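(* Fix $k \geq 1$. The following are equivalent over $\mathsf{RCA}_0$: \begin{enumerate} \item Determinacy for wellfounded binary choice game trees: for every binary choice tree $T$ with no infinite path, the game on $T$ is determined. \item $\Delta^0_1$-$\mathsf{Det}$ for binary choice game trees: for every binary choice tree $T$ and every $\Delta^0_1$ formula $\phi(x)$, the game $G(T,\phi)$ is determined. \item $(\Sigma^0_1)_k$-$\mathsf{Det}$ for binary choice game trees: for every binary choice tree $T$ and every formula $\phi(x)$ in the class $(\Sigma^0_1)_k$, the game $G(T,\phi)$ is determined. \item $\mathsf{ACA}_0$ (arithmetical comprehension). \end{enumerate}
   Context: Work in second-order arithmetic; formulas may contain second-order (set) parameters. For a sequence $x$ (finite or infinite) of natural numbers, $x[n]$ denotes its initial segment of length $n$. A set $T$ of (codes for) finite sequences of natural numbers is a binary choice tree if (i) it is closed under initial segments: $\tau \in T \rightarrow \forall n<|\tau|\ \tau[n]\in T$, and (ii) every node has at most two immediate successors: $\tau\in T \rightarrow \exists^{\leq 2} n\ \tau^\frown n \in T$. A (regular) strategy for player I is any function $\sigma$ from even-length finite sequences of naturals to $\mathbb{N}$; a strategy for player II is any function $\tau$ from odd-length finite sequences to $\mathbb{N}$. The play $\sigma\otimes\tau = \langle n_i\rangle_{i\in\mathbb{N}}$ is defined by $n_0=\sigma(\emptyset)$ and $n_{i+1} = \sigma(\langle n_0,\dots,n_i\rangle)$ if $i$ is odd (so $i+1$ even), $n_{i+1}=\tau(\langle n_0,\dots,n_i\rangle)$ if $i$ is even; i.e. I plays the moves at even indices and II those at odd indices.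 Games $G(T,\phi)$: for a binary choice tree $T$ let $\mu_I(x) \equiv \exists n\,(x[2n+1]\notin T \wedge x[2n]\in T)$ (player I first played outside $T$) and $\mu_{II}(x)\equiv \exists n\,(x[2n+2]\notin T \wedge x[2n+1]\in T)$. For a formula $\phi(x)$ with distinguished free variable $x$ ranging over $\mathbb{N}^{\mathbb{N}}$, put $\psi(x)\equiv \neg\mu_I(x)\wedge(\phi(x)\vee\mu_{II}(x))$. The game $G(T,\phi)$ is determined if $\exists\sigma\,\forall\tau\,\psi(\sigma\otimes\tau)\ \vee\ \exists\tau\,\forall\sigma\,\neg\psi(\sigma\otimes\tau)$, with $\sigma$ ranging over strategies for I and $\tau$ over strategies for II. A $\Delta^0_1$ formula is a $\Sigma^0_1$ formula equivalent to a $\Pi^0_1$ formula. $(\Sigma^0_1)_k$ is the $k$-th level of the difference hierarchy over $\Sigma^0_1$: the class of sets (formulas) obtained from $k$ nested differences of $\Sigma^0_1$ (open) sets. Game on a wellfounded binary choice tree $T$ (a binary choice tree with no infinite path): for a finite sequence $u$ define $W_I(u)$ iff there is $n<|u|$ with $u[n]\notin T$, $u[j]\in T$ for all $j<n$, and $n$ odd; $W_{II}(u)$ is defined identically but with $n$ even. The game on $T$ is determined iff either there is a strategy $\sigma$ for I such that for every strategy $\tau$ for II, $\exists n\, W_I((\sigma\otimes\tau)[n])$; or there is a strategy $\tau$ for II such that for every strategy $\sigma$ for I, $\exists n\, W_{II}((\sigma\otimes\tau)[n])$.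
   Formalization: Binary choice trees are taken nonempty (for empty T the game is unrestricted, so items 2 and 3 would exceed ACA_0), and the parities in W_I and W_II are swapped so that the player who first leaves T loses (as written, I wins by leaving at once and item 1 is trivial). *)

theory Defs
  imports Main
begin

section \<open>The language of second-order arithmetic\<close>

text \<open>Number variables and set variables are two separate families, both indexed by \<^typ>\<open>nat\<close>.\<close>

datatype trm = Var nat | Zero | One | Plus trm trm | Times trm trm

datatype fml =
    Eq trm trm
  | Lt trm trm
  | Mem trm nat
  | Neg fml
  | Conj fml fml
  | Disj fml fml
  | Imp fml fml
  | ExN nat fml
  | AllN nat fml
  | ExS nat fml
  | AllS nat fml

primrec tvars :: "trm \<Rightarrow> nat set" where
  "tvars (Var x) = {x}"
| "tvars Zero = {}"
| "tvars One = {}"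
| "tvars (Plus s t) = tvars s \<union> tvars t"
| "tvars (Times s t) = tvars s \<union> tvars t"

inductive bounded_fml :: "fml \<Rightarrow> bool" where
  "bounded_fml (Eq s t)"
| "bounded_fml (Lt s t)"
| "bounded_fml (Mem t X)"
| "bounded_fml p \<Longrightarrow> bounded_fml (Neg p)"
| "bounded_fml p \<Longrightarrow> bounded_fml q \<Longrightarrow> bounded_fml (Conj p q)"
| "bounded_fml p \<Longrightarrow> bounded_fml q \<Longrightarrow> bounded_fml (Disj p q)"
| "bounded_fml p \<Longrightarrow> bounded_fml q \<Longrightarrow> bounded_fml (Imp p q)"
| "bounded_fml p \<Longrightarrow> x \<notin> tvars t \<Longrightarrow> bounded_fml (AllN x (Imp (Lt (Var x) t) p))"
| "bounded_fml p \<Longrightarrow> x \<notin> tvars t \<Longrightarrow> bounded_fml (ExN x (Conj (Lt (Var x) t) p))"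

definition sigma01 :: "fml \<Rightarrow> bool" where
  "sigma01 p \<longleftrightarrow> (\<exists>x q. bounded_fml q \<and> p = ExN x q)"

definition pi01 :: "fml \<Rightarrow> bool" where
  "pi01 p \<longleftrightarrow> (\<exists>x q. bounded_fml q \<and> p = AllN x q)"

text \<open>Level \<open>k \<ge> 1\<close> of the difference hierarchy over \<open>\<Sigma>\<^sup>0\<^sub>1\<close>:
  \<open>A\<^sub>1 - (A\<^sub>2 - (\<dots> - A\<^sub>k))\<close>. There is no level \<open>0\<close>.\<close>

inductive diff_sigma01 :: "nat \<Rightarrow> fml \<Rightarrow> bool" where
  "sigma01 p \<Longrightarrow> diff_sigma01 1 p"
| "sigma01 p \<Longrightarrow> diff_sigma01 k q \<Longrightarrow> diff_sigma01 (Suc k) (Conj p (Neg q))"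

primrec arithmetical :: "fml \<Rightarrow> bool" where
  "arithmetical (Eq s t) \<longleftrightarrow> True"
| "arithmetical (Lt s t) \<longleftrightarrow> True"
| "arithmetical (Mem t X) \<longleftrightarrow> True"
| "arithmetical (Neg p) \<longleftrightarrow> arithmetical p"
| "arithmetical (Conj p q) \<longleftrightarrow> arithmetical p \<and> arithmetical q"
| "arithmetical (Disj p q) \<longleftrightarrow> arithmetical p \<and> arithmetical q"
| "arithmetical (Imp p q) \<longleftrightarrow> arithmetical p \<and> arithmetical q"
| "arithmetical (ExN x p) \<longleftrightarrow> arithmetical p"
| "arithmetical (AllN x p) \<longleftrightarrow> arithmetical p"
| "arithmetical (ExS X p) \<longleftrightarrow> False"
| "arithmetical (AllS X p) \<longleftrightarrow> False"


section \<open>Structures and satisfaction\<close>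

text \<open>Henkin structures: the numbers are the elements of the type \<^typ>\<open>'a\<close> (possibly
  nonstandard), and the set quantifiers range over the family \<open>sets M\<close> of subsets of it.\<close>

record 'a l2_struct =
  num0 :: 'a ("\<zero>\<index>")
  num1 :: 'a ("\<one>\<index>")
  add :: "'a \<Rightarrow> 'a \<Rightarrow> 'a" (infixl "\<oplus>\<index>" 65)
  mul :: "'a \<Rightarrow> 'a \<Rightarrow> 'a" (infixl "\<otimes>\<index>" 70)
  less :: "'a \<Rightarrow> 'a \<Rightarrow> bool" (infix "\<prec>\<index>" 50)
  sets :: "'a set set"

context
  fixes M :: "'a l2_struct" (structure)
begin

primrec tval :: "(nat \<Rightarrow> 'a) \<Rightarrow> trm \<Rightarrow> 'a" where
  "tval e (Var x) = e x"
| "tval e Zero = \<zero>"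
| "tval e One = \<one>"
| "tval e (Plus s t) = tval e s \<oplus> tval e t"
| "tval e (Times s t) = tval e s \<otimes> tval e t"

primrec sat :: "(nat \<Rightarrow> 'a) \<Rightarrow> (nat \<Rightarrow> 'a set) \<Rightarrow> fml \<Rightarrow> bool" where
  "sat e E (Eq s t) \<longleftrightarrow> tval e s = tval e t"
| "sat e E (Lt s t) \<longleftrightarrow> tval e s \<prec> tval e t"
| "sat e E (Mem t X) \<longleftrightarrow> tval e t \<in> E X"
| "sat e E (Neg p) \<longleftrightarrow> \<not> sat e E p"
| "sat e E (Conj p q) \<longleftrightarrow> sat e E p \<and> sat e E q"
| "sat e E (Disj p q) \<longleftrightarrow> sat e E p \<or> sat e E q"
| "sat e E (Imp p q) \<longleftrightarrow> (sat e E p \<longrightarrow> sat e E q)"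
| "sat e E (ExN x p) \<longleftrightarrow> (\<exists>a. sat (e(x := a)) E p)"
| "sat e E (AllN x p) \<longleftrightarrow> (\<forall>a. sat (e(x := a)) E p)"
| "sat e E (ExS X p) \<longleftrightarrow> (\<exists>A\<in>sets M. sat e (E(X := A)) p)"
| "sat e E (AllS X p) \<longleftrightarrow> (\<forall>A\<in>sets M. sat e (E(X := A)) p)"

definition set_assignment :: "(nat \<Rightarrow> 'a set) \<Rightarrow> bool" where
  "set_assignment E \<longleftrightarrow> range E \<subseteq> sets M"


section \<open>The systems \<open>RCA\<^sub>0\<close> and \<open>ACA\<^sub>0\<close>\<close>

text \<open>Number and set parameters of the schemes are supplied by the assignments \<open>e\<close> and \<open>E\<close>.\<close>

definition basic_axioms :: bool where
  "basic_axioms \<longleftrightarrow>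
     (\<forall>n. n \<oplus> \<one> \<noteq> \<zero>) \<and>
     (\<forall>m n. m \<oplus> \<one> = n \<oplus> \<one> \<longrightarrow> m = n) \<and>
     (\<forall>m. m \<oplus> \<zero> = m) \<and>
     (\<forall>m n. m \<oplus> (n \<oplus> \<one>) = (m \<oplus> n) \<oplus> \<one>) \<and>
     (\<forall>m. m \<otimes> \<zero> = \<zero>) \<and>
     (\<forall>m n. m \<otimes> (n \<oplus> \<one>) = (m \<otimes> n) \<oplus> m) \<and>
     (\<forall>m. \<not> m \<prec> \<zero>) \<and>
     (\<forall>m n. m \<prec> n \<oplus> \<one> \<longleftrightarrow> m \<prec> n \<or> m = n)"

definition sigma01_induction :: bool where
  "sigma01_induction \<longleftrightarrow>
     (\<forall>p x e E. sigma01 p \<longrightarrow> set_assignment E \<longrightarrow>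
        sat (e(x := \<zero>)) E p \<longrightarrow>
        (\<forall>n. sat (e(x := n)) E p \<longrightarrow> sat (e(x := n \<oplus> \<one>)) E p) \<longrightarrow>
        (\<forall>n. sat (e(x := n)) E p))"

definition delta01_comprehension :: bool where
  "delta01_comprehension \<longleftrightarrow>
     (\<forall>p q x e E. sigma01 p \<longrightarrow> pi01 q \<longrightarrow> set_assignment E \<longrightarrow>
        (\<forall>n. sat (e(x := n)) E p \<longleftrightarrow> sat (e(x := n)) E q) \<longrightarrow>
        {n. sat (e(x := n)) E p} \<in> sets M)"

definition set_induction :: bool where
  "set_induction \<longleftrightarrow>
     (\<forall>X\<in>sets M. \<zero> \<in> X \<longrightarrow> (\<forall>n. n \<in> X \<longrightarrow> n \<oplus> \<one> \<in> X) \<longrightarrow> (\<forall>n. n \<in> X))"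

definition arithmetical_comprehension :: bool where
  "arithmetical_comprehension \<longleftrightarrow>
     (\<forall>p x e E. arithmetical p \<longrightarrow> set_assignment E \<longrightarrow> {n. sat (e(x := n)) E p} \<in> sets M)"

definition RCA0 :: bool where
  "RCA0 \<longleftrightarrow> sets M \<noteq> {} \<and> basic_axioms \<and> sigma01_induction \<and> delta01_comprehension"

definition ACA0 :: bool where
  "ACA0 \<longleftrightarrow> sets M \<noteq> {} \<and> basic_axioms \<and> set_induction \<and> arithmetical_comprehension"


section \<open>Coding of finite sequences\<close>

text \<open>From here on every quantifier ranges over the numbers or over \<open>sets M\<close>, so that each
  predicate is the interpretation in \<open>M\<close> of a formula of second-order arithmetic. The coding is the
  one of Simpson, Subsystems of Second Order Arithmetic, II.2: a finite set is \<open>{i. i < k \<and> m(i+1)+1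
  divides n}\<close> for some \<open>k\<close>, \<open>m\<close>, \<open>n\<close>, its code is the least such \<open>(k,(m,n))\<close>, and finite
  sequences are identified with their graphs.\<close>

definition pair :: "'a \<Rightarrow> 'a \<Rightarrow> 'a" where
  "pair m n = (m \<oplus> n) \<otimes> (m \<oplus> n) \<oplus> m"

definition divides :: "'a \<Rightarrow> 'a \<Rightarrow> bool" where
  "divides d n \<longleftrightarrow> (\<exists>q. n = d \<otimes> q)"

definition is_triple :: "'a \<Rightarrow> bool" where
  "is_triple c \<longleftrightarrow> (\<exists>k m n. c = pair k (pair m n))"

definition members :: "'a \<Rightarrow> 'a set" where
  "members c = {i. \<exists>k m n. c = pair k (pair m n) \<and> i \<prec> k \<and> divides (m \<otimes> (i \<oplus> \<one>) \<oplus> \<one>) n}"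

definition set_code :: "'a \<Rightarrow> bool" where
  "set_code c \<longleftrightarrow> is_triple c \<and> (\<forall>c'. c' \<prec> c \<longrightarrow> is_triple c' \<longrightarrow> members c' \<noteq> members c)"

text \<open>\<open>seq_len s l\<close>: \<open>s\<close> is the code of a finite sequence of length \<open>l\<close>.\<close>

definition seq_len :: "'a \<Rightarrow> 'a \<Rightarrow> bool" where
  "seq_len s l \<longleftrightarrow> set_code s \<and>
     (\<forall>p\<in>members s. \<exists>i j. i \<prec> l \<and> p = pair i j) \<and>
     (\<forall>i. i \<prec> l \<longrightarrow> (\<exists>!j. pair i j \<in> members s))"

text \<open>\<open>snoc s a t\<close>: \<open>t\<close> is \<open>s\<close> extended by the entry \<open>a\<close>.\<close>

definition snoc :: "'a \<Rightarrow> 'a \<Rightarrow> 'a \<Rightarrow> bool" where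
  "snoc s a t \<longleftrightarrow> (\<exists>l. seq_len s l \<and> seq_len t (l \<oplus> \<one>) \<and>
     (\<forall>i j. pair i j \<in> members t \<longleftrightarrow> pair i j \<in> members s \<or> (i = l \<and> j = a)))"

text \<open>\<open>seg x n t\<close>: \<open>t = x[n]\<close>, where \<open>x\<close> is the graph of a finite or infinite sequence. The graph
  of the finite sequence coded by \<open>s\<close> is \<open>members s\<close>.\<close>

definition seg :: "'a set \<Rightarrow> 'a \<Rightarrow> 'a \<Rightarrow> bool" where
  "seg x n t \<longleftrightarrow> seq_len t n \<and>
     (\<forall>i j. pair i j \<in> members t \<longleftrightarrow> i \<prec> n \<and> pair i j \<in> x)"

definition seg_in :: "'a set \<Rightarrow> 'a \<Rightarrow> 'a set \<Rightarrow> bool" where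
  "seg_in x n T \<longleftrightarrow> (\<exists>t\<in>T. seg x n t)"

definition infinite_seq :: "'a set \<Rightarrow> bool" where
  "infinite_seq x \<longleftrightarrow> x \<in> sets M \<and>
     (\<forall>p\<in>x. \<exists>i j. p = pair i j) \<and> (\<forall>i. \<exists>!j. pair i j \<in> x)"

definition is_even :: "'a \<Rightarrow> bool" where
  "is_even n \<longleftrightarrow> (\<exists>m. n = m \<oplus> m)"

definition is_odd :: "'a \<Rightarrow> bool" where
  "is_odd n \<longleftrightarrow> (\<exists>m. n = m \<oplus> m \<oplus> \<one>)"


section \<open>Binary choice trees\<close>

text \<open>Trees are nonempty, so they contain the empty sequence. For the empty tree nobody would
  ever be the first to leave, and the game below would be the unrestricted game on Baire space.\<close>

definition binary_choice_tree :: "'a set \<Rightarrow> bool" where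
  "binary_choice_tree T \<longleftrightarrow> T \<in> sets M \<and> T \<noteq> {} \<and>
     (\<forall>s\<in>T. \<exists>l. seq_len s l) \<and>
     (\<forall>s\<in>T. \<forall>l. seq_len s l \<longrightarrow> (\<forall>n. n \<prec> l \<longrightarrow> seg_in (members s) n T)) \<and>
     (\<forall>s\<in>T. \<forall>a b c. (\<exists>t\<in>T. snoc s a t) \<longrightarrow> (\<exists>t\<in>T. snoc s b t) \<longrightarrow> (\<exists>t\<in>T. snoc s c t) \<longrightarrow>
        a = b \<or> a = c \<or> b = c)"

definition wellfounded_tree :: "'a set \<Rightarrow> bool" where
  "wellfounded_tree T \<longleftrightarrow> \<not> (\<exists>x. infinite_seq x \<and> (\<forall>n. seg_in x n T))"


section \<open>Strategies, plays, determinacy\<close>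

text \<open>A strategy is (the graph of) a function on the sequences of even, respectively odd,
  length.\<close>

definition strategy_I :: "'a set \<Rightarrow> bool" where
  "strategy_I \<sigma> \<longleftrightarrow> \<sigma> \<in> sets M \<and>
     (\<forall>p\<in>\<sigma>. \<exists>s l a. seq_len s l \<and> is_even l \<and> p = pair s a) \<and>
     (\<forall>s l. seq_len s l \<longrightarrow> is_even l \<longrightarrow> (\<exists>!a. pair s a \<in> \<sigma>))"

definition strategy_II :: "'a set \<Rightarrow> bool" where
  "strategy_II \<tau> \<longleftrightarrow> \<tau> \<in> sets M \<and>
     (\<forall>p\<in>\<tau>. \<exists>s l a. seq_len s l \<and> is_odd l \<and> p = pair s a) \<and>
     (\<forall>s l. seq_len s l \<longrightarrow> is_odd l \<longrightarrow> (\<exists>!a. pair s a \<in> \<tau>))"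

text \<open>\<open>is_play \<sigma> \<tau> x\<close>: \<open>x = \<sigma> \<otimes> \<tau>\<close>. In models of \<open>RCA\<^sub>0\<close> there is exactly one such \<open>x\<close>,
  by primitive recursion.\<close>

definition is_play :: "'a set \<Rightarrow> 'a set \<Rightarrow> 'a set \<Rightarrow> bool" where
  "is_play \<sigma> \<tau> x \<longleftrightarrow> infinite_seq x \<and>
     (\<forall>i. \<exists>s a. seg x i s \<and> pair i a \<in> x \<and>
        (is_even i \<longrightarrow> pair s a \<in> \<sigma>) \<and> (is_odd i \<longrightarrow> pair s a \<in> \<tau>))"

text \<open>\<open>A\<close> and \<open>B\<close> are the winning conditions of I and II.\<close>

definition determined :: "('a set \<Rightarrow> bool) \<Rightarrow> ('a set \<Rightarrow> bool) \<Rightarrow> bool" where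
  "determined A B \<longleftrightarrow>
     (\<exists>\<sigma>. strategy_I \<sigma> \<and> (\<forall>\<tau>. strategy_II \<tau> \<longrightarrow> (\<exists>x. is_play \<sigma> \<tau> x \<and> A x))) \<or>
     (\<exists>\<tau>. strategy_II \<tau> \<and> (\<forall>\<sigma>. strategy_I \<sigma> \<longrightarrow> (\<exists>x. is_play \<sigma> \<tau> x \<and> B x)))"


section \<open>Games on wellfounded trees\<close>

text \<open>The player who first leaves \<open>T\<close> loses. The last move of a position of length \<open>n\<close> was made by
  I if \<open>n\<close> is odd and by II if \<open>n\<close> is even; so I wins if the first initial segment outside \<open>T\<close> has
  even length.\<close>

definition W_I :: "'a set \<Rightarrow> 'a \<Rightarrow> bool" where
  "W_I T u \<longleftrightarrow> (\<exists>l n. seq_len u l \<and> n \<prec> l \<and> \<not> seg_in (members u) n T \<and>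
     (\<forall>j. j \<prec> n \<longrightarrow> seg_in (members u) j T) \<and> is_even n)"

definition W_II :: "'a set \<Rightarrow> 'a \<Rightarrow> bool" where
  "W_II T u \<longleftrightarrow> (\<exists>l n. seq_len u l \<and> n \<prec> l \<and> \<not> seg_in (members u) n T \<and>
     (\<forall>j. j \<prec> n \<longrightarrow> seg_in (members u) j T) \<and> is_odd n)"

definition wellfounded_det :: bool where
  "wellfounded_det \<longleftrightarrow>
     (\<forall>T. binary_choice_tree T \<longrightarrow> wellfounded_tree T \<longrightarrow>
        determined (\<lambda>x. \<exists>n u. seg x n u \<and> W_I T u) (\<lambda>x. \<exists>n u. seg x n u \<and> W_II T u))"


section \<open>The games \<open>G(T,\<phi>)\<close>\<close>

definition mu_I :: "'a set \<Rightarrow> 'a set \<Rightarrow> bool" where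
  "mu_I T x \<longleftrightarrow> (\<exists>n. \<not> seg_in x (n \<oplus> n \<oplus> \<one>) T \<and> seg_in x (n \<oplus> n) T)"

definition mu_II :: "'a set \<Rightarrow> 'a set \<Rightarrow> bool" where
  "mu_II T x \<longleftrightarrow> (\<exists>n. \<not> seg_in x (n \<oplus> n \<oplus> \<one> \<oplus> \<one>) T \<and> seg_in x (n \<oplus> n \<oplus> \<one>) T)"

definition psi :: "'a set \<Rightarrow> ('a set \<Rightarrow> bool) \<Rightarrow> 'a set \<Rightarrow> bool" where
  "psi T P x \<longleftrightarrow> \<not> mu_I T x \<and> (P x \<or> mu_II T x)"

definition game_determined :: "'a set \<Rightarrow> ('a set \<Rightarrow> bool) \<Rightarrow> bool" where
  "game_determined T P \<longleftrightarrow> determined (psi T P) (\<lambda>x. \<not> psi T P x)"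

text \<open>In the formula \<open>p\<close> the set variable \<open>X\<close> is distinguished and stands for (the graph of) the
  play; all other free variables are parameters.\<close>

definition delta01_det :: bool where
  "delta01_det \<longleftrightarrow>
     (\<forall>T p q X e E. binary_choice_tree T \<longrightarrow> set_assignment E \<longrightarrow> sigma01 p \<longrightarrow> pi01 q \<longrightarrow>
        (\<forall>x. infinite_seq x \<longrightarrow> (sat e (E(X := x)) p \<longleftrightarrow> sat e (E(X := x)) q)) \<longrightarrow>
        game_determined T (\<lambda>x. sat e (E(X := x)) p))"

definition diff_sigma01_det :: "nat \<Rightarrow> bool" where
  "diff_sigma01_det k \<longleftrightarrow>
     (\<forall>T p X e E. binary_choice_tree T \<longrightarrow> set_assignment E \<longrightarrow> diff_sigma01 k p \<longrightarrow>
        game_determined T (\<lambda>x. sat e (E(X := x)) p))"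

end

end

theory Submission
  imports Defs
begin

text \<open>Everything is done in an arbitrary Henkin model, with semantic classes of bounded,
  \<open>\<Sigma>\<^sup>0\<^sub>1\<close> and \<open>\<Delta>\<^sup>0\<^sub>1\<close> predicates in place of formulas.

  Under arithmetical comprehension, a game whose payoff for a player is a difference \<open>A - P\<close> with
  \<open>A\<close> open is solved from the game \<open>P\<close> with the roles exchanged: the player tries to reach a
  position that secures \<open>A\<close> and lies in the part won there by avoiding \<open>P\<close>. Since the tree is
  binary, a position from which this can be forced has a finite set of positions as a witness, so
  the winning region is arithmetical. Iterating this, starting from the empty payoff, settles
  every level of the difference hierarchy, and level \<open>1\<close> contains the \<open>\<Delta>\<^sup>0\<^sub>1\<close> games.

  Conversely, let \<open>A\<close> be a set whose projection does not exist. In the game on \<open>Tr A\<close> player I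
  decides one number after the other, giving witnesses for positive answers, and II may challenge
  negative answers by a witness. An infinite play would compute the projection, so \<open>Tr A\<close> is
  wellfounded, but neither player has a winning strategy.\<close>

text \<open>The obstacle throughout is definability: a set, a strategy or a play exists in the model
  only if it has a Delta01 description, and induction is available only for Sigma01 predicates. The
  classes \<open>B\<close>, \<open>S\<close>, \<open>D\<close>, together with the class
  \<open>F\<close> of functions with Sigma01 graph, turn every such obligation into a run of
  introduction rules, and de Bruijn environments spare the choice of fresh variables. The two
  directions of the theorem meet in \<open>jump_closed\<close>, closure under projection. It makes
  every Sigma01 predicate Delta01, and \<open>D\<close> is then closed under number quantifiers.

  Without binary branching the attractor would be a genuine inductive definition, in general beyond
  arithmetical comprehension. Here a finite witness replaces the stages of the induction, and the
  boundedness of coded sets replaces a rank. The winning clauses of \<open>solution\<close>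
  constrain a play only from some stage \<open>n0\<close> on, because the strategy for the outer
  game hands over to that for the inner game when the play enters the open set.\<close>

primrec trename :: "(nat \<Rightarrow> nat) \<Rightarrow> trm \<Rightarrow> trm" where
  "trename r (Var x) = Var (r x)"
| "trename r Zero = Zero"
| "trename r One = One"
| "trename r (Plus s t) = Plus (trename r s) (trename r t)"
| "trename r (Times s t) = Times (trename r s) (trename r t)"

text \<open>Bound variables are renamed along with the free ones. For injective maps nothing is
  captured, which spares a substitution operation on formulas.\<close>

primrec rename :: "(nat \<Rightarrow> nat) \<Rightarrow> (nat \<Rightarrow> nat) \<Rightarrow> fml \<Rightarrow> fml" where
  "rename r R (Eq s t) = Eq (trename r s) (trename r t)"
| "rename r R (Lt s t) = Lt (trename r s) (trename r t)"
| "rename r R (Mem t X) = Mem (trename r t) (R X)"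
| "rename r R (Neg p) = Neg (rename r R p)"
| "rename r R (Conj p q) = Conj (rename r R p) (rename r R q)"
| "rename r R (Disj p q) = Disj (rename r R p) (rename r R q)"
| "rename r R (Imp p q) = Imp (rename r R p) (rename r R q)"
| "rename r R (ExN x p) = ExN (r x) (rename r R p)"
| "rename r R (AllN x p) = AllN (r x) (rename r R p)"
| "rename r R (ExS X p) = ExS (R X) (rename r R p)"
| "rename r R (AllS X p) = AllS (R X) (rename r R p)"

lemma tval_trename: "tval M e (trename r t) = tval M (\<lambda>i. e (r i)) t"
  by (induct t) auto

lemma tvars_trename: "tvars (trename r t) = r ` tvars t"
  by (induct t) auto

lemma update_comp: "inj r \<Longrightarrow> (\<lambda>i. (e(r x := a)) (r i)) = (\<lambda>i. e (r i))(x := a)"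
  by (auto simp: inj_eq fun_eq_iff)

lemma sat_rename:
  "inj r \<Longrightarrow> inj R \<Longrightarrow> sat M e E (rename r R p) = sat M (\<lambda>i. e (r i)) (\<lambda>i. E (R i)) p"
proof (induct p arbitrary: e E)
qed (simp_all only: sat.simps rename.simps tval_trename update_comp)

lemma bounded_rename: "bounded_fml p \<Longrightarrow> inj r \<Longrightarrow> bounded_fml (rename r R p)"
  by (induct rule: bounded_fml.induct)
    (auto intro: bounded_fml.intros simp: tvars_trename inj_image_mem_iff)

lemma tval_cong: "(\<And>i. i \<in> tvars t \<Longrightarrow> e i = e' i) \<Longrightarrow> tval M e t = tval M e' t"
  by (induct t) auto

lemma finite_tvars: "finite (tvars t)"
  by (induct t) auto

lemma tvars_bounded: "\<exists>N. \<forall>i\<in>tvars t. i < (N::nat)"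
  using finite_tvars[of t] finite_nat_set_iff_bounded by auto

text \<open>Merges two finite supports, for the binary connectives in \<open>sat_cong\<close>.
  \<open>E\<close> is carried along because the threshold must not depend on the set
  assignment.\<close>

lemma agree_both:
  fixes R R' :: "(nat \<Rightarrow> 'a) \<Rightarrow> (nat \<Rightarrow> 'a) \<Rightarrow> 'b \<Rightarrow> bool"
  assumes "\<exists>N::nat. \<forall>e e' E. (\<forall>i<N. e i = e' i) \<longrightarrow> R e e' E"
    "\<exists>N::nat. \<forall>e e' E. (\<forall>i<N. e i = e' i) \<longrightarrow> R' e e' E"
  shows "\<exists>N::nat. \<forall>e e' E. (\<forall>i<N. e i = e' i) \<longrightarrow> R e e' E \<and> R' e e' E"
proof -
  from assms(1) obtain a where a: "\<forall>e e' E. (\<forall>i<a. e i = e' i) \<longrightarrow> R e e' E" ..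
  from assms(2) obtain b where b: "\<forall>e e' E. (\<forall>i<b. e i = e' i) \<longrightarrow> R' e e' E" ..
  show ?thesis
  proof (intro exI[of _ "max a b"] allI impI)
    fix e e' :: "nat \<Rightarrow> 'a" and E :: 'b assume "\<forall>i<max a b. e i = e' i"
    then have 1: "\<forall>i<a. e i = e' i" and 2: "\<forall>i<b. e i = e' i" by simp_all
    show "R e e' E \<and> R' e e' E" using a[rule_format, of e e' E] b[rule_format, of e e' E] 1 2 by simp
  qed
qed

text \<open>Only finitely many number variables occur in a formula. This supplies fresh variables in
  \<open>formula_lower\<close> and, in \<open>S_D\<close>, reduces a predicate to finitely many
  arguments.\<close>

lemma sat_cong: "\<exists>N. \<forall>e e' E. (\<forall>i<N. e i = e' i) \<longrightarrow> sat M e E p = sat M e' E p"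
proof (induct p)
  case (Eq s t)
  obtain a b where "\<forall>i\<in>tvars s. i < (a::nat)" "\<forall>i\<in>tvars t. i < (b::nat)"
    using tvars_bounded by metis
  then have "\<forall>e e'. (\<forall>i<max a b. e i = e' i) \<longrightarrow> tval M e s = tval M e' s \<and> tval M e t = tval M e' t"
    by (auto intro!: tval_cong)
  then show ?case by (metis sat.simps(1,2))
next
  case (Lt s t)
  obtain a b where "\<forall>i\<in>tvars s. i < (a::nat)" "\<forall>i\<in>tvars t. i < (b::nat)"
    using tvars_bounded by metis
  then have "\<forall>e e'. (\<forall>i<max a b. e i = e' i) \<longrightarrow> tval M e s = tval M e' s \<and> tval M e t = tval M e' t"
    by (auto intro!: tval_cong)
  then show ?case by (metis sat.simps(1,2))
next
  case (Mem t X)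
  obtain a where "\<forall>i\<in>tvars t. i < (a::nat)"
    using tvars_bounded by metis
  then have "\<forall>e e'. (\<forall>i<a. e i = e' i) \<longrightarrow> tval M e t = tval M e' t"
    by (auto intro!: tval_cong)
  then show ?case by (metis sat.simps(3))
next
  case (Neg p) then show ?case by auto
next
  case (Conj p q)
  from agree_both[OF Conj] show ?case unfolding sat.simps by (rule ex_forward) blast
next
  case (Disj p q)
  from agree_both[OF Disj] show ?case unfolding sat.simps by (rule ex_forward) blast
next
  case (Imp p q)
  from agree_both[OF Imp] show ?case unfolding sat.simps by (rule ex_forward) blast
next
  case (ExN x p)
  then obtain N where N: "\<forall>e e' E. (\<forall>i<N. e i = e' i) \<longrightarrow> sat M e E p = sat M e' E p" by auto
  show ?case
  proof (intro exI[of _ N] allI impI)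
    fix e e' :: "nat \<Rightarrow> 'a" and E assume "\<forall>i<N. e i = e' i"
    then have "sat M (e(x := a)) E p = sat M (e'(x := a)) E p" for a using N by simp
    then show "sat M e E (ExN x p) = sat M e' E (ExN x p)" by simp
  qed
next
  case (AllN x p)
  then obtain N where N: "\<forall>e e' E. (\<forall>i<N. e i = e' i) \<longrightarrow> sat M e E p = sat M e' E p" by auto
  show ?case
  proof (intro exI[of _ N] allI impI)
    fix e e' :: "nat \<Rightarrow> 'a" and E assume "\<forall>i<N. e i = e' i"
    then have "sat M (e(x := a)) E p = sat M (e'(x := a)) E p" for a using N by simp
    then show "sat M e E (AllN x p) = sat M e' E (AllN x p)" by simp
  qed
next
  case (ExS X p)
  then obtain N where N: "\<forall>e e' E. (\<forall>i<N. e i = e' i) \<longrightarrow> sat M e E p = sat M e' E p" by auto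
  show ?case
  proof (intro exI[of _ N] allI impI)
    fix e e' :: "nat \<Rightarrow> 'a" and E assume "\<forall>i<N. e i = e' i"
    then have "sat M e E p = sat M e' E p" for E using N by blast
    then show "sat M e E (ExS X p) = sat M e' E (ExS X p)" by simp
  qed
next
  case (AllS X p)
  then obtain N where N: "\<forall>e e' E. (\<forall>i<N. e i = e' i) \<longrightarrow> sat M e E p = sat M e' E p" by auto
  show ?case
  proof (intro exI[of _ N] allI impI)
    fix e e' :: "nat \<Rightarrow> 'a" and E assume "\<forall>i<N. e i = e' i"
    then have "sat M e E p = sat M e' E p" for E using N by blast
    then show "sat M e E (AllS X p) = sat M e' E (AllS X p)" by simp
  qed
qed

text \<open>The permutation of variables that turns the de Bruijn index \<open>0\<close> into the variable \<open>N\<close>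
  and lowers the other indices up to \<open>N\<close>.\<close>

definition lower :: "nat \<Rightarrow> nat \<Rightarrow> nat" where
  "lower N i = (case i of 0 \<Rightarrow> N | Suc j \<Rightarrow> if j < N then j else Suc j)"

lemma inj_lower: "inj (lower N)"
  by (auto simp: inj_def lower_def split: nat.splits if_splits)

lemma lower_env: "i < N \<Longrightarrow> (e(N := a)) (lower N i) = case_nat a e i"
  by (auto simp: lower_def split: nat.splits)

lemma bounded_arithmetical: "bounded_fml p \<Longrightarrow> arithmetical p"
  by (induct rule: bounded_fml.induct) auto

text \<open>Serves \<open>bounded_use\<close>, where the variable of a bounded quantifier is
  replaced by the bound of that quantifier.\<close>

primrec tsubst :: "nat \<Rightarrow> trm \<Rightarrow> trm \<Rightarrow> trm" where
  "tsubst x t (Var y) = (if y = x then t else Var y)"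
| "tsubst x t Zero = Zero"
| "tsubst x t One = One"
| "tsubst x t (Plus u v) = Plus (tsubst x t u) (tsubst x t v)"
| "tsubst x t (Times u v) = Times (tsubst x t u) (tsubst x t v)"

lemma tval_tsubst: "tval M e (tsubst x t u) = tval M (e(x := tval M e t)) u"
  by (induct u) auto

section \<open>Semantic classes of predicates in a model of \<open>RCA0\<close>\<close>

locale rca0 = fixes M :: "'a l2_struct" (structure)
  assumes RCA0: "RCA0 M"
begin

text \<open>Predicates of environments, read with de Bruijn indices: \<open>B\<close>, \<open>S\<close>, \<open>D\<close> are those that are
  bounded, \<open>\<Sigma>\<^sup>0\<^sub>1\<close> and \<open>\<Delta>\<^sup>0\<^sub>1\<close> in set parameters of the model.\<close>

definition B :: "((nat \<Rightarrow> 'a) \<Rightarrow> bool) \<Rightarrow> bool" where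
  "B P \<longleftrightarrow> (\<exists>p E. bounded_fml p \<and> set_assignment M E \<and> (\<forall>e. sat M e E p = P e))"

definition TT :: "((nat \<Rightarrow> 'a) \<Rightarrow> 'a) \<Rightarrow> bool" where
  "TT t \<longleftrightarrow> (\<exists>u. \<forall>e. tval M e u = t e)"

definition S :: "((nat \<Rightarrow> 'a) \<Rightarrow> bool) \<Rightarrow> bool" where
  "S P \<longleftrightarrow> (\<exists>Q. B Q \<and> (\<forall>e. P e \<longleftrightarrow> (\<exists>a. Q (case_nat a e))))"

definition D :: "((nat \<Rightarrow> 'a) \<Rightarrow> bool) \<Rightarrow> bool" where
  "D P \<longleftrightarrow> S P \<and> S (\<lambda>e. \<not> P e)"

lemma basic: "basic_axioms M" and S_ind_ax: "sigma01_induction M"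
  and compr_ax: "delta01_comprehension M" and sets_nonempty: "sets M \<noteq> {}"
  using RCA0 by (auto simp: RCA0_def)

lemma TT_var: "TT (\<lambda>e. e k)" unfolding TT_def by (rule exI[of _ "Var k"]) simp
lemma TT_zero: "TT (\<lambda>e. \<zero>)" unfolding TT_def by (rule exI[of _ Zero]) simp
lemma TT_one: "TT (\<lambda>e. \<one>)" unfolding TT_def by (rule exI[of _ One]) simp
lemma TT_add: "TT s \<Longrightarrow> TT t \<Longrightarrow> TT (\<lambda>e. s e \<oplus> t e)"
  unfolding TT_def by (metis tval.simps(4))
lemma TT_mul: "TT s \<Longrightarrow> TT t \<Longrightarrow> TT (\<lambda>e. s e \<otimes> t e)"
  unfolding TT_def by (metis tval.simps(5))

lemma set_assignment_const: "A \<in> sets M \<Longrightarrow> set_assignment M (\<lambda>_. A)"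
  by (auto simp: set_assignment_def)

lemma B_eq: "TT s \<Longrightarrow> TT t \<Longrightarrow> B (\<lambda>e. s e = t e)"
  unfolding TT_def B_def using sets_nonempty set_assignment_const
  by (metis all_not_in_conv bounded_fml.intros(1) sat.simps(1))
lemma B_lt: "TT s \<Longrightarrow> TT t \<Longrightarrow> B (\<lambda>e. s e \<prec> t e)"
  unfolding TT_def B_def using sets_nonempty set_assignment_const
  by (metis all_not_in_conv bounded_fml.intros(2) sat.simps(2))
lemma B_mem: "TT t \<Longrightarrow> A \<in> sets M \<Longrightarrow> B (\<lambda>e. t e \<in> A)"
  unfolding TT_def B_def using set_assignment_const
  by (metis bounded_fml.intros(3) sat.simps(3))
lemma B_not: "B P \<Longrightarrow> B (\<lambda>e. \<not> P e)"
  unfolding B_def by (metis bounded_fml.intros(4) sat.simps(4))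

text \<open>Two formulas with different parameters are put under one assignment by interleaving: the
  even set variables carry the first assignment, the odd ones the second.\<close>

lemma common_parameters:
  assumes "set_assignment M E" "set_assignment M E'"
  obtains R R' E'' where "inj R" "inj R'" "set_assignment M E''"
    "(\<lambda>i. E'' (R i)) = E" "(\<lambda>i. E'' (R' i)) = E'"
proof
  let ?E = "\<lambda>i. if even i then E (i div 2) else E' (i div 2)"
  show "inj ((*) (2::nat))" "inj (\<lambda>i. 2 * i + (1::nat))" by (auto simp: inj_def)
  show "(\<lambda>i. ?E (2 * i)) = E" "(\<lambda>i. ?E (2 * i + 1)) = E'" by auto
  show "set_assignment M ?E" using assms by (auto simp: set_assignment_def)
qed

lemma B_conj: assumes "B P" "B Q" shows "B (\<lambda>e. P e \<and> Q e)"
proof -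
  obtain p E q E' where p: "bounded_fml p" "set_assignment M E" "\<forall>e. sat M e E p = P e"
    and q: "bounded_fml q" "set_assignment M E'" "\<forall>e. sat M e E' q = Q e"
    using assms unfolding B_def by auto
  obtain R R' E'' where R: "inj R" "inj R'" "set_assignment M E''"
    "(\<lambda>i. E'' (R i)) = E" "(\<lambda>i. E'' (R' i)) = E'" using common_parameters[OF p(2) q(2)] by blast
  have "bounded_fml (Conj (rename id R p) (rename id R' q))"
    using p(1) q(1) by (intro bounded_fml.intros bounded_rename) auto
  moreover have "sat M e E'' (Conj (rename id R p) (rename id R' q)) \<longleftrightarrow> P e \<and> Q e" for e
    using p q R by (simp add: sat_rename)
  ultimately show ?thesis using R(3) unfolding B_def by blast
qed
lemma B_disj: assumes "B P" "B Q" shows "B (\<lambda>e. P e \<or> Q e)"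
  using B_not[OF B_conj[OF B_not[OF assms(1)] B_not[OF assms(2)]]] by simp
lemma B_imp: assumes "B P" "B Q" shows "B (\<lambda>e. P e \<longrightarrow> Q e)"
  unfolding imp_conv_disj by (intro B_disj B_not assms)

lemma B_rename: assumes "B P" "inj r" shows "B (\<lambda>e. P (\<lambda>i. e (r i)))"
proof -
  obtain p E where p: "bounded_fml p" "set_assignment M E" "\<forall>e. sat M e E p = P e"
    using assms unfolding B_def by auto
  have "sat M e E (rename r id p) = P (\<lambda>i. e (r i))" for e
    using p assms by (simp add: sat_rename)
  then show ?thesis using bounded_rename[OF p(1) assms(2)] p(2) unfolding B_def by blast
qed

text \<open>Turns the de Bruijn index \<open>0\<close> into a named variable that a quantifier can
  bind. \<open>lower N\<close> is right only on indices below \<open>N\<close>, so \<open>N\<close>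
  has to exceed all variables that matter to \<open>p\<close>.\<close>

lemma formula_lower:
  assumes p: "\<forall>e. sat M e E p = P e"
  shows "\<exists>N0. \<forall>N\<ge>N0. \<forall>e a. sat M (e(N := a)) E (rename (lower N) id p) = P (case_nat a e)"
proof -
  obtain N0 where N0: "\<forall>e e' E. (\<forall>i<N0. e i = e' i) \<longrightarrow> sat M e E p = sat M e' E p"
    using sat_cong[of M p] by blast
  have "sat M (e(N := a)) E (rename (lower N) id p) = P (case_nat a e)" if "N \<ge> N0" for N e a
  proof -
    have "sat M (e(N := a)) E (rename (lower N) id p) = sat M (\<lambda>i. (e(N := a)) (lower N i)) E p"
      by (simp add: sat_rename inj_lower)
    also have "\<dots> = sat M (case_nat a e) E p"
    proof (rule N0[THEN spec, THEN spec, THEN spec, THEN mp], intro allI impI)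
      fix i assume "i < N0" then show "(e(N := a)) (lower N i) = case_nat a e i"
        using lower_env[of i N e a] that by (metis less_le_trans)
    qed
    finally show ?thesis using p by simp
  qed
  then show ?thesis by blast
qed

lemma B_all:
  assumes "TT t" "B (\<lambda>e. P (e 0) (\<lambda>i. e (Suc i)))"
  shows "B (\<lambda>e. \<forall>a. a \<prec> t e \<longrightarrow> P a e)"
proof -
  obtain p E where p: "bounded_fml p" "set_assignment M E"
    "\<forall>e. sat M e E p = P (e 0) (\<lambda>i. e (Suc i))" using assms unfolding B_def by auto
  obtain u where u: "\<forall>e. tval M e u = t e" using assms unfolding TT_def by auto
  obtain N1 where N1: "\<forall>i\<in>tvars u. i < N1" using tvars_bounded by blast
  obtain N0 where N0: "\<forall>N\<ge>N0. \<forall>e a. sat M (e(N := a)) E (rename (lower N) id p) = P a e"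
    using formula_lower[OF p(3)] by auto
  \<comment> \<open>\<open>N0\<close> serves the body; \<open>N1\<close> keeps the variable out of
    the bound \<open>u\<close>, as \<open>bounded_fml\<close> requires.\<close>
  let ?N = "max N0 N1" let ?p = "AllN ?N (Imp (Lt (Var ?N) u) (rename (lower ?N) id p))"
  have "bounded_fml ?p" using N1 p
    by (intro bounded_fml.intros bounded_rename inj_lower) (auto simp: max_def)
  moreover have "tval M (e(?N := a)) u = t e" for e a
    using u N1 tval_cong[of u "e(?N := a)" e M] by (metis fun_upd_other less_irrefl max.strict_coboundedI2)
  then have "sat M e E ?p = (\<forall>a. a \<prec> t e \<longrightarrow> P a e)" for e
    using N0 by simp
  ultimately show ?thesis using p(2) unfolding B_def by blast
qed

lemma B_bex:
  assumes "TT t" "B (\<lambda>e. P (e 0) (\<lambda>i. e (Suc i)))"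
  shows "B (\<lambda>e. \<exists>a. a \<prec> t e \<and> P a e)"
proof -
  have "B (\<lambda>e. \<not> (\<forall>a. a \<prec> t e \<longrightarrow> \<not> P a e))"
    by (intro B_not B_all assms)
  then show ?thesis by simp
qed

lemmas B_intros = B_not B_conj B_disj B_imp B_all B_bex B_eq B_lt B_mem
  TT_var TT_zero TT_one TT_add TT_mul

lemma S_B: assumes "B P" shows "S P"
  unfolding S_def
  by (rule exI[of _ "\<lambda>e. P (\<lambda>i. e (Suc i))"]) (use B_rename[OF assms, of Suc] in simp)

lemma S_formula:
  assumes "S P" shows "\<exists>p E. sigma01 p \<and> set_assignment M E \<and> (\<forall>e. sat M e E p = P e)"
proof -
  obtain Q where Q: "B Q" "\<forall>e. P e \<longleftrightarrow> (\<exists>a. Q (case_nat a e))" using assms unfolding S_def by auto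
  then obtain p E where p: "bounded_fml p" "set_assignment M E" "\<forall>e. sat M e E p = Q e"
    unfolding B_def by auto
  then obtain N where N: "\<forall>e a. sat M (e(N := a)) E (rename (lower N) id p) = Q (case_nat a e)"
    using formula_lower[OF p(3)] by auto
  have "sigma01 (ExN N (rename (lower N) id p))"
    unfolding sigma01_def using p bounded_rename inj_lower by blast
  moreover have "sat M e E (ExN N (rename (lower N) id p)) = P e" for e using N Q by simp
  ultimately show ?thesis using p(2) by blast
qed

lemma S_rename: assumes "S P" "inj r" shows "S (\<lambda>e. P (\<lambda>i. e (r i)))"
proof -
  obtain Q where Q: "B Q" "\<forall>e. P e \<longleftrightarrow> (\<exists>a. Q (case_nat a e))" using assms unfolding S_def by auto
  have inj: "inj (case_nat 0 (\<lambda>i. Suc (r i)))"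
    by (rule injI) (use assms(2) in \<open>auto simp: inj_eq split: nat.split_asm\<close>)
  have "(\<lambda>i. case_nat a e (case_nat 0 (\<lambda>i. Suc (r i)) i)) = case_nat a (\<lambda>i. e (r i))" for a::'a and e
    by (auto split: nat.splits)
  then show ?thesis using B_rename[OF Q(1) inj] Q(2) unfolding S_def by force
qed

lemma D_rename: assumes "D P" "inj r" shows "D (\<lambda>e. P (\<lambda>i. e (r i)))"
  using assms S_rename[of P r] S_rename[of "\<lambda>e. \<not> P e" r] unfolding D_def by auto

lemma S_induct:
  assumes "S (\<lambda>e. P (e 0) (\<lambda>i. e (Suc i)))" "P \<zero> e" "\<And>n. P n e \<Longrightarrow> P (n \<oplus> \<one>) e"
  shows "P n e"
proof -
  obtain p E where p: "sigma01 p" "set_assignment M E"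
    "\<forall>e. sat M e E p = P (e 0) (\<lambda>i. e (Suc i))" using S_formula[OF assms(1)] by auto
  have *: "sat M ((case_nat n e)(0 := k)) E p = P k e" for k using p(3) by simp
  have "\<forall>n'. sat M ((case_nat n e)(0 := n')) E p"
  proof (rule S_ind_ax[unfolded sigma01_induction_def, THEN spec, THEN spec, THEN spec, THEN spec, THEN mp, THEN mp, THEN mp, THEN mp, OF p(1,2)])
    show "sat M ((case_nat n e)(0 := \<zero>)) E p" by (simp only: * assms(2))
    show "\<forall>k. sat M ((case_nat n e)(0 := k)) E p \<longrightarrow> sat M ((case_nat n e)(0 := k \<oplus> \<one>)) E p"
      using assms(3) by (simp only: *) simp
  qed
  then show ?thesis by (simp only: *) 
qed

lemma D_comprehension:
  assumes "D P" shows "{a. P (case_nat a e)} \<in> sets M"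
proof -
  obtain p E q E' where p: "sigma01 p" "set_assignment M E" "\<forall>e. sat M e E p = P e"
    and q: "sigma01 q" "set_assignment M E'" "\<forall>e. sat M e E' q = (\<not> P e)"
    using S_formula[of P] S_formula[of "\<lambda>e. \<not> P e"] assms[unfolded D_def] by (elim conjE) auto
  obtain R R' E'' where R: "inj R" "inj R'" "set_assignment M E''"
    "(\<lambda>i. E'' (R i)) = E" "(\<lambda>i. E'' (R' i)) = E'" using common_parameters[OF p(2) q(2)] by blast
  obtain x q' where q': "bounded_fml q'" "q = ExN x q'" using q unfolding sigma01_def by auto
  \<comment> \<open>The Pi01 description comes from the Sigma01 formula for the complement, with the
    negation pushed through its quantifier.\<close>
  let ?q = "AllN x (Neg (rename id R' q'))"
  obtain y p' where p': "bounded_fml p'" "p = ExN y p'" using p unfolding sigma01_def by auto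
  have "rename id R p = ExN y (rename id R p')" "bounded_fml (rename id R p')"
    using p' bounded_rename[of p' id R] by auto
  then have s: "sigma01 (rename id R p)" unfolding sigma01_def by blast
  have pi: "pi01 ?q" unfolding pi01_def
    using bounded_fml.intros(4)[OF bounded_rename[OF q'(1) inj_on_id, of R']] by blast
  have 1: "sat M e E'' (rename id R p) = P e" for e using p R by (simp add: sat_rename)
  have "sat M e E'' ?q = (\<not> sat M e E'' (rename id R' q))" for e
    using q' by simp
  then have 2: "sat M e E'' ?q = P e" for e using q R by (simp add: sat_rename)
  have "{a. sat M ((case_nat a e)(0 := a)) E'' (rename id R p)} \<in> sets M"
  proof -
    \<comment> \<open>The axiom wants one environment for all \<open>a\<close>; index
      \<open>0\<close> is overwritten anyway.\<close>
    have "{a. sat M ((case_nat undefined e)(0 := a)) E'' (rename id R p)} \<in> sets M"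
      using compr_ax[unfolded delta01_comprehension_def, THEN spec, THEN spec, THEN spec, THEN spec, THEN spec, THEN mp, THEN mp, THEN mp, THEN mp, OF s pi R(3)]
      by (simp only: 1 2 simp_thms)
    moreover have "(case_nat undefined e)(0 := a) = (case_nat a e)(0 := a)" for a
      by (auto split: nat.splits)
    ultimately show ?thesis by simp
  qed
  moreover have "(case_nat a e)(0 := a) = case_nat a e" for a by auto
  ultimately show ?thesis using 1 by simp
qed

subsection \<open>Arithmetic in the model\<close>

lemma B_ind:
  assumes "B (\<lambda>e. P (e 0) (e 1) (e 2))" "P \<zero> a b" "\<And>n. P n a b \<Longrightarrow> P (n \<oplus> \<one>) a b"
  shows "P n a b"
  using S_induct[where P="\<lambda>n e. P n (e 0) (e 1)" and e="case_nat a (\<lambda>_. b)" and n=n] S_B[OF assms(1)]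
    assms(2,3) by (simp add: numeral_2_eq_2)

lemma suc_neq: "n \<oplus> \<one> \<noteq> \<zero>" and suc_inj: "m \<oplus> \<one> = n \<oplus> \<one> \<Longrightarrow> m = n"
  and add0: "m \<oplus> \<zero> = m" and add_suc: "m \<oplus> (n \<oplus> \<one>) = (m \<oplus> n) \<oplus> \<one>"
  and mul0: "m \<otimes> \<zero> = \<zero>" and mul_suc: "m \<otimes> (n \<oplus> \<one>) = (m \<otimes> n) \<oplus> m"
  and not_lt0: "\<not> m \<prec> \<zero>" and lt_suc: "m \<prec> n \<oplus> \<one> \<longleftrightarrow> m \<prec> n \<or> m = n"
  using basic unfolding basic_axioms_def by auto

lemma zero_add: "\<zero> \<oplus> n = n"
  by (rule B_ind[of "\<lambda>n a b. \<zero> \<oplus> n = n"], (intro B_intros)[1]) (auto simp: add0 add_suc)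
lemma suc_add: "(m \<oplus> \<one>) \<oplus> n = (m \<oplus> n) \<oplus> \<one>"
  by (rule B_ind[of "\<lambda>n m b. (m \<oplus> \<one>) \<oplus> n = (m \<oplus> n) \<oplus> \<one>"], (intro B_intros)[1]) (auto simp: add0 add_suc)
lemma add_comm: "m \<oplus> n = n \<oplus> m"
  by (rule B_ind[of "\<lambda>n m b. m \<oplus> n = n \<oplus> m"], (intro B_intros)[1]) (auto simp: add0 add_suc zero_add suc_add)
lemma add_assoc': "(m \<oplus> k) \<oplus> n = m \<oplus> (k \<oplus> n)"
  by (rule B_ind[of "\<lambda>n m k. (m \<oplus> k) \<oplus> n = m \<oplus> (k \<oplus> n)"], (intro B_intros)[1]) (auto simp: add0 add_suc)
lemma zero_mul: "\<zero> \<otimes> n = \<zero>"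
  by (rule B_ind[of "\<lambda>n a b. \<zero> \<otimes> n = \<zero>"], (intro B_intros)[1]) (auto simp: mul0 mul_suc add0)
lemma add_lcomm: "m \<oplus> (k \<oplus> n) = k \<oplus> (m \<oplus> n)"
  by (metis add_assoc' add_comm)
lemma suc_mul: "(m \<oplus> \<one>) \<otimes> n = m \<otimes> n \<oplus> n"
  by (rule B_ind[of "\<lambda>n m b. (m \<oplus> \<one>) \<otimes> n = m \<otimes> n \<oplus> n"], (intro B_intros)[1])
    (auto simp: mul0 mul_suc add0 add_assoc' add_lcomm add_comm)
lemma mul_comm: "m \<otimes> n = n \<otimes> m"
  by (rule B_ind[of "\<lambda>n m b. m \<otimes> n = n \<otimes> m"], (intro B_intros)[1]) (auto simp: mul0 mul_suc zero_mul suc_mul)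
lemma distr: "(m \<oplus> k) \<otimes> n = m \<otimes> n \<oplus> k \<otimes> n"
  by (rule B_ind[of "\<lambda>n m k. (m \<oplus> k) \<otimes> n = m \<otimes> n \<oplus> k \<otimes> n"], (intro B_intros)[1])
    (auto simp: mul0 mul_suc add0 add_assoc' add_lcomm add_comm)
lemma mul_assoc': "(m \<otimes> k) \<otimes> n = m \<otimes> (k \<otimes> n)"
  by (rule B_ind[of "\<lambda>n m k. (m \<otimes> k) \<otimes> n = m \<otimes> (k \<otimes> n)"], (intro B_intros)[1])
    (auto simp: mul0 mul_suc, metis distr mul_comm)
lemma one_mul: "\<one> \<otimes> n = n"
  using suc_mul[of \<zero> n] by (simp add: zero_add zero_mul)

lemma add_cancel: "m \<oplus> n = k \<oplus> n \<Longrightarrow> m = k"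
  by (rule mp[OF B_ind[of "\<lambda>n m k. m \<oplus> n = k \<oplus> n \<longrightarrow> m = k"]], (intro B_intros)[1])
    (auto simp: add0 add_suc dest!: suc_inj)
lemma zero_or_suc: "n = \<zero> \<or> (\<exists>k. n = k \<oplus> \<one>)"
proof -
  have "n = \<zero> \<or> (\<exists>k. k \<prec> n \<and> n = k \<oplus> \<one>)"
    by (rule B_ind[of "\<lambda>n a b. n = \<zero> \<or> (\<exists>k. k \<prec> n \<and> n = k \<oplus> \<one>)"], (intro B_intros)[1]) (auto simp: lt_suc)
  then show ?thesis by auto
qed
lemma zero_lt_suc: "\<zero> \<prec> n \<oplus> \<one>"
  by (rule B_ind[of "\<lambda>n a b. \<zero> \<prec> n \<oplus> \<one>"], (intro B_intros)[1]) (auto simp: lt_suc)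
lemma lt_suc_mono: "m \<prec> n \<Longrightarrow> m \<oplus> \<one> \<prec> n \<oplus> \<one>"
  by (rule mp[OF B_ind[of "\<lambda>n m b. m \<prec> n \<longrightarrow> m \<oplus> \<one> \<prec> n \<oplus> \<one>"]], (intro B_intros)[1]) (auto simp: lt_suc not_lt0)
lemma lt_add: "m \<prec> m \<oplus> (k \<oplus> \<one>)"
  by (rule B_ind[of "\<lambda>k m b. m \<prec> m \<oplus> (k \<oplus> \<one>)"], (intro B_intros)[1]) (auto simp: lt_suc add0 add_suc zero_add)
lemma lt_iff: "m \<prec> n \<longleftrightarrow> (\<exists>k. n = m \<oplus> (k \<oplus> \<one>))"
proof -
  \<comment> \<open>The bound on \<open>k\<close> makes the induction predicate bounded.\<close>
  have "m \<prec> n \<longrightarrow> (\<exists>k. k \<prec> n \<and> n = m \<oplus> (k \<oplus> \<one>))"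
  proof (rule B_ind[of "\<lambda>n m b. m \<prec> n \<longrightarrow> (\<exists>k. k \<prec> n \<and> n = m \<oplus> (k \<oplus> \<one>))"], (intro B_intros)[1])
    fix n assume *: "m \<prec> n \<longrightarrow> (\<exists>k. k \<prec> n \<and> n = m \<oplus> (k \<oplus> \<one>))"
    show "m \<prec> n \<oplus> \<one> \<longrightarrow> (\<exists>k. k \<prec> n \<oplus> \<one> \<and> n \<oplus> \<one> = m \<oplus> (k \<oplus> \<one>))"
    proof (cases "m = n")
      case True then show ?thesis using zero_lt_suc zero_add by metis
    next
      case False then show ?thesis using * lt_suc_mono lt_suc by (metis add_suc)
    qed
  qed (auto simp: not_lt0)
  then show ?thesis using lt_add by auto
qed
lemma lt_trans: "k \<prec> m \<Longrightarrow> m \<prec> n \<Longrightarrow> k \<prec> n"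
  unfolding lt_iff by (metis add_assoc' add_suc)
lemma lt_irrefl: "\<not> m \<prec> m"
  unfolding lt_iff using add_cancel[of \<zero> m] suc_neq by (metis add_comm zero_add)
lemma lt_linear: "m \<prec> n \<or> m = n \<or> n \<prec> m"
proof (rule B_ind[of "\<lambda>n m b. m \<prec> n \<or> m = n \<or> n \<prec> m"])
  show "m \<prec> \<zero> \<or> m = \<zero> \<or> \<zero> \<prec> m" using zero_or_suc[of m] zero_lt_suc by auto
  fix n assume "m \<prec> n \<or> m = n \<or> n \<prec> m"
  then show "m \<prec> n \<oplus> \<one> \<or> m = n \<oplus> \<one> \<or> n \<oplus> \<one> \<prec> m"
  proof (elim disjE)
    assume "n \<prec> m"
    then obtain k where k: "m = n \<oplus> (k \<oplus> \<one>)" using lt_iff by auto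
    show ?thesis
    proof (cases "k = \<zero>")
      case True then show ?thesis using k zero_add by simp
    next
      case False
      then obtain j where "k = j \<oplus> \<one>" using zero_or_suc by blast
      then have "m = (n \<oplus> \<one>) \<oplus> (j \<oplus> \<one>)" using k add_suc suc_add by metis
      then show ?thesis using lt_add by simp
    qed
  qed (auto simp: lt_suc)
qed (intro B_intros)

definition le :: "'a \<Rightarrow> 'a \<Rightarrow> bool" (infix "\<preceq>" 50) where
  "m \<preceq> n \<longleftrightarrow> m \<prec> n \<or> m = n"

text \<open>Truncated subtraction, an operation that the class
  \<open>discrete_linordered_semidom\<close> asks for.\<close>

definition sub :: "'a \<Rightarrow> 'a \<Rightarrow> 'a" where
  "sub m n = (if n \<prec> m then THE k. m = k \<oplus> n else \<zero>)"

lemma le_iff: "m \<preceq> n \<longleftrightarrow> (\<exists>k. n = k \<oplus> m)"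
  unfolding le_def lt_iff by (metis add0 add_comm zero_or_suc)
lemma sub_add: "sub (k \<oplus> n) n = k"
proof (cases "k = \<zero>")
  case True then show ?thesis by (simp add: sub_def zero_add lt_irrefl)
next
  case False
  then have "n \<prec> k \<oplus> n" using zero_or_suc[of k] add_comm lt_add by metis
  then show ?thesis unfolding sub_def by (auto intro!: the_equality dest: add_cancel)
qed
lemma sub_zero: "\<not> n \<prec> m \<Longrightarrow> sub m n = \<zero>"
  by (simp add: sub_def)
lemma lt_add_mono: "a \<prec> b \<Longrightarrow> c \<oplus> a \<prec> c \<oplus> b"
  unfolding lt_iff using add_assoc' by metis
lemma mul_mono: "a \<prec> b \<Longrightarrow> \<zero> \<prec> c \<Longrightarrow> c \<otimes> a \<prec> c \<otimes> b"
  unfolding lt_iff by (metis add_assoc' distr mul_comm mul_suc add_suc zero_add)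
lemma le_lt: "m \<preceq> n \<longleftrightarrow> \<not> n \<prec> m" 
  using le_def lt_irrefl lt_linear lt_trans by metis

lemma le_cases: obtains k where "m = k \<oplus> n" "n \<preceq> m" | "m \<prec> n" "sub m n = \<zero>"
  using le_iff le_lt sub_zero le_def lt_irrefl lt_trans by metis
lemma sub_sub: "sub (sub a b) c = sub a (b \<oplus> c)"
proof (cases rule: le_cases[of a b])
  case (1 k)
  show ?thesis
  proof (cases rule: le_cases[of k c])
    case (1 j) then show ?thesis using \<open>a = k \<oplus> b\<close> by (metis sub_add add_assoc' add_comm)
  next
    case 2
    then have "a \<prec> b \<oplus> c" using \<open>a = k \<oplus> b\<close> lt_add_mono add_comm by metis
    then show ?thesis using 1 2 sub_add sub_zero lt_trans lt_irrefl by metis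
  qed
next
  case 2
  have "b \<preceq> b \<oplus> c" using le_iff add_comm by metis
  then show ?thesis using 2 sub_zero lt_trans lt_irrefl le_def not_lt0 by metis
qed
lemma mul_pos_mono: "a \<preceq> b \<Longrightarrow> c \<otimes> a \<preceq> c \<otimes> b"
  unfolding le_iff by (metis distr mul_comm)
lemma mul_sub: "c \<otimes> sub a b = sub (c \<otimes> a) (c \<otimes> b)"
proof (cases rule: le_cases[of a b])
  case (1 k) then show ?thesis by (metis distr mul_comm sub_add)
next
  case 2
  then have "c \<otimes> a \<preceq> c \<otimes> b" using mul_pos_mono le_def by blast
  then show ?thesis using 2 sub_zero le_lt mul0 by metis
qed
lemma lt_succ_le: "m \<prec> n \<longleftrightarrow> m \<oplus> \<one> \<preceq> n"
  unfolding lt_iff le_iff by (metis add_comm add_assoc')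
lemma pos_iff: "\<zero> \<prec> n \<longleftrightarrow> n \<noteq> \<zero>"
  using zero_or_suc zero_lt_suc lt_irrefl by metis

lemma semidom: "class.discrete_linordered_semidom (\<oplus>) sub (\<preceq>) (\<prec>) \<zero> (\<otimes>) \<one>"
proof unfold_locales
  fix a b c :: 'a
  show "a \<oplus> b \<oplus> c = a \<oplus> (b \<oplus> c)" by (rule add_assoc')
  show "a \<oplus> b = b \<oplus> a" by (rule add_comm)
  show "\<zero> \<oplus> a = a" by (rule zero_add)
  show "sub (a \<oplus> b) a = b" by (metis add_comm sub_add)
  show "sub (sub a b) c = sub a (b \<oplus> c)" by (rule sub_sub)
  show "a \<otimes> b \<otimes> c = a \<otimes> (b \<otimes> c)" by (rule mul_assoc')
  show "a \<otimes> b = b \<otimes> a" by (rule mul_comm)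
  show "\<one> \<otimes> a = a" by (rule one_mul)
  show "(a \<oplus> b) \<otimes> c = a \<otimes> c \<oplus> b \<otimes> c" by (rule distr)
  show "\<zero> \<otimes> a = \<zero>" by (rule zero_mul)
  show "a \<otimes> \<zero> = \<zero>" by (rule mul0)
  show "\<zero> \<noteq> \<one>" using suc_neq zero_add by metis
  show "a \<otimes> sub b c = sub (a \<otimes> b) (a \<otimes> c)" by (rule mul_sub)
  show "a \<otimes> b \<noteq> \<zero>" if "a \<noteq> \<zero>" "b \<noteq> \<zero>"
    using that mul_mono[of \<zero> b a] by (metis lt_irrefl mul0 pos_iff)
  show "a \<prec> b \<longleftrightarrow> a \<preceq> b \<and> \<not> b \<preceq> a" using le_lt le_def by metis
  show "a \<preceq> a" by (simp add: le_def)
  show "a \<preceq> c" if "a \<preceq> b" "b \<preceq> c" using that lt_trans le_def by metis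
  show "a = b" if "a \<preceq> b" "b \<preceq> a" using that lt_trans le_def lt_irrefl by metis
  show "a \<preceq> b \<or> b \<preceq> a" using lt_linear le_def by metis
  show "c \<oplus> a \<preceq> c \<oplus> b" if "a \<preceq> b" using that lt_add_mono le_def by metis
  show "c \<otimes> a \<prec> c \<otimes> b" if "a \<prec> b" "\<zero> \<prec> c" using that by (rule mul_mono)
  show "\<zero> \<prec> \<one>" using zero_lt_suc[of \<zero>] zero_add by simp
  show "sub a b \<oplus> b = a" if "b \<preceq> a" using that le_iff sub_add by metis
  show "a \<prec> b \<longleftrightarrow> a \<oplus> \<one> \<preceq> b" by (rule lt_succ_le)
  show "a \<otimes> (b \<oplus> c) = a \<otimes> b \<oplus> a \<otimes> c" by (metis distr mul_comm)
qed

text \<open>The numbers of the model, standard or not, thereby get the library of ordered semirings,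
  including \<open>dvd\<close> and the simplification rules for sums and products.\<close>

sublocale ar: discrete_linordered_semidom "(\<oplus>)" sub "(\<preceq>)" "(\<prec>)" \<zero> "(\<otimes>)" \<one>
  by (rule semidom)

subsection \<open>Closure properties of \<open>\<Sigma>\<^sup>0\<^sub>1\<close> and \<open>\<Delta>\<^sup>0\<^sub>1\<close>\<close>

text \<open>Two unbounded quantifiers are merged by quantifying over a common strict bound
  \<open>c\<close> of both witnesses, which avoids a pairing function.\<close>

lemma S_ex:
  assumes "S (\<lambda>e. P (e 0) (\<lambda>i. e (Suc i)))"
  shows "S (\<lambda>e. \<exists>a. P a e)"
proof -
  obtain Q where Q: "B Q" "\<forall>e. P (e 0) (\<lambda>i. e (Suc i)) \<longleftrightarrow> (\<exists>b. Q (case_nat b e))"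
    using assms unfolding S_def by auto
  have P: "P a e \<longleftrightarrow> (\<exists>b. Q (case_nat b (case_nat a e)))" for a e
    using Q(2)[THEN spec, of "case_nat a e"] by simp
  \<comment> \<open>Frees index \<open>2\<close> for the bound \<open>c\<close>, which is quantified
    outside \<open>a\<close> and \<open>b\<close>.\<close>
  define r where "r = (\<lambda>i. case i of 0 \<Rightarrow> 0 | Suc 0 \<Rightarrow> Suc 0 | Suc (Suc j) \<Rightarrow> Suc (Suc (Suc j)))"
  have inj: "inj r" unfolding r_def by (auto intro!: injI split: nat.split_asm)
  have "(\<lambda>i. e (r i)) = case_nat (e 0) (case_nat (e 1) (\<lambda>i. e (Suc (Suc (Suc i)))))" for e :: "nat \<Rightarrow> 'a"
    by (auto simp: r_def fun_eq_iff split: nat.splits)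
  then have "B (\<lambda>e. Q (case_nat (e 0) (case_nat (e 1) (\<lambda>i. e (Suc (Suc (Suc i)))))))"
    using B_rename[OF Q(1) inj] by simp
  then have "B (\<lambda>e. \<exists>a. a \<prec> e 0 \<and> (\<exists>b. b \<prec> e 0 \<and> Q (case_nat b (case_nat a (\<lambda>i. e (Suc i))))))"
    by (intro B_intros) simp
  moreover have "(\<exists>a. P a e) \<longleftrightarrow> (\<exists>c a. a \<prec> c \<and> (\<exists>b. b \<prec> c \<and> Q (case_nat b (case_nat a e))))" for e
  proof -
    have "a \<prec> a \<oplus> b \<oplus> \<one>" "b \<prec> a \<oplus> b \<oplus> \<one>" for a b
      using lt_add add_comm add_assoc' by metis+
    then show ?thesis unfolding P by blast
  qed
  ultimately show ?thesis unfolding S_def by fastforce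
qed

lemma S_conj: assumes "S P" "S Q" shows "S (\<lambda>e. P e \<and> Q e)"
proof -
  obtain P' where P': "B P'" "\<forall>e. P e \<longleftrightarrow> (\<exists>b. P' (case_nat b e))" using assms unfolding S_def by auto
  obtain Q' where Q': "B Q'" "\<forall>e. Q e \<longleftrightarrow> (\<exists>b. Q' (case_nat b e))" using assms unfolding S_def by auto
  have "B (\<lambda>e. P' (\<lambda>i. e (case i of 0 \<Rightarrow> 1 | Suc j \<Rightarrow> Suc (Suc j))))"
    by (rule B_rename[OF P'(1)]) (auto intro!: injI split: nat.split_asm)
  moreover have "B (\<lambda>e. Q' (\<lambda>i. e (case i of 0 \<Rightarrow> 0 | Suc j \<Rightarrow> Suc (Suc j))))"
    by (rule B_rename[OF Q'(1)]) (auto intro!: injI split: nat.split_asm)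
  ultimately have *: "S (\<lambda>e. P' (\<lambda>i. e (case i of 0 \<Rightarrow> 1 | Suc j \<Rightarrow> Suc (Suc j))) \<and>
    Q' (\<lambda>i. e (case i of 0 \<Rightarrow> 0 | Suc j \<Rightarrow> Suc (Suc j))))"
    by (intro S_B B_conj)
  have eqs: "(\<lambda>i. e (case i of 0 \<Rightarrow> 1 | Suc j \<Rightarrow> Suc (Suc j))) = case_nat (e 1) (\<lambda>i. e (Suc (Suc i)))"
    "(\<lambda>i. e (case i of 0 \<Rightarrow> 0 | Suc j \<Rightarrow> Suc (Suc j))) = case_nat (e 0) (\<lambda>i. e (Suc (Suc i)))" for e :: "nat \<Rightarrow> 'a"
    by (auto split: nat.splits)
  have "S (\<lambda>e. P' (case_nat (e 1) (\<lambda>i. e (Suc (Suc i)))) \<and> Q' (case_nat (e 0) (\<lambda>i. e (Suc (Suc i)))))"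
    using * by (simp only: eqs)
  then have "S (\<lambda>e. \<exists>a b. P' (case_nat a e) \<and> Q' (case_nat b e))"
    by (intro S_ex) simp
  then show ?thesis using P' Q' by simp
qed

lemma S_disj: assumes "S P" "S Q" shows "S (\<lambda>e. P e \<or> Q e)"
proof -
  obtain P' where P': "B P'" "\<forall>e. P e \<longleftrightarrow> (\<exists>b. P' (case_nat b e))" using assms unfolding S_def by auto
  obtain Q' where Q': "B Q'" "\<forall>e. Q e \<longleftrightarrow> (\<exists>b. Q' (case_nat b e))" using assms unfolding S_def by auto
  show ?thesis unfolding S_def
    by (rule exI[of _ "\<lambda>e. P' e \<or> Q' e"]) (use P' Q' B_disj in auto)
qed

lemma S_at:
  assumes "S (\<lambda>e. P (e 0) (\<lambda>i. e (Suc i)))" "k < n"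
  shows "S (\<lambda>e. P (e k) (\<lambda>i. e (i + n)))"
proof -
  have "inj (case_nat k (\<lambda>j. j + n))"
    by (rule injI) (use assms(2) in \<open>auto split: nat.split_asm\<close>)
  from S_rename[OF assms(1) this] show ?thesis by simp
qed

text \<open>Sigma01 bounding: induction on \<open>k\<close> collects the witnesses for all
  \<open>a\<close> below \<open>k\<close> under a single bound \<open>b\<close>, and the resulting
  matrix is bounded. The extra condition that \<open>a\<close> is below \<open>N\<close> lets the
  induction run over all \<open>k\<close>.\<close>

lemma S_ball_raw:
  assumes "S (\<lambda>e. P (e 0) (\<lambda>i. e (Suc i)))"
  shows "S (\<lambda>e. \<forall>a. a \<prec> e 0 \<longrightarrow> P a (\<lambda>i. e (Suc i)))"
proof -
  obtain Q where Q: "B Q" "\<forall>e. P (e 0) (\<lambda>i. e (Suc i)) \<longleftrightarrow> (\<exists>b. Q (case_nat b e))"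
    using assms unfolding S_def by auto
  have P: "P a e \<longleftrightarrow> (\<exists>b. Q (case_nat b (case_nat a e)))" for a e
    using Q(2)[THEN spec, of "case_nat a e"] by simp
  have 1: "B (\<lambda>e. Q (case_nat (e 0) (case_nat (e 1) (\<lambda>i. e (i + n)))))" if "n \<ge> 2" for n
  proof -
    let ?r = "\<lambda>i. case i of 0 \<Rightarrow> 0 | Suc 0 \<Rightarrow> Suc 0 | Suc (Suc j) \<Rightarrow> j + n"
    have "inj ?r" using that by (auto intro!: injI split: nat.split_asm)
    moreover have "(\<lambda>i. e (?r i)) = case_nat (e 0) (case_nat (e 1) (\<lambda>i. e (i + n)))" for e :: "nat \<Rightarrow> 'a"
      by (auto simp: fun_eq_iff split: nat.splits)
    ultimately show ?thesis using B_rename[OF Q(1), of ?r] by simp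
  qed
  let ?R = "\<lambda>k N e. \<exists>b. \<forall>a. a \<prec> k \<longrightarrow> a \<prec> N \<longrightarrow> (\<exists>c. c \<prec> b \<and> Q (case_nat c (case_nat a e)))"
  have 2: "S (\<lambda>e. ?R (e 0) (e 1) (\<lambda>i. e (Suc (Suc i))))"
    by (intro S_ex S_B B_intros) (use 1[of 5] in \<open>simp add: eval_nat_numeral\<close>)
  have col: "?R N N e" if all: "\<forall>a. a \<prec> N \<longrightarrow> P a e" for N e
  proof -
    have "?R k N e" for k
    proof (rule S_induct[where P="\<lambda>k e. ?R k (e 0) (\<lambda>i. e (Suc i))" and e="case_nat N e" and n=k, simplified])
      show "S (\<lambda>e. ?R (e 0) (e (Suc 0)) (\<lambda>i. e (Suc (Suc i))))" using 2 by simp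
      show "\<exists>b. \<forall>a. a \<prec> \<zero> \<longrightarrow> a \<prec> N \<longrightarrow> (\<exists>c. c \<prec> b \<and> Q (case_nat c (case_nat a e)))"
        using not_lt0 by blast
      fix k assume "?R k N e"
      then obtain b where b: "\<forall>a. a \<prec> k \<longrightarrow> a \<prec> N \<longrightarrow> (\<exists>c. c \<prec> b \<and> Q (case_nat c (case_nat a e)))" by blast
      show "?R (k \<oplus> \<one>) N e"
      proof (cases "k \<prec> N")
        case True
        then obtain c where c: "Q (case_nat c (case_nat k e))" using all True P[of k e] by blast
        have "x \<prec> b \<oplus> c \<oplus> \<one>" if "x \<prec> b" for x
          using lt_trans[OF that lt_add[of b c]] by (simp add: add_assoc')
        moreover have "c \<prec> b \<oplus> c \<oplus> \<one>" using lt_add[of c b] by (simp add: ar.add_ac)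
        ultimately show ?thesis using b c by (intro exI[of _ "b \<oplus> c \<oplus> \<one>"]) (metis lt_suc)
      next
        case False then show ?thesis using b lt_suc by blast
      qed
    qed
    then show ?thesis by blast
  qed
  have "(\<forall>a. a \<prec> N \<longrightarrow> P a e) \<longleftrightarrow> ?R N N e" for N e
    using col[of N e] P by blast
  moreover have "S (\<lambda>e. ?R (e 0) (e 0) (\<lambda>i. e (Suc i)))"
    by (intro S_ex S_B B_intros) (use 1[of 4] in \<open>simp add: eval_nat_numeral\<close>)
  ultimately show ?thesis by simp
qed

lemma D_not: "D P \<Longrightarrow> D (\<lambda>e. \<not> P e)" unfolding D_def by simp
lemma D_conj: "D P \<Longrightarrow> D Q \<Longrightarrow> D (\<lambda>e. P e \<and> Q e)"
  unfolding D_def de_Morgan_conj by (intro conjI S_conj S_disj; simp)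
lemma D_disj: "D P \<Longrightarrow> D Q \<Longrightarrow> D (\<lambda>e. P e \<or> Q e)"
  unfolding D_def de_Morgan_disj by (intro conjI S_conj S_disj; simp)
lemma D_imp: "D P \<Longrightarrow> D Q \<Longrightarrow> D (\<lambda>e. P e \<longrightarrow> Q e)"
  unfolding imp_conv_disj by (intro D_disj D_not)
lemma D_iff: "D P \<Longrightarrow> D Q \<Longrightarrow> D (\<lambda>e. P e \<longleftrightarrow> Q e)"
  unfolding iff_conv_conj_imp by (intro D_conj D_imp)
lemma D_B: "B P \<Longrightarrow> D P" unfolding D_def by (intro conjI S_B B_not)
lemma D_S: "D P \<Longrightarrow> S P" unfolding D_def by simp
lemma D_const: "D (\<lambda>e. P)"
proof (cases P)
  case True then show ?thesis using D_B[OF B_eq[OF TT_zero TT_zero]] by simp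
next
  case False then show ?thesis using D_B[OF B_not[OF B_eq[OF TT_zero TT_zero]]] by simp
qed

text \<open>Since \<open>t\<close> is total, the complement of its graph is Sigma01 as well. Hence
  substituting such functions preserves both \<open>S\<close> and \<open>D\<close>.\<close>

definition F :: "((nat \<Rightarrow> 'a) \<Rightarrow> 'a) \<Rightarrow> bool" where
  "F t \<longleftrightarrow> S (\<lambda>e. e 0 = t (\<lambda>i. e (Suc i)))"

lemma F_at: "F t \<Longrightarrow> k < n \<Longrightarrow> S (\<lambda>e. e k = t (\<lambda>i. e (i + n)))"
  using S_at[where P="\<lambda>a e. a = t e"] unfolding F_def .

lemma F_weak: assumes "F t" shows "F (\<lambda>e. t (\<lambda>i. e (i + n)))"
  unfolding F_def using F_at[OF assms, of 0 "Suc n"] by simp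

lemma S_subst1:
  assumes "S (\<lambda>e. P (e 0) (\<lambda>i. e (Suc i)))" "F t" shows "S (\<lambda>e. P (t e) e)"
proof -
  have "S (\<lambda>e. \<exists>a. a = t e \<and> P a e)"
    using assms(1,2) unfolding F_def by (intro S_ex S_conj)
  then show ?thesis by simp
qed

lemma D_subst1:
  assumes "D (\<lambda>e. P (e 0) (\<lambda>i. e (Suc i)))" "F t" shows "D (\<lambda>e. P (t e) e)"
  using assms S_subst1[of P t] S_subst1[of "\<lambda>a e. \<not> P a e" t] unfolding D_def by simp

lemma S_subst2:
  assumes "S (\<lambda>e. P (e 0) (e 1))" "F s" "F t" shows "S (\<lambda>e. P (s e) (t e))"
proof -
  \<comment> \<open>Under the quantifiers over \<open>a\<close> and \<open>b\<close> the inner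
    variable \<open>b\<close> has index \<open>0\<close>, so the arguments appear swapped.\<close>
  have P: "S (\<lambda>e. P (e 1) (e 0))"
    using S_rename[OF assms(1), of "\<lambda>i. if i = 0 then 1 else if i = 1 then 0 else i"] by (auto simp: inj_def)
  have "S (\<lambda>e. \<exists>a b. a = s e \<and> b = t e \<and> P a b)"
    by (intro S_ex S_conj) (use F_at[OF assms(2), of 1 2] F_at[OF assms(3), of 0 2] P in simp_all)
  then show ?thesis by simp
qed

lemma D_subst2:
  assumes "D (\<lambda>e. P (e 0) (e 1))" "F s" "F t" shows "D (\<lambda>e. P (s e) (t e))"
  using assms S_subst2[of P s t] S_subst2[of "\<lambda>a b. \<not> P a b" s t] unfolding D_def by simp

lemma S_subst3:
  assumes "S (\<lambda>e. P (e 0) (e 1) (e 2))" "F r" "F s" "F t" shows "S (\<lambda>e. P (r e) (s e) (t e))"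
proof -
  have P: "S (\<lambda>e. P (e 2) (e 1) (e 0))"
    using S_rename[OF assms(1), of "\<lambda>i. if i = 0 then 2 else if i = 2 then 0 else i"] by (auto simp: inj_def)
  have "S (\<lambda>e. \<exists>a b c. a = r e \<and> b = s e \<and> c = t e \<and> P a b c)"
    by (intro S_ex S_conj) (use F_at[OF assms(2), of 2 3] F_at[OF assms(3), of 1 3] F_at[OF assms(4), of 0 3] P
      in \<open>simp_all add: eval_nat_numeral\<close>)
  then show ?thesis by simp
qed

lemma D_subst3:
  assumes "D (\<lambda>e. P (e 0) (e 1) (e 2))" "F r" "F s" "F t" shows "D (\<lambda>e. P (r e) (s e) (t e))"
  using assms S_subst3[of P r s t] S_subst3[of "\<lambda>a b c. \<not> P a b c" r s t] unfolding D_def by simp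

lemma F_TT: "TT t \<Longrightarrow> F t"
proof -
  assume "TT t"
  then obtain u where u: "\<forall>e. tval M e u = t e" unfolding TT_def by auto
  have "tval M e (trename Suc u) = t (\<lambda>i. e (Suc i))" for e
    using u by (simp add: tval_trename)
  then have "TT (\<lambda>e. t (\<lambda>i. e (Suc i)))" unfolding TT_def by blast
  then show "F t" unfolding F_def by (intro S_B B_intros)
qed
lemma F_var: "F (\<lambda>e. e k)" by (intro F_TT TT_var)

lemma F_subst1:
  assumes "S (\<lambda>e. e 0 = f (e 1))" "F s" shows "F (\<lambda>e. f (s e))"
  unfolding F_def
  by (rule S_subst2[where P="\<lambda>a b. a = f b", OF assms(1) F_var]) (use F_weak[OF assms(2), of 1] in simp)

lemma F_move: "F (\<lambda>e. h (e 0)) \<Longrightarrow> F t \<Longrightarrow> F (\<lambda>e. h (t e))"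
  by (rule F_subst1[where f=h]) (use F_at[of "\<lambda>e. h (e 0)" 0 1] in simp_all)

lemma F_subst2:
  assumes "S (\<lambda>e. e 0 = f (e 1) (e 2))" "F s" "F t" shows "F (\<lambda>e. f (s e) (t e))"
  unfolding F_def
  by (rule S_subst3[where P="\<lambda>a b c. a = f b c", OF assms(1) F_var])
    (use F_weak[OF assms(2), of 1] F_weak[OF assms(3), of 1] in simp_all)

lemma D_set: "D (\<lambda>e. P (e 0)) \<Longrightarrow> {a. P a} \<in> sets M"
  using D_comprehension[of "\<lambda>e. P (e 0)"] by simp

text \<open>An element of the model need not be the value of a closed term, so it enters through the
  singleton \<open>{c}\<close> as a set parameter.\<close>

lemma F_const: "F (\<lambda>e. c)"
proof -
  have "D (\<lambda>e. e 0 = e 1)" by (intro D_B B_intros)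
  then have "{c} \<in> sets M" using D_comprehension[of "\<lambda>e. e 0 = e 1" "\<lambda>_. c"] by simp
  then have "S (\<lambda>e. e 0 \<in> {c})" by (intro S_B B_intros)
  then show ?thesis unfolding F_def by simp
qed
lemma F_add: "F s \<Longrightarrow> F t \<Longrightarrow> F (\<lambda>e. s e \<oplus> t e)"
  by (rule F_subst2[where f="(\<oplus>)"]) (intro S_B B_intros)
lemma F_mul: "F s \<Longrightarrow> F t \<Longrightarrow> F (\<lambda>e. s e \<otimes> t e)"
  by (rule F_subst2[where f="(\<otimes>)"]) (intro S_B B_intros)
lemma D_eq: "F s \<Longrightarrow> F t \<Longrightarrow> D (\<lambda>e. s e = t e)"
  by (rule D_subst2[where P="(=)"]) (intro D_B B_intros)
lemma D_lt: "F s \<Longrightarrow> F t \<Longrightarrow> D (\<lambda>e. s e \<prec> t e)"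
  by (rule D_subst2[where P="(\<prec>)"]) (intro D_B B_intros)
lemma D_le: "F s \<Longrightarrow> F t \<Longrightarrow> D (\<lambda>e. s e \<preceq> t e)"
  unfolding le_def by (intro D_disj D_lt D_eq)
lemma D_mem: "A \<in> sets M \<Longrightarrow> F t \<Longrightarrow> D (\<lambda>e. t e \<in> A)"
  by (rule D_subst1[where P="\<lambda>a e. a \<in> A"]) (intro D_B B_intros)

lemma S_ball:
  assumes "F t" "S (\<lambda>e. P (e 0) (\<lambda>i. e (Suc i)))"
  shows "S (\<lambda>e. \<forall>a. a \<prec> t e \<longrightarrow> P a e)"
  by (rule S_subst1[where P="\<lambda>b e. \<forall>a. a \<prec> b \<longrightarrow> P a e", OF _ assms(1)])
    (rule S_ball_raw[OF assms(2)])

lemma S_bex: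
  assumes "F t" "S (\<lambda>e. P (e 0) (\<lambda>i. e (Suc i)))"
  shows "S (\<lambda>e. \<exists>a. a \<prec> t e \<and> P a e)"
proof -
  have "S (\<lambda>e. e 0 \<prec> t (\<lambda>i. e (Suc i)))"
    by (rule S_subst2[where P="(\<prec>)", OF _ F_var])
      (use F_weak[OF assms(1), of 1] in \<open>simp_all add: S_B B_lt TT_var\<close>)
  then show ?thesis by (intro S_ex S_conj assms(2))
qed

lemma D_ball:
  assumes "F t" "D (\<lambda>e. P (e 0) (\<lambda>i. e (Suc i)))"
  shows "D (\<lambda>e. \<forall>a. a \<prec> t e \<longrightarrow> P a e)"
  using assms S_ball[of t P] S_bex[of t "\<lambda>a e. \<not> P a e"] unfolding D_def by simp

lemma D_bex:
  assumes "F t" "D (\<lambda>e. P (e 0) (\<lambda>i. e (Suc i)))"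
  shows "D (\<lambda>e. \<exists>a. a \<prec> t e \<and> P a e)"
  using D_not[OF D_ball[OF assms(1) D_not[OF assms(2)]]] by simp

lemma D_ball_le:
  assumes "F t" "D (\<lambda>e. P (e 0) (\<lambda>i. e (Suc i)))"
  shows "D (\<lambda>e. \<forall>a. a \<preceq> t e \<longrightarrow> P a e)"
  using D_ball[OF F_add[OF assms(1) F_const] assms(2), of \<one>] by (simp add: lt_suc le_def)

lemma D_bex_le:
  assumes "F t" "D (\<lambda>e. P (e 0) (\<lambda>i. e (Suc i)))"
  shows "D (\<lambda>e. \<exists>a. a \<preceq> t e \<and> P a e)"
  using D_bex[OF F_add[OF assms(1) F_const] assms(2), of \<one>] by (simp add: lt_suc le_def)

lemma D_If: "D P \<Longrightarrow> D Q \<Longrightarrow> D R \<Longrightarrow> D (\<lambda>e. if P e then Q e else R e)"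
  unfolding if_bool_eq_conj by (intro D_conj D_imp D_not)

lemmas F_intros = F_var F_const F_add F_mul
lemmas D_intros = D_not D_conj D_disj D_imp D_iff D_eq D_lt D_le D_ball D_bex D_ball_le D_bex_le
  D_mem D_If D_const F_intros

lemma S_induction:
  assumes "S (\<lambda>e. P (e 0))" "P \<zero>" "\<And>n. P n \<Longrightarrow> P (n \<oplus> \<one>)" shows "P n"
  using S_induct[where P="\<lambda>n e. P n"] assms by simp

text \<open>Otherwise induction on \<open>m\<close> excludes everything below \<open>m\<close> that
  is at most \<open>n\<close>, hence finally \<open>n\<close> itself.\<close>

lemma D_least:
  assumes "D (\<lambda>e. P (e 0))" "P n"
  shows "\<exists>m. m \<preceq> n \<and> P m \<and> (\<forall>k. k \<prec> m \<longrightarrow> \<not> P k)"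
proof (rule ccontr)
  assume *: "\<not> ?thesis"
  have D: "D (\<lambda>e. P (e k))" for k
    using D_subst1[where P="\<lambda>a e. P a", OF assms(1) F_var] by simp
  have "\<forall>k. k \<prec> m \<longrightarrow> k \<preceq> n \<longrightarrow> \<not> P k" for m
  proof (rule S_induction[where P="\<lambda>m. \<forall>k. k \<prec> m \<longrightarrow> k \<preceq> n \<longrightarrow> \<not> P k"])
    show "S (\<lambda>e. \<forall>k. k \<prec> e 0 \<longrightarrow> k \<preceq> n \<longrightarrow> \<not> P k)"
      by (intro D_S D_intros D)
    fix m assume IH: "\<forall>k. k \<prec> m \<longrightarrow> k \<preceq> n \<longrightarrow> \<not> P k"
    show "\<forall>k. k \<prec> m \<oplus> \<one> \<longrightarrow> k \<preceq> n \<longrightarrow> \<not> P k"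
    proof (intro allI impI)
      fix k assume k: "k \<prec> m \<oplus> \<one>" "k \<preceq> n"
      show "\<not> P k"
      proof (cases "k \<prec> m")
        case False
        then have "k = m" using k lt_suc by blast
        then show ?thesis using * IH k(2) by (meson ar.less_le_trans ar.less_imp_le ar.order.trans)
      qed (use IH k in blast)
    qed
  qed (simp add: not_lt0)
  then show False using assms(2) by (metis ar.order.refl lt_suc)
qed

subsection \<open>Coding of finite sets\<close>

lemma F_pair: "F s \<Longrightarrow> F t \<Longrightarrow> F (\<lambda>e. pair M (s e) (t e))"
  unfolding pair_def by (intro F_intros)

lemma square_suc: "(a \<oplus> \<one>) \<otimes> (a \<oplus> \<one>) = (a \<otimes> a \<oplus> a) \<oplus> (a \<oplus> \<one>)"
  by (simp only: algebra_simps ar.mult_1_right ar.mult_1)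

text \<open>With \<open>a = i + j\<close> the value lies between \<open>a * a\<close> and
  \<open>a * a + a\<close>, hence below the next square. So the sum of the components can be read
  off, which gives \<open>pair_inj\<close>.\<close>

lemma pair_mono: assumes "i \<oplus> j \<prec> i' \<oplus> j'" shows "pair M i j \<prec> pair M i' j'"
proof -
  let ?a = "i \<oplus> j" and ?b = "i' \<oplus> j'"
  have "pair M i j \<preceq> ?a \<otimes> ?a \<oplus> ?a"
    unfolding pair_def by (intro ar.add_left_mono) (simp add: le_iff, metis add_comm)
  also have "\<dots> \<prec> (?a \<oplus> \<one>) \<otimes> (?a \<oplus> \<one>)"
    using square_suc lt_add by metis
  also have "\<dots> \<preceq> ?b \<otimes> ?b"
    using assms unfolding lt_succ_le by (metis mul_comm mul_pos_mono ar.order.trans)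
  also have "\<dots> \<preceq> pair M i' j'" unfolding pair_def le_iff by (metis add_comm)
  finally show ?thesis .
qed

lemma pair_inj: "pair M i j = pair M i' j' \<longleftrightarrow> i = i' \<and> j = j'"
proof
  assume *: "pair M i j = pair M i' j'"
  then have "i \<oplus> j = i' \<oplus> j'" using pair_mono lt_linear lt_irrefl by metis
  moreover from this have "i = i'" using * unfolding pair_def by (metis add_cancel add_comm)
  ultimately show "i = i' \<and> j = j'" by (metis add_cancel add_comm)
qed simp

lemma le_pair1: "i \<preceq> pair M i j" unfolding pair_def le_iff by blast
lemma le_pair2: "j \<preceq> pair M i j"
proof (cases "j = \<zero>")
  case True then show ?thesis using le_iff[of \<zero>] add0 by metis
next
  case False
  then obtain k where k: "j = k \<oplus> \<one>" using zero_or_suc by blast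
  have "j \<preceq> (i \<oplus> j)" unfolding le_iff by blast
  also have "\<dots> \<preceq> (i \<oplus> j) \<otimes> (i \<oplus> j)"
    unfolding k add_suc[of i] mul_suc[of "i \<oplus> k \<oplus> \<one>"] le_iff by blast
  also have "\<dots> \<preceq> pair M i j" unfolding pair_def le_iff by (metis add_comm)
  finally show ?thesis .
qed

lemma zero_le: "\<zero> \<preceq> n" using le_iff add0 by metis
lemma le_add1: "m \<preceq> m \<oplus> n" and le_add2: "m \<preceq> n \<oplus> m" unfolding le_iff using add_comm by blast+

lemma divides_dvd: "divides M = dvd.dvd (\<otimes>)"
  by (auto simp: fun_eq_iff divides_def ar.dvd_def)

lemma divides_bound: "divides M d n \<longleftrightarrow> (\<exists>q. q \<preceq> n \<and> n = d \<otimes> q)"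
proof
  assume "divides M d n"
  then obtain q where q: "n = d \<otimes> q" unfolding divides_def by blast
  show "\<exists>q. q \<preceq> n \<and> n = d \<otimes> q"
  proof (cases "d = \<zero>")
    case True then show ?thesis using q zero_le zero_mul by metis
  next
    case False
    then obtain k where "d = k \<oplus> \<one>" using zero_or_suc by blast
    then have "q \<preceq> n" using q suc_mul le_add2 by metis
    then show ?thesis using q by blast
  qed
qed (auto simp: divides_def)

lemma D_divides: "F s \<Longrightarrow> F t \<Longrightarrow> D (\<lambda>e. divides M (s e) (t e))"
  by (rule D_subst2[where P="divides M"]) (unfold divides_bound, intro D_intros)

lemma triple_le: "c = pair M k (pair M m n) \<Longrightarrow> k \<preceq> c \<and> m \<preceq> c \<and> n \<preceq> c"
  using le_pair1[of k "pair M m n"] le_pair1[of m n] le_pair2[of n m] le_pair2[of "pair M m n" k]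
    ar.order.trans by blast

lemma members_iff:
  "i \<in> members M c \<longleftrightarrow> (\<exists>k. k \<preceq> c \<and> (\<exists>m. m \<preceq> c \<and> (\<exists>n. n \<preceq> c \<and> c = pair M k (pair M m n) \<and> i \<prec> k \<and>
     divides M (m \<otimes> (i \<oplus> \<one>) \<oplus> \<one>) n)))"
  unfolding members_def mem_Collect_eq using triple_le by metis

lemma is_triple_iff:
  "is_triple M c \<longleftrightarrow> (\<exists>k. k \<preceq> c \<and> (\<exists>m. m \<preceq> c \<and> (\<exists>n. n \<preceq> c \<and> c = pair M k (pair M m n))))"
  unfolding is_triple_def using triple_le by metis

lemma D_members: "F s \<Longrightarrow> F t \<Longrightarrow> D (\<lambda>e. s e \<in> members M (t e))"
  by (rule D_subst2[where P="\<lambda>i c. i \<in> members M c"]) (unfold members_iff, intro D_intros F_pair D_divides)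

lemma D_is_triple: "F t \<Longrightarrow> D (\<lambda>e. is_triple M (t e))"
  by (rule D_subst1[where P="\<lambda>c e. is_triple M c"]) (unfold is_triple_iff, intro D_intros F_pair)

lemma members_less: "i \<in> members M c \<Longrightarrow> i \<prec> c"
  unfolding members_iff by (metis ar.less_le_trans)

text \<open>Members lie below their code. The resulting bound makes equality of coded sets, and with
  it \<open>set_code\<close>, Delta01.\<close>

lemma members_eq_iff: "members M c = members M d \<longleftrightarrow>
    (\<forall>i. i \<prec> c \<oplus> d \<longrightarrow> (i \<in> members M c \<longleftrightarrow> i \<in> members M d))"
proof -
  have "i \<prec> c \<oplus> d" if "i \<in> members M c \<or> i \<in> members M d" for i
    using that members_less le_add1 le_add2 ar.less_le_trans by metis
  then show ?thesis unfolding set_eq_iff by metis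
qed

lemma set_code_iff: "set_code M c \<longleftrightarrow> is_triple M c \<and> (\<forall>c'. c' \<prec> c \<longrightarrow> is_triple M c' \<longrightarrow>
    \<not> (\<forall>i. i \<prec> c' \<oplus> c \<longrightarrow> (i \<in> members M c' \<longleftrightarrow> i \<in> members M c)))"
  unfolding set_code_def members_eq_iff ..

lemma D_set_code: "F t \<Longrightarrow> D (\<lambda>e. set_code M (t e))"
  by (rule D_subst1[where P="\<lambda>c e. set_code M c"])
    (unfold set_code_iff, intro D_intros D_members D_is_triple)

lemma set_code_inj: "set_code M c \<Longrightarrow> set_code M d \<Longrightarrow> members M c = members M d \<Longrightarrow> c = d"
  unfolding set_code_def using lt_linear by metis

text \<open>Replaces the factorial of \<open>k\<close>, for which no recursion is available yet.
  \<open>m\<close> must not vanish, so that the moduli in \<open>ex_beta\<close> exceed one.\<close>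

lemma ex_common_multiple: "\<exists>m. m \<noteq> \<zero> \<and> (\<forall>i. i \<prec> k \<longrightarrow> divides M (i \<oplus> \<one>) m)"
proof (rule S_induction[where P="\<lambda>k. \<exists>m. m \<noteq> \<zero> \<and> (\<forall>i. i \<prec> k \<longrightarrow> divides M (i \<oplus> \<one>) m)"])
  show "S (\<lambda>e. \<exists>m. m \<noteq> \<zero> \<and> (\<forall>i. i \<prec> e 0 \<longrightarrow> divides M (i \<oplus> \<one>) m))"
    by (intro S_ex D_S D_intros D_divides)
  show "\<exists>m. m \<noteq> \<zero> \<and> (\<forall>i. i \<prec> \<zero> \<longrightarrow> divides M (i \<oplus> \<one>) m)"
    using not_lt0 ar.zero_neq_one by metis
  fix k assume "\<exists>m. m \<noteq> \<zero> \<and> (\<forall>i. i \<prec> k \<longrightarrow> divides M (i \<oplus> \<one>) m)"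
  then obtain m where m: "m \<noteq> \<zero>" "\<forall>i. i \<prec> k \<longrightarrow> divides M (i \<oplus> \<one>) m" by blast
  then have "\<forall>i. i \<prec> k \<oplus> \<one> \<longrightarrow> divides M (i \<oplus> \<one>) (m \<otimes> (k \<oplus> \<one>))"
    unfolding lt_suc divides_dvd by auto
  moreover have "m \<otimes> (k \<oplus> \<one>) \<noteq> \<zero>" using m suc_neq by simp
  ultimately show "\<exists>m. m \<noteq> \<zero> \<and> (\<forall>i. i \<prec> k \<oplus> \<one> \<longrightarrow> divides M (i \<oplus> \<one>) m)" by blast
qed

text \<open>The moduli \<open>?di\<close> and \<open>?dj\<close> differ by
  \<open>m * (t + 1)\<close>, so \<open>?dj\<close> divides \<open>n * m * (t + 1)\<close>. As
  \<open>t + 1\<close> divides \<open>m\<close>, it divides \<open>n * ?z * ?z\<close>, where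
  \<open>?z\<close> is one less than \<open>?dj\<close>. Modulo \<open>?dj\<close> the factor
  \<open>?z\<close> is minus one, so both copies can be stripped off. This replaces an argument with
  greatest common divisors.\<close>

lemma beta_coprime:
  assumes m: "\<forall>i. i \<prec> k \<longrightarrow> divides M (i \<oplus> \<one>) m" and ij: "i \<prec> k" "j \<prec> k" "i \<noteq> j"
    and d: "divides M (m \<otimes> (j \<oplus> \<one>) \<oplus> \<one>) (n \<otimes> (m \<otimes> (i \<oplus> \<one>) \<oplus> \<one>))"
  shows "divides M (m \<otimes> (j \<oplus> \<one>) \<oplus> \<one>) n"
proof -
  let ?di = "m \<otimes> (i \<oplus> \<one>) \<oplus> \<one>" and ?z = "m \<otimes> (j \<oplus> \<one>)"
  let ?dj = "?z \<oplus> \<one>"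
  have "\<exists>t. t \<prec> k \<and> divides M ?dj (n \<otimes> m \<otimes> (t \<oplus> \<one>))"
  proof (cases "j \<prec> i")
    case True
    then obtain t where t: "i = j \<oplus> (t \<oplus> \<one>)" using lt_iff by blast
    have "n \<otimes> ?di = n \<otimes> ?dj \<oplus> n \<otimes> m \<otimes> (t \<oplus> \<one>)" unfolding t by (simp only: algebra_simps ar.mult_1_right ar.mult_1)
    then have "divides M ?dj (n \<otimes> m \<otimes> (t \<oplus> \<one>))"
      using d unfolding divides_dvd by (metis ar.dvd_add_right_iff ar.dvd_triv_right)
    moreover have "t \<prec> k" using ij(1) t lt_trans by (metis add_comm add_assoc' lt_add)
    ultimately show ?thesis by blast
  next
    case False
    then obtain t where t: "j = i \<oplus> (t \<oplus> \<one>)" using lt_iff ij(3) lt_linear by blast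
    have "n \<otimes> ?dj = n \<otimes> ?di \<oplus> n \<otimes> m \<otimes> (t \<oplus> \<one>)" unfolding t by (simp only: algebra_simps ar.mult_1_right ar.mult_1)
    then have "divides M ?dj (n \<otimes> m \<otimes> (t \<oplus> \<one>))"
      using d unfolding divides_dvd by (metis ar.dvd_add_right_iff ar.dvd_triv_right)
    moreover have "t \<prec> k" using ij(2) t lt_trans by (metis add_comm add_assoc' lt_add)
    ultimately show ?thesis by blast
  qed
  then obtain t where t: "t \<prec> k" "divides M ?dj (n \<otimes> m \<otimes> (t \<oplus> \<one>))" by blast
  obtain q where q: "m = (t \<oplus> \<one>) \<otimes> q" using m t(1) unfolding divides_def by blast
  have "(n \<otimes> m \<otimes> (t \<oplus> \<one>)) \<otimes> (q \<otimes> (j \<oplus> \<one>) \<otimes> (j \<oplus> \<one>)) =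
    n \<otimes> m \<otimes> ((t \<oplus> \<one>) \<otimes> q) \<otimes> ((j \<oplus> \<one>) \<otimes> (j \<oplus> \<one>))"
    by (simp only: ar.mult_ac)
  also have "\<dots> = n \<otimes> ?z \<otimes> ?z"
    unfolding q[symmetric] by (simp only: ar.mult_ac)
  finally have "n \<otimes> ?z \<otimes> ?z = (n \<otimes> m \<otimes> (t \<oplus> \<one>)) \<otimes> (q \<otimes> (j \<oplus> \<one>) \<otimes> (j \<oplus> \<one>))" ..
  then have "divides M ?dj (n \<otimes> ?z \<otimes> ?z)"
    using t(2) unfolding divides_dvd by (metis ar.dvd_mult2)
  moreover have "n \<otimes> ?z \<otimes> ?dj = n \<otimes> ?z \<otimes> ?z \<oplus> n \<otimes> ?z" "n \<otimes> ?dj = n \<otimes> ?z \<oplus> n"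
    using mul_suc by simp_all
  ultimately show ?thesis
    unfolding divides_dvd by (metis ar.dvd_add_right_iff ar.dvd_triv_right)
qed

text \<open>Goedel's beta function. The number \<open>n\<close> is the product of the moduli at
  those \<open>j\<close> that satisfy \<open>P\<close>, built up by induction on \<open>i\<close>;
  by \<open>beta_coprime\<close> no other modulus divides it.\<close>

lemma ex_beta:
  assumes "D (\<lambda>e. P (e 0))"
  shows "\<exists>m n. \<forall>j. j \<prec> k \<longrightarrow> (divides M (m \<otimes> (j \<oplus> \<one>) \<oplus> \<one>) n \<longleftrightarrow> P j)"
proof -
  obtain m where m: "m \<noteq> \<zero>" "\<forall>i. i \<prec> k \<longrightarrow> divides M (i \<oplus> \<one>) m" using ex_common_multiple by blast
  have P: "D (\<lambda>e. P (e i))" for i using D_subst1[where P="\<lambda>a e. P a", OF assms F_var] .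
  let ?d = "\<lambda>j. m \<otimes> (j \<oplus> \<one>) \<oplus> \<one>"
  have "\<exists>n. \<forall>j. j \<prec> k \<longrightarrow> (divides M (?d j) n \<longleftrightarrow> j \<prec> i \<and> P j)" for i
  proof (rule S_induction[where P="\<lambda>i. \<exists>n. \<forall>j. j \<prec> k \<longrightarrow> (divides M (?d j) n \<longleftrightarrow> j \<prec> i \<and> P j)"])
    show "S (\<lambda>e. \<exists>n. \<forall>j. j \<prec> k \<longrightarrow> (divides M (?d j) n \<longleftrightarrow> j \<prec> e 0 \<and> P j))"
      by (intro S_ex D_S D_intros D_divides P)
    \<comment> \<open>Start of the induction, the empty product: a modulus exceeds one because
      \<open>m\<close> is not zero.\<close>
    have "\<not> divides M (?d j) \<one>" for j
    proof -
      have "m \<otimes> (j \<oplus> \<one>) \<noteq> \<zero>" using m suc_neq by simp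
      then have "\<one> \<prec> ?d j" using pos_iff lt_suc_mono zero_add by metis
      moreover have "?d j \<preceq> \<one>" if "divides M (?d j) \<one>"
      proof -
        from that obtain q where q: "\<one> = ?d j \<otimes> q" unfolding divides_def by blast
        then obtain q' where "q = q' \<oplus> \<one>" using mul0 ar.zero_neq_one zero_or_suc by metis
        then show ?thesis using q mul_suc le_add2 by metis
      qed
      ultimately show ?thesis using le_lt by blast
    qed
    then show "\<exists>n. \<forall>j. j \<prec> k \<longrightarrow> (divides M (?d j) n \<longleftrightarrow> j \<prec> \<zero> \<and> P j)"
      using not_lt0 by blast
    fix i assume "\<exists>n. \<forall>j. j \<prec> k \<longrightarrow> (divides M (?d j) n \<longleftrightarrow> j \<prec> i \<and> P j)"
    then obtain n where n: "\<forall>j. j \<prec> k \<longrightarrow> (divides M (?d j) n \<longleftrightarrow> j \<prec> i \<and> P j)" by blast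
    show "\<exists>n. \<forall>j. j \<prec> k \<longrightarrow> (divides M (?d j) n \<longleftrightarrow> j \<prec> i \<oplus> \<one> \<and> P j)"
    proof (cases "i \<prec> k \<and> P i")
      case False then show ?thesis using n lt_suc by metis
    next
      case True
      have "divides M (?d j) (n \<otimes> ?d i) \<longleftrightarrow> j \<prec> i \<oplus> \<one> \<and> P j" if j: "j \<prec> k" for j
      proof (cases "j = i")
        case True then show ?thesis using \<open>i \<prec> k \<and> P i\<close> lt_suc by (simp add: divides_dvd)
      next
        case False
        then have "divides M (?d j) (n \<otimes> ?d i) \<longleftrightarrow> divides M (?d j) n"
          using beta_coprime[OF m(2) _ j, of i n] True by (metis ar.dvd_mult2 divides_dvd)
        then show ?thesis using n j False lt_suc by metis
      qed
      then show ?thesis by blast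
    qed
  qed
  from this[of k] show ?thesis by blast
qed

text \<open>\<open>ex_beta\<close> yields some triple with the right members, and
  \<open>D_least\<close> the least such triple, which is the code.\<close>

lemma ex_set_code:
  assumes "D (\<lambda>e. P (e 0))" "\<And>i. P i \<Longrightarrow> i \<prec> k"
  shows "\<exists>c. set_code M c \<and> members M c = {i. P i}"
proof -
  obtain m n where mn: "\<forall>j. j \<prec> k \<longrightarrow> (divides M (m \<otimes> (j \<oplus> \<one>) \<oplus> \<one>) n \<longleftrightarrow> P j)"
    using ex_beta[OF assms(1)] by metis
  define c0 where "c0 = pair M k (pair M m n)"
  have c0: "members M c0 = {i. P i}" "is_triple M c0"
    using mn assms(2) by (auto simp: members_def is_triple_def c0_def pair_inj)
  have *: "D (\<lambda>e. is_triple M (e 0) \<and> (\<forall>i. i \<prec> e 0 \<oplus> c0 \<longrightarrow> (i \<in> members M (e 0) \<longleftrightarrow> i \<in> members M c0)))"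
    by (intro D_intros D_members D_is_triple)
  obtain c where "is_triple M c \<and> members M c = members M c0"
    "\<forall>d. d \<prec> c \<longrightarrow> \<not> (is_triple M d \<and> members M d = members M c0)"
    using D_least[OF *, of c0] c0(2) unfolding members_eq_iff[symmetric] by blast
  then have "set_code M c \<and> members M c = members M c0"
    unfolding set_code_def by metis
  then show ?thesis using c0(1) by auto
qed

subsection \<open>Coding of finite sequences\<close>

lemma seq_len_iff: "seq_len M s l \<longleftrightarrow> set_code M s \<and>
     (\<forall>p. p \<prec> s \<longrightarrow> p \<in> members M s \<longrightarrow> (\<exists>i. i \<prec> l \<and> (\<exists>j. j \<preceq> s \<and> p = pair M i j))) \<and>
     (\<forall>i. i \<prec> l \<longrightarrow> (\<exists>j. j \<prec> s \<and> pair M i j \<in> members M s \<and>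
        (\<forall>j'. j' \<prec> s \<longrightarrow> pair M i j' \<in> members M s \<longrightarrow> j' = j)))"
proof -
  have 1: "(\<forall>p\<in>members M s. \<exists>i j. i \<prec> l \<and> p = pair M i j) \<longleftrightarrow>
    (\<forall>p. p \<prec> s \<longrightarrow> p \<in> members M s \<longrightarrow> (\<exists>i. i \<prec> l \<and> (\<exists>j. j \<preceq> s \<and> p = pair M i j)))"
    using members_less le_pair2 by (metis ar.le_less_trans ar.less_imp_le)
  have "j \<prec> s" if "pair M i j \<in> members M s" for i j
    using members_less[OF that] le_pair2 by (metis ar.le_less_trans)
  then have 2: "(\<exists>!j. pair M i j \<in> members M s) \<longleftrightarrow> (\<exists>j. j \<prec> s \<and> pair M i j \<in> members M s \<and>
        (\<forall>j'. j' \<prec> s \<longrightarrow> pair M i j' \<in> members M s \<longrightarrow> j' = j))" for i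
    by metis
  show ?thesis unfolding seq_len_def 1 2 ..
qed

lemma D_seq_len: "F s \<Longrightarrow> F t \<Longrightarrow> D (\<lambda>e. seq_len M (s e) (t e))"
  by (rule D_subst2[where P="seq_len M"])
    (unfold seq_len_iff, intro D_intros D_members D_set_code F_pair)

lemma seq_entry: "seq_len M s l \<Longrightarrow> i \<prec> l \<Longrightarrow> \<exists>!j. pair M i j \<in> members M s"
  unfolding seq_len_def by blast

lemma seq_pos: "seq_len M s l \<Longrightarrow> pair M i j \<in> members M s \<Longrightarrow> i \<prec> l"
  unfolding seq_len_def using pair_inj by metis

lemma seq_len_unique: "seq_len M s l \<Longrightarrow> seq_len M s l' \<Longrightarrow> l = l'"
  using seq_entry seq_pos lt_linear lt_irrefl by metis

lemma seq_len_le: assumes "seq_len M s l" shows "l \<preceq> s"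
proof (rule ccontr)
  assume "\<not> l \<preceq> s"
  then have "s \<prec> l" using le_lt by blast
  then obtain j where "pair M s j \<in> members M s" using seq_entry[OF assms] by blast
  then show False using members_less le_pair1 le_lt by blast
qed

text \<open>One inclusion is enough, both graphs being functions on the numbers below
  \<open>l\<close>.\<close>

lemma seq_eqI:
  assumes "seq_len M s l" "seq_len M t l" "\<And>i j. pair M i j \<in> members M s \<Longrightarrow> pair M i j \<in> members M t"
  shows "s = t"
proof (rule set_code_inj)
  show "set_code M s" "set_code M t" using assms by (auto simp: seq_len_def)
  have "pair M i j \<in> members M s" if "pair M i j \<in> members M t" for i j
    using that assms seq_entry seq_pos by metis
  moreover have "\<forall>p\<in>members M s \<union> members M t. \<exists>i j. p = pair M i j" using assms(1,2) unfolding seq_len_def by blast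
  ultimately have "p \<in> members M s \<longleftrightarrow> p \<in> members M t" for p using assms(3) by (metis UnI1 UnI2)
  then show "members M s = members M t" by blast
qed

definition Seq :: "'a \<Rightarrow> bool" where "Seq s \<longleftrightarrow> (\<exists>l. seq_len M s l)"
definition lh :: "'a \<Rightarrow> 'a" where "lh s = (if Seq s then THE l. seq_len M s l else \<zero>)"
definition app :: "'a \<Rightarrow> 'a \<Rightarrow> 'a" where "app s a = (if Seq s then THE t. snoc M s a t else \<zero>)"

lemma lh_eq: "seq_len M s l \<Longrightarrow> lh s = l"
  unfolding lh_def Seq_def using seq_len_unique by auto
lemma seq_len_lh: "Seq s \<Longrightarrow> seq_len M s (lh s)"
  unfolding Seq_def using lh_eq by auto
lemma SeqI: "seq_len M s l \<Longrightarrow> Seq s" unfolding Seq_def by blast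
lemma Seq_iff: "Seq s \<longleftrightarrow> (\<exists>l. l \<preceq> s \<and> seq_len M s l)" unfolding Seq_def using seq_len_le by blast
lemma D_Seq: "F t \<Longrightarrow> D (\<lambda>e. Seq (t e))"
  by (rule D_subst1[where P="\<lambda>s e. Seq s"]) (unfold Seq_iff, intro D_intros D_seq_len)
lemma F_lh: "F t \<Longrightarrow> F (\<lambda>e. lh (t e))"
proof (rule F_subst1[where f=lh])
  have "a = lh s \<longleftrightarrow> (if Seq s then seq_len M s a else a = \<zero>)" for a s
    using lh_eq[of s a] seq_len_lh[of s] by (cases "Seq s") (auto simp: lh_def)
  then show "S (\<lambda>e. e 0 = lh (e 1))"
    by (simp only:) (intro D_S D_intros D_Seq D_seq_len)
qed

lemma ex_snoc: assumes "seq_len M s l" shows "\<exists>t. snoc M s a t"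
proof -
  let ?P = "\<lambda>p. p \<in> members M s \<or> p = pair M l a"
  have "\<exists>c. set_code M c \<and> members M c = {p. ?P p}"
  proof (rule ex_set_code)
    show "D (\<lambda>e. ?P (e 0))" by (intro D_intros D_members)
    show "p \<prec> s \<oplus> pair M l a \<oplus> \<one>" if "?P p" for p
      unfolding lt_suc using that members_less le_add1 le_add2 ar.less_le_trans le_def by metis
  qed
  then obtain t where t: "set_code M t" "members M t = {p. ?P p}" by blast
  have "seq_len M t (l \<oplus> \<one>)"
    unfolding seq_len_def lt_suc
  proof (intro conjI t(1) ballI allI impI)
    fix p assume "p \<in> members M t"
    then show "\<exists>i j. (i \<prec> l \<or> i = l) \<and> p = pair M i j" using t(2) assms unfolding seq_len_def by blast
  next
    fix i assume "i \<prec> l \<or> i = l"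
    then show "\<exists>!j. pair M i j \<in> members M t"
    proof
      assume i: "i \<prec> l"
      then have "i \<noteq> l" using lt_irrefl by blast
      then show ?thesis using seq_entry[OF assms i] t(2) pair_inj by simp
    next
      assume "i = l"
      moreover have "pair M l j \<notin> members M s" for j using seq_pos[OF assms] lt_irrefl by blast
      ultimately show ?thesis using t(2) pair_inj by simp
    qed
  qed
  then show ?thesis unfolding snoc_def using assms t(2) pair_inj by (intro exI[of _ t] exI[of _ l]) auto
qed

lemma snoc_unique: "snoc M s a t \<Longrightarrow> snoc M s a t' \<Longrightarrow> t = t'"
  unfolding snoc_def using seq_eqI seq_len_unique by metis

lemma snoc_iff: "snoc M s a t \<longleftrightarrow> Seq s \<and> t = app s a"
proof
  assume *: "snoc M s a t"
  then have "Seq s" unfolding snoc_def Seq_def by blast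
  then show "Seq s \<and> t = app s a" using * snoc_unique unfolding app_def by (auto intro!: the_equality[symmetric])
next
  assume *: "Seq s \<and> t = app s a"
  then have "\<exists>t. snoc M s a t" using ex_snoc unfolding Seq_def by blast
  then have "snoc M s a (THE t. snoc M s a t)" using snoc_unique theI' by metis
  then show "snoc M s a t" using * unfolding app_def by simp
qed

lemma seq_len_app: "seq_len M s l \<Longrightarrow> seq_len M (app s a) (l \<oplus> \<one>)"
  using snoc_iff[of s a "app s a"] SeqI seq_len_unique unfolding snoc_def by metis
lemma Seq_app [simp]: "Seq s \<Longrightarrow> Seq (app s a)" using seq_len_app Seq_def by blast
lemma lh_app [simp]: "Seq s \<Longrightarrow> lh (app s a) = lh s \<oplus> \<one>" using seq_len_app seq_len_lh lh_eq by blast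
lemma members_app: "Seq s \<Longrightarrow>
    pair M i j \<in> members M (app s a) \<longleftrightarrow> pair M i j \<in> members M s \<or> (i = lh s \<and> j = a)"
  using snoc_iff[of s a "app s a"] lh_eq unfolding snoc_def by blast

lemma app_inj: assumes "Seq s" "Seq t" "app s a = app t b" shows "s = t \<and> a = b"
proof -
  have l: "lh s = lh t" using lh_app assms suc_inj by metis
  have *: "pair M i j \<in> members M s \<or> (i = lh s \<and> j = a) \<longleftrightarrow> pair M i j \<in> members M t \<or> (i = lh s \<and> j = b)" for i j
    using members_app assms l by metis
  have "pair M (lh s) j \<notin> members M s" "pair M (lh s) j \<notin> members M t" for j
    using seq_pos seq_len_lh assms l lt_irrefl by metis+
  then have "a = b" and "pair M i j \<in> members M s \<Longrightarrow> pair M i j \<in> members M t" for i j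
    using * by metis+
  then show ?thesis using seq_eqI seq_len_lh assms l by metis
qed

text \<open>A pair that matters has components below the sum of all the data, so the unbounded
  quantifiers can be cut off. \<open>F_app\<close> rests on the resulting Delta01 form.\<close>

lemma snoc_bounded: "snoc M s a t \<longleftrightarrow> (\<exists>l. l \<preceq> s \<and> seq_len M s l \<and> seq_len M t (l \<oplus> \<one>) \<and>
     (\<forall>i. i \<preceq> s \<oplus> (t \<oplus> (l \<oplus> a)) \<longrightarrow> (\<forall>j. j \<preceq> s \<oplus> (t \<oplus> (l \<oplus> a)) \<longrightarrow>
        (pair M i j \<in> members M t \<longleftrightarrow> pair M i j \<in> members M s \<or> (i = l \<and> j = a)))))"
proof -
  have *: "i \<preceq> s \<oplus> (t \<oplus> (l \<oplus> a)) \<and> j \<preceq> s \<oplus> (t \<oplus> (l \<oplus> a))"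
    if "pair M i j \<in> members M t \<or> pair M i j \<in> members M s \<or> (i = l \<and> j = a)" for l i j
    using that
  proof (elim disjE)
    assume "pair M i j \<in> members M t"
    then have "pair M i j \<preceq> t" using members_less le_def by blast
    then have "i \<preceq> t" "j \<preceq> t" using le_pair1 le_pair2 ar.order.trans by metis+
    then show ?thesis using le_add1[of t] le_add2[of "t \<oplus> (l \<oplus> a)" s] ar.order.trans by metis
  next
    assume "pair M i j \<in> members M s"
    then have "pair M i j \<preceq> s" using members_less le_def by blast
    then have "i \<preceq> s" "j \<preceq> s" using le_pair1 le_pair2 ar.order.trans by metis+
    then show ?thesis using le_add1[of s] ar.order.trans by metis
  next
    assume "i = l \<and> j = a"
    then show ?thesis using le_add1 le_add2 ar.order.trans by metis
  qed
  have eq: "(\<forall>i j. pair M i j \<in> members M t \<longleftrightarrow> pair M i j \<in> members M s \<or> (i = l \<and> j = a)) \<longleftrightarrow>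
    (\<forall>i. i \<preceq> s \<oplus> (t \<oplus> (l \<oplus> a)) \<longrightarrow> (\<forall>j. j \<preceq> s \<oplus> (t \<oplus> (l \<oplus> a)) \<longrightarrow>
        (pair M i j \<in> members M t \<longleftrightarrow> pair M i j \<in> members M s \<or> (i = l \<and> j = a))))" for l
  proof -
    have bounded: "(\<forall>i j. A i j \<longleftrightarrow> C i j) \<longleftrightarrow> (\<forall>i. I i \<longrightarrow> (\<forall>j. I j \<longrightarrow> (A i j \<longleftrightarrow> C i j)))"
      if "\<forall>i j. A i j \<or> C i j \<longrightarrow> I i \<and> I j" for A C :: "'a \<Rightarrow> 'a \<Rightarrow> bool" and I
      using that by metis
    show ?thesis by (rule bounded) (use * in blast)
  qed
  show ?thesis unfolding snoc_def eq by (rule ex_cong1) (use seq_len_le in blast)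
qed

lemma D_snoc: "F r \<Longrightarrow> F s \<Longrightarrow> F t \<Longrightarrow> D (\<lambda>e. snoc M (r e) (s e) (t e))"
  by (rule D_subst3[where P="snoc M"])
    (unfold snoc_bounded, intro D_intros D_members D_seq_len F_pair)

lemma F_app: "F s \<Longrightarrow> F t \<Longrightarrow> F (\<lambda>e. app (s e) (t e))"
proof (rule F_subst2[where f=app])
  have "b = app s a \<longleftrightarrow> (if Seq s then snoc M s a b else b = \<zero>)" for a s b
    using snoc_iff[of s a b] by (cases "Seq s") (auto simp: app_def)
  then show "S (\<lambda>e. e 0 = app (e 1) (e 2))"
    by (simp only:) (intro D_S D_intros D_Seq D_snoc)
qed

subsection \<open>Infinite sequences and plays\<close>

definition eps :: 'a where "eps = (THE s. seq_len M s \<zero>)"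
definition nth :: "'a set \<Rightarrow> 'a \<Rightarrow> 'a" where "nth x i = (THE j. pair M i j \<in> x)"
definition pre :: "'a set \<Rightarrow> 'a \<Rightarrow> 'a" where "pre x n = (THE t. seg M x n t)"

lemma seq_len_zero: "seq_len M s \<zero> \<longleftrightarrow> s = eps"
proof -
  have "\<exists>c. set_code M c \<and> members M c = {i. False}"
    by (rule ex_set_code) (auto intro: D_const)
  then obtain c where "seq_len M c \<zero>" unfolding seq_len_def using not_lt0 by auto
  moreover have "s = t" if "seq_len M s \<zero>" "seq_len M t \<zero>" for s t
    using seq_eqI that seq_pos not_lt0 by metis
  ultimately show ?thesis unfolding eps_def by (metis the_equality)
qed

lemma members_pair: "Seq s \<Longrightarrow> p \<in> members M s \<Longrightarrow> \<exists>i j. i \<prec> lh s \<and> p = pair M i j"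
  using seq_len_lh unfolding seq_len_def by blast

lemma members_sub_app: "Seq s \<Longrightarrow> members M s \<subseteq> members M (app s a)"
  using members_pair members_app by blast

lemma Seq_eps [simp]: "Seq eps" and lh_eps [simp]: "lh eps = \<zero>"
  using seq_len_zero SeqI lh_eq by blast+

text \<open>Since \<open>x\<close> is functional and \<open>t\<close> is defined at every index
  below \<open>n\<close>, inclusion of the graphs forces agreement. The bounded form shows that
  initial segments are Delta01 in \<open>x\<close>.\<close>

lemma seg_iff:
  assumes "infinite_seq M x"
  shows "seg M x n t \<longleftrightarrow> seq_len M t n \<and> (\<forall>p. p \<prec> t \<longrightarrow> p \<in> members M t \<longrightarrow> p \<in> x)"
proof
  assume *: "seg M x n t"
  then show "seq_len M t n \<and> (\<forall>p. p \<prec> t \<longrightarrow> p \<in> members M t \<longrightarrow> p \<in> x)"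
    unfolding seg_def seq_len_def by metis
next
  assume "seq_len M t n \<and> (\<forall>p. p \<prec> t \<longrightarrow> p \<in> members M t \<longrightarrow> p \<in> x)"
  then have t: "seq_len M t n" and sub: "members M t \<subseteq> x" using members_less by blast+
  have "pair M i j \<in> members M t" if ij: "i \<prec> n" "pair M i j \<in> x" for i j
  proof -
    obtain j' where j': "pair M i j' \<in> members M t" using seq_entry[OF t ij(1)] by blast
    have "\<exists>!j. pair M i j \<in> x" using assms unfolding infinite_seq_def by blast
    then show ?thesis using j' sub ij(2) by blast
  qed
  then show "seg M x n t" unfolding seg_def using t sub seq_pos[OF t] by blast
qed

lemma seg_unique: "seg M x n t \<Longrightarrow> seg M x n t' \<Longrightarrow> t = t'"
  unfolding seg_def using seq_eqI by metis

lemma infinite_seq_sets: "infinite_seq M x \<Longrightarrow> x \<in> sets M" unfolding infinite_seq_def by blast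

lemma D_seg: "infinite_seq M x \<Longrightarrow> F s \<Longrightarrow> F t \<Longrightarrow> D (\<lambda>e. seg M x (s e) (t e))"
  by (rule D_subst2[where P="seg M x"])
    (unfold seg_iff, intro D_intros D_members D_seq_len infinite_seq_sets)

context
  fixes x assumes x: "infinite_seq M x"
begin

lemma nth_iff: "pair M i j \<in> x \<longleftrightarrow> j = nth x i"
proof -
  have "\<exists>!j. pair M i j \<in> x" using x unfolding infinite_seq_def by blast
  then show ?thesis unfolding nth_def by (metis (no_types, lifting) the_equality)
qed

lemma seg_snoc: assumes "seg M x n t" shows "seg M x (n \<oplus> \<one>) (app t (nth x n))"
proof -
  have t: "seq_len M t n" using assms unfolding seg_def by blast
  then have "seq_len M (app t (nth x n)) (n \<oplus> \<one>)" using seq_len_app by blast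
  moreover have "pair M i j \<in> members M (app t (nth x n)) \<longleftrightarrow> i \<prec> n \<oplus> \<one> \<and> pair M i j \<in> x" for i j
    using assms members_app[OF SeqI[OF t]] lh_eq[OF t] nth_iff unfolding seg_def lt_suc by metis
  ultimately show ?thesis unfolding seg_def by blast
qed

lemma seg_zero: "seg M x \<zero> eps"
  unfolding seg_iff[OF x] using seq_len_zero[of eps] seq_pos not_lt0 by (metis seq_len_def)

lemma seg_pre: "seg M x n (pre x n)"
proof -
  have "\<exists>t. seg M x n t"
  proof (rule S_induction[where P="\<lambda>n. \<exists>t. seg M x n t"])
    show "S (\<lambda>e. \<exists>t. seg M x (e 0) t)" by (intro S_ex D_S D_seg x F_intros)
  qed (use seg_zero seg_snoc in blast)+
  then show ?thesis unfolding pre_def using seg_unique by (metis theI')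
qed

lemma seg_pre_iff: "seg M x n t \<longleftrightarrow> t = pre x n" using seg_pre seg_unique by blast
lemma pre_zero: "pre x \<zero> = eps" using seg_zero seg_pre_iff by simp
lemma pre_Suc: "pre x (n \<oplus> \<one>) = app (pre x n) (nth x n)" using seg_snoc[OF seg_pre] seg_pre_iff by simp
lemma seq_len_pre: "seq_len M (pre x n) n" using seg_pre unfolding seg_def by blast
lemma Seq_pre: "Seq (pre x n)" using seq_len_pre SeqI by blast
lemma lh_pre: "lh (pre x n) = n" using seq_len_pre lh_eq by blast
lemma pre_entry: "pair M i j \<in> members M (pre x n) \<longleftrightarrow> i \<prec> n \<and> j = nth x i"
  using seg_pre nth_iff unfolding seg_def by blast
lemma seg_in_iff: "seg_in M x n T \<longleftrightarrow> pre x n \<in> T" unfolding seg_in_def seg_pre_iff by blast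
lemma seg_of_pre: assumes "n \<preceq> m" shows "seg M (members M (pre x m)) n t \<longleftrightarrow> t = pre x n"
proof -
  have "i \<prec> n \<and> pair M i j \<in> members M (pre x m) \<longleftrightarrow> i \<prec> n \<and> pair M i j \<in> x" for i j
    using assms pre_entry nth_iff ar.less_le_trans by metis
  then show ?thesis unfolding seg_pre_iff[symmetric] unfolding seg_def by simp
qed
lemma seg_in_of_pre: "n \<preceq> m \<Longrightarrow> seg_in M (members M (pre x m)) n T \<longleftrightarrow> pre x n \<in> T"
  by (auto simp: seg_in_def seg_of_pre Bex_def)
lemma n_le_pre: "n \<preceq> pre x n" using seq_len_pre seq_len_le by blast

lemma F_nth: "F t \<Longrightarrow> F (\<lambda>e. nth x (t e))"
  by (rule F_subst1[where f="nth x"])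
    (unfold nth_iff[symmetric], intro D_S D_intros F_pair infinite_seq_sets[OF x])
lemma F_pre: "F t \<Longrightarrow> F (\<lambda>e. pre x (t e))"
  by (rule F_subst1[where f="pre x"])
    (unfold seg_pre_iff[symmetric], intro D_S D_intros D_seg x)

end

lemma F_S_eq: "F s \<Longrightarrow> F t \<Longrightarrow> S (\<lambda>e. s e = t e)" by (intro D_S D_eq)

text \<open>Course-of-values recursion, and the source of all plays. Approximations of every length
  exist by Sigma01 induction, and those of equal length coincide by \<open>uniq\<close>, so the
  sequence read off from them is Delta01.\<close>

lemma ex_generated:
  assumes h: "F (\<lambda>e. h (e 0))"
  shows "\<exists>x. infinite_seq M x \<and> (\<forall>n. nth x n = h (pre x n))"
proof -
  note Fh = F_move[OF h]
  define sb where "sb t s \<longleftrightarrow> (\<forall>p. p \<prec> t \<longrightarrow> p \<in> members M t \<longrightarrow> p \<in> members M s)" for t s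
  have sbD: "sb t s \<longleftrightarrow> members M t \<subseteq> members M s" for t s
    unfolding sb_def using members_less by blast
  \<comment> \<open>A correct approximation: each entry is \<open>h\<close> of the segment before
    it. That segment \<open>t\<close> is guessed by an unbounded quantifier, which leaves
    \<open>gd\<close> Sigma01.\<close>
  define gd where "gd s \<longleftrightarrow> Seq s \<and>
    (\<forall>i. i \<prec> lh s \<longrightarrow> (\<exists>t. seq_len M t i \<and> sb t s \<and> pair M i (h t) \<in> members M s))" for s
  have S_gd: "S (\<lambda>e. gd (e k))" for k
    unfolding gd_def sb_def
    by (intro S_conj S_ball F_lh F_intros S_ex D_Seq D_S[OF D_Seq] D_S[OF D_seq_len] D_S[OF D_members]
      D_S[OF D_ball] D_intros D_members F_pair Fh)
  have gd_app: "gd (app s (h s))" if s: "gd s" for s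
  proof -
    have Seq: "Seq s" using s unfolding gd_def by blast
    have "\<exists>t. seq_len M t i \<and> sb t (app s (h s)) \<and> pair M i (h t) \<in> members M (app s (h s))"
      if "i \<prec> lh s \<oplus> \<one>" for i
    proof -
      have sub: "members M s \<subseteq> members M (app s (h s))"
        by (rule members_sub_app[OF Seq])
      show ?thesis
      proof (cases "i = lh s")
        case True
        then show ?thesis using sub sbD seq_len_lh[OF Seq] members_app[OF Seq] by blast
      next
        case False
        then have "i \<prec> lh s" using that lt_suc by blast
        then obtain t where "seq_len M t i \<and> sb t s \<and> pair M i (h t) \<in> members M s"
          using s unfolding gd_def by blast
        then show ?thesis using sub unfolding sbD by blast
      qed
    qed
    then show ?thesis using Seq unfolding gd_def by simp
  qed
  have ex: "\<exists>s. gd s \<and> lh s = n" for n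
  proof (rule S_induction[where P="\<lambda>n. \<exists>s. gd s \<and> lh s = n"])
    show "S (\<lambda>e. \<exists>s. gd s \<and> lh s = e 0)"
      by (intro S_ex S_conj S_gd F_S_eq F_lh F_intros)
    have "gd eps" unfolding gd_def using not_lt0 by simp
    then show "\<exists>s. gd s \<and> lh s = \<zero>" using lh_eps by blast
    fix n assume "\<exists>s. gd s \<and> lh s = n"
    then show "\<exists>s. gd s \<and> lh s = n \<oplus> \<one>" using gd_app lh_app gd_def by metis
  qed
  have uniq: "s = s'" if s: "gd s" "gd s'" "lh s = lh s'" for s s'
  proof -
    have Seq: "seq_len M s (lh s)" "seq_len M s' (lh s)" using s seq_len_lh unfolding gd_def by metis+
    \<comment> \<open>The bound on \<open>j\<close>, harmless by \<open>bd\<close>, keeps the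
      induction predicate within \<open>S\<close>.\<close>
    let ?Q = "\<lambda>n. n \<preceq> lh s \<longrightarrow> (\<forall>i. i \<prec> n \<longrightarrow> (\<forall>j. j \<prec> s \<longrightarrow>
      (pair M i j \<in> members M s \<longrightarrow> pair M i j \<in> members M s')))"
    have bd: "j \<prec> s" if "pair M i j \<in> members M s" for i j
      using that members_less le_pair2 ar.le_less_trans by metis
    have "?Q n" for n
    proof (rule S_induction[where P="?Q"])
      show "S (\<lambda>e. ?Q (e 0))" by (intro D_S D_intros D_members F_pair)
      show "?Q \<zero>" using not_lt0 by blast
      fix n assume IH: "?Q n"
      show "?Q (n \<oplus> \<one>)"
      proof (intro impI allI)
        fix i j assume n: "n \<oplus> \<one> \<preceq> lh s" and i: "i \<prec> n \<oplus> \<one>" and j: "j \<prec> s" "pair M i j \<in> members M s"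
        have nl: "n \<prec> lh s" using n lt_succ_le by blast
        show "pair M i j \<in> members M s'"
        proof (cases "i = n")
          case False
          then show ?thesis using IH i j nl lt_suc le_def by blast
        next
          case True
          obtain t where t: "seq_len M t n" "sb t s" "pair M n (h t) \<in> members M s"
            using s(1) nl unfolding gd_def by blast
          obtain t' where t': "seq_len M t' n" "sb t' s'" "pair M n (h t') \<in> members M s'"
            using s(2,3) nl unfolding gd_def by metis
          have "pair M k l \<in> members M t'" if kl: "pair M k l \<in> members M t" for k l
          proof -
            have k: "k \<prec> n" using kl t(1) seq_pos by blast
            have "pair M k l \<in> members M s" using kl t(2) sbD by blast
            then have 1: "pair M k l \<in> members M s'" using IH k nl le_def bd by blast
            obtain l' where l': "pair M k l' \<in> members M t'" using seq_entry[OF t'(1) k] by blast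
            then have "pair M k l' \<in> members M s'" using t'(2) sbD by blast
            then have "l = l'" using 1 seq_entry[OF Seq(2)] seq_pos[OF Seq(2)] by metis
            then show ?thesis using l' by blast
          qed
          then have "t = t'" using seq_eqI t t' by blast
          moreover have "j = h t" using t(3) j(2) True seq_entry[OF Seq(1)] seq_pos[OF Seq(1)] by metis
          ultimately show ?thesis using t' True by blast
        qed
      qed
    qed
    then have "pair M i j \<in> members M s'" if "pair M i j \<in> members M s" for i j
      using that seq_pos[OF Seq(1)] bd ar.order.refl by blast
    then show ?thesis using seq_eqI Seq by blast
  qed
  define x where "x = {p. \<exists>s. gd s \<and> p = pair M (lh s) (h s)}"
  have px: "pair M i j \<in> x \<longleftrightarrow> (\<exists>s. gd s \<and> lh s = i \<and> h s = j)" for i j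
    unfolding x_def using pair_inj by auto
  \<comment> \<open>The complement is Sigma01 too: either \<open>p\<close> is no pair, or some
    approximation gives another value.\<close>
  have "p \<notin> x \<longleftrightarrow> \<not> (\<exists>i. i \<preceq> p \<and> (\<exists>j. j \<preceq> p \<and> p = pair M i j)) \<or>
      (\<exists>s. gd s \<and> (\<exists>j. p = pair M (lh s) j \<and> h s \<noteq> j))" for p
  proof (cases "\<exists>i j. p = pair M i j")
    case True
    then obtain i j where p: "p = pair M i j" by blast
    obtain s where s: "gd s" "lh s = i" using ex by blast
    have "p \<notin> x \<longleftrightarrow> h s \<noteq> j" using px s p uniq by metis
    moreover have "(\<exists>s. gd s \<and> (\<exists>j. p = pair M (lh s) j \<and> h s \<noteq> j)) \<longleftrightarrow> h s \<noteq> j"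
      using p s uniq pair_inj by metis
    ultimately show ?thesis using p le_pair1 le_pair2 by blast
  next
    case False
    then show ?thesis unfolding x_def by blast
  qed
  moreover have "S (\<lambda>e. \<exists>s. gd s \<and> e 0 = pair M (lh s) (h s))"
    by (intro S_ex S_conj S_gd F_S_eq F_pair Fh F_lh F_intros)
  moreover have "S (\<lambda>e. \<not> (\<exists>i. i \<preceq> e 0 \<and> (\<exists>j. j \<preceq> e 0 \<and> e 0 = pair M i j)) \<or>
      (\<exists>s. gd s \<and> (\<exists>j. e 0 = pair M (lh s) j \<and> h s \<noteq> j)))"
    by (intro S_disj S_ex S_conj S_gd F_S_eq D_S[OF D_not] D_intros F_pair Fh F_lh)
  ultimately have D: "D (\<lambda>e. e 0 \<in> x)" unfolding D_def by (simp add: x_def)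
  then have "x \<in> sets M" using D_set[of "\<lambda>a. a \<in> x"] by simp
  moreover have "\<exists>!j. pair M i j \<in> x" for i using px ex uniq by metis
  ultimately have inf: "infinite_seq M x" unfolding infinite_seq_def x_def by blast
  \<comment> \<open>\<open>x\<close> was defined from values of \<open>h\<close>, so its initial
    segments have still to be identified with the approximations. To this end each segment
    \<open>t\<close> of \<open>s\<close> is shown to be an approximation itself.\<close>
  have pre: "pre x n = s" if s: "gd s" "lh s = n" for n s
  proof -
    have Seq: "Seq s" and ls: "seq_len M s n" using s seq_len_lh unfolding gd_def by auto
    have "pair M i j \<in> x" if ij: "pair M i j \<in> members M s" for i j
    proof -
      have i: "i \<prec> lh s" using seq_pos[OF ls] ij s by blast
      then obtain t where t: "seq_len M t i" "sb t s" "pair M i (h t) \<in> members M s"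
        using s(1) unfolding gd_def by blast
      have "j = h t" using t(3) ij seq_entry[OF ls] seq_pos[OF ls] by metis
      moreover have "gd t" unfolding gd_def lh_eq[OF t(1)]
      proof (intro conjI SeqI[OF t(1)] allI impI)
        fix k assume k: "k \<prec> i"
        then obtain t' where t': "seq_len M t' k" "sb t' s" "pair M k (h t') \<in> members M s"
          using s(1) i lt_trans unfolding gd_def by blast
        have tr: "pair M a b \<in> members M t" if ab: "pair M a b \<in> members M s" "a \<prec> i" for a b
        proof -
          obtain b' where b': "pair M a b' \<in> members M t" using seq_entry[OF t(1)] ab by blast
          then have "b' = b" using t(2) ab seq_entry[OF ls] seq_pos[OF ls] unfolding sbD by blast
          then show ?thesis using b' by blast
        qed
        have "sb t' t"
        proof -
          have "p \<in> members M t" if p: "p \<in> members M t'" for p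
          proof -
            obtain a b where ab: "p = pair M a b" "a \<prec> k" using t'(1) p unfolding seq_len_def by blast
            then show ?thesis using tr p t'(2) k lt_trans unfolding sbD by blast
          qed
          then show ?thesis unfolding sbD by blast
        qed
        then show "\<exists>t'. seq_len M t' k \<and> sb t' t \<and> pair M k (h t') \<in> members M t"
          using t' tr k by blast
      qed
      ultimately show ?thesis using px lh_eq[OF t(1)] by blast
    qed
    then have "seg M x n s" unfolding seg_iff[OF inf] using ls unfolding seq_len_def by metis
    then show ?thesis using seg_pre_iff[OF inf] by simp
  qed
  have "nth x n = h (pre x n)" for n
  proof -
    obtain s where s: "gd s" "lh s = n" using ex by blast
    then have "pair M n (h s) \<in> x" using px by blast
    then show ?thesis using pre[OF s] nth_iff[OF inf] by simp
  qed
  then show ?thesis using inf by blast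
qed

subsection \<open>Parity, strategies and trees\<close>

lemma even_iff: "is_even M n \<longleftrightarrow> (\<exists>m. m \<preceq> n \<and> n = m \<oplus> m)"
  unfolding is_even_def using le_add1 by blast
lemma D_even: "F t \<Longrightarrow> D (\<lambda>e. is_even M (t e))"
  by (rule D_subst1[where P="\<lambda>s e. is_even M s"]) (unfold even_iff, intro D_intros)
lemma even_zero: "is_even M \<zero>" unfolding is_even_def using add0 by metis
lemma odd_suc: "is_odd M (n \<oplus> \<one>) \<longleftrightarrow> is_even M n"
  unfolding is_even_def is_odd_def using suc_inj by metis
lemma even_suc: "is_even M (n \<oplus> \<one>) \<longleftrightarrow> is_odd M n"
proof
  assume "is_odd M n"
  then obtain m where "n = m \<oplus> m \<oplus> \<one>" unfolding is_odd_def by blast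
  then have "n \<oplus> \<one> = (m \<oplus> \<one>) \<oplus> (m \<oplus> \<one>)" by (simp only: ar.add_ac)
  then show "is_even M (n \<oplus> \<one>)" unfolding is_even_def by blast
next
  assume "is_even M (n \<oplus> \<one>)"
  then obtain m where m: "n \<oplus> \<one> = m \<oplus> m" unfolding is_even_def by blast
  then obtain k where k: "m = k \<oplus> \<one>" using zero_or_suc add0 suc_neq by metis
  have "n \<oplus> \<one> = (k \<oplus> k \<oplus> \<one>) \<oplus> \<one>" using m unfolding k by (simp only: ar.add_ac)
  then show "is_odd M n" unfolding is_odd_def using suc_inj by blast
qed
lemma odd_iff: "is_odd M n \<longleftrightarrow> \<not> is_even M n"
proof (rule S_induction[where P="\<lambda>n. is_odd M n \<longleftrightarrow> \<not> is_even M n"])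
  have "is_odd M n \<longleftrightarrow> (\<exists>m. m \<preceq> n \<and> n = m \<oplus> m \<oplus> \<one>)" for n
    unfolding is_odd_def using le_add1 ar.order.trans by metis
  then show "S (\<lambda>e. is_odd M (e 0) \<longleftrightarrow> \<not> is_even M (e 0))"
    by (simp only:) (intro D_S D_intros D_even)
  show "is_odd M \<zero> \<longleftrightarrow> \<not> is_even M \<zero>" using even_zero suc_neq unfolding is_odd_def by metis
qed (simp add: odd_suc even_suc)

lemma is_play_iff: "is_play M \<sigma> \<tau> x \<longleftrightarrow> infinite_seq M x \<and>
   (\<forall>i. pair M (pre x i) (nth x i) \<in> (if is_even M i then \<sigma> else \<tau>))"
proof (cases "infinite_seq M x")
  case True
  then show ?thesis unfolding is_play_def seg_pre_iff[OF True] nth_iff[OF True] odd_iff by (auto split: if_splits)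
qed (simp add: is_play_def)

text \<open>The player moving at even positions is denoted by \<open>True\<close>.\<close>

definition strat :: "bool \<Rightarrow> 'a set \<Rightarrow> bool" where
  "strat pl \<sigma> = (if pl then strategy_I M \<sigma> else strategy_II M \<sigma>)"

definition strat_of :: "bool \<Rightarrow> ('a \<Rightarrow> 'a) \<Rightarrow> 'a set" where
  "strat_of pl h = {p. \<exists>s. Seq s \<and> is_even M (lh s) = pl \<and> p = pair M s (h s)}"

lemma strat_iff: "strat pl \<sigma> \<longleftrightarrow> \<sigma> \<in> sets M \<and>
   (\<forall>p\<in>\<sigma>. \<exists>s a. Seq s \<and> is_even M (lh s) = pl \<and> p = pair M s a) \<and>
   (\<forall>s. Seq s \<longrightarrow> is_even M (lh s) = pl \<longrightarrow> (\<exists>!a. pair M s a \<in> \<sigma>))"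
proof -
  have "(\<exists>s l a. seq_len M s l \<and> P l \<and> p = pair M s a) \<longleftrightarrow> (\<exists>s a. Seq s \<and> P (lh s) \<and> p = pair M s a)"
    "(\<forall>s l. seq_len M s l \<longrightarrow> P l \<longrightarrow> Q s) \<longleftrightarrow> (\<forall>s. Seq s \<longrightarrow> P (lh s) \<longrightarrow> Q s)" for P Q p
    using lh_eq seq_len_lh SeqI by metis+
  then show ?thesis
    unfolding strat_def strategy_I_def strategy_II_def odd_iff by simp
qed

lemma strat_of: assumes h: "F (\<lambda>e. h (e 0))" shows "strat pl (strat_of pl h)"
proof -
  note Fh = F_move[OF h]
  have "p \<in> strat_of pl h \<longleftrightarrow> (\<exists>s. s \<preceq> p \<and> Seq s \<and> (is_even M (lh s) \<longleftrightarrow> pl) \<and> p = pair M s (h s))" for p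
    unfolding strat_of_def using le_pair1 by blast
  then have "D (\<lambda>e. e 0 \<in> strat_of pl h)"
    by (simp only:) (intro D_intros D_Seq D_even F_lh F_pair Fh)
  then have "strat_of pl h \<in> sets M" using D_set[of "\<lambda>a. a \<in> strat_of pl h"] by simp
  then show ?thesis unfolding strat_iff unfolding strat_of_def using pair_inj by auto
qed

lemma strat_of_mem: "Seq s \<Longrightarrow> is_even M (lh s) = pl \<Longrightarrow> pair M s a \<in> strat_of pl h \<longleftrightarrow> a = h s"
  unfolding strat_of_def using pair_inj by auto

text \<open>The two strategies are merged into a single function of the position, and
  \<open>ex_generated\<close> iterates it.\<close>

lemma ex_play:
  assumes "strat True \<sigma>" "strat False \<tau>" shows "\<exists>x. is_play M \<sigma> \<tau> x"
proof -
  define h where "h s = (if Seq s then THE a. pair M s a \<in> (if is_even M (lh s) then \<sigma> else \<tau>) else \<zero>)" for s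
  have h: "pair M s (h s) \<in> (if is_even M (lh s) then \<sigma> else \<tau>)" if "Seq s" for s
  proof -
    have "\<exists>!a. pair M s a \<in> (if is_even M (lh s) then \<sigma> else \<tau>)" using assms that unfolding strat_iff by auto
    from theI'[OF this] show ?thesis using that unfolding h_def by simp
  qed
  have "a = h s \<longleftrightarrow> (if Seq s then (if is_even M (lh s) then pair M s a \<in> \<sigma> else pair M s a \<in> \<tau>) else a = \<zero>)" for s a
    using h[of s] assms unfolding strat_iff by (cases "Seq s") (auto simp: h_def)
  moreover have "S (\<lambda>e. if Seq (e 1) then (if is_even M (lh (e 1)) then pair M (e 1) (e 0) \<in> \<sigma> else pair M (e 1) (e 0) \<in> \<tau>) else e 0 = \<zero>)"
    using assms unfolding strat_iff by (intro D_S D_intros D_Seq D_even F_lh F_pair) auto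
  ultimately have "S (\<lambda>e. e 0 = h (e 1))" by (simp only:)
  then have "F (\<lambda>e. h (e 0))" unfolding F_def by simp
  then obtain x where x: "infinite_seq M x" "\<forall>n. nth x n = h (pre x n)" using ex_generated by blast
  have "is_play M \<sigma> \<tau> x" unfolding is_play_iff using x h Seq_pre[OF x(1)] lh_pre[OF x(1)] by metis
  then show ?thesis by blast
qed

context
  fixes T assumes T: "binary_choice_tree M T"
begin

lemma tree_sets: "T \<in> sets M" using T unfolding binary_choice_tree_def by blast
lemma tree_Seq: "s \<in> T \<Longrightarrow> Seq s" using T unfolding binary_choice_tree_def Seq_def by blast
lemma tree_closed: "s \<in> T \<Longrightarrow> seq_len M s l \<Longrightarrow> n \<prec> l \<Longrightarrow> seg_in M (members M s) n T"
  using T unfolding binary_choice_tree_def by blast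
lemma tree_eps: "eps \<in> T"
proof -
  obtain s l where s: "s \<in> T" "seq_len M s l" using T unfolding binary_choice_tree_def by blast
  show ?thesis
  proof (cases "l = \<zero>")
    case True then show ?thesis using s seq_len_zero by simp
  next
    case False
    then have "seg_in M (members M s) \<zero> T" using tree_closed[OF s] pos_iff by blast
    then show ?thesis unfolding seg_in_def seg_def seq_len_zero by blast
  qed
qed
lemma tree_pre: "infinite_seq M x \<Longrightarrow> pre x n \<in> T \<Longrightarrow> m \<preceq> n \<Longrightarrow> pre x m \<in> T"
  using tree_closed[OF _ seq_len_pre] seg_in_of_pre le_def by metis
lemma tree_binary: "s \<in> T \<Longrightarrow> app s a \<in> T \<Longrightarrow> app s b \<in> T \<Longrightarrow> app s c \<in> T \<Longrightarrow> a = b \<or> a = c \<or> b = c"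
  using T tree_Seq snoc_iff unfolding binary_choice_tree_def by blast

end

lemma F_If: assumes "D P" "F s" "F t" shows "F (\<lambda>e. if P e then s e else t e)"
proof -
  have P: "D (\<lambda>e. P (\<lambda>i. e (Suc i)))" using D_rename[OF assms(1), of Suc] by simp
  have "S (\<lambda>e. P (\<lambda>i. e (Suc i)) \<and> e 0 = s (\<lambda>i. e (Suc i)) \<or> \<not> P (\<lambda>i. e (Suc i)) \<and> e 0 = t (\<lambda>i. e (Suc i)))"
    by (intro S_disj S_conj D_S[OF P] D_S[OF D_not[OF P]] assms(2,3)[unfolded F_def])
  moreover have "(P (\<lambda>i. e (Suc i)) \<and> e 0 = s (\<lambda>i. e (Suc i)) \<or> \<not> P (\<lambda>i. e (Suc i)) \<and> e 0 = t (\<lambda>i. e (Suc i))) =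
    (e 0 = (if P (\<lambda>i. e (Suc i)) then s (\<lambda>i. e (Suc i)) else t (\<lambda>i. e (Suc i))))" for e by simp
  ultimately show ?thesis unfolding F_def by simp
qed

subsection \<open>Closure under the jump\<close>

definition jump_closed :: bool where
  "jump_closed \<longleftrightarrow> (\<forall>A\<in>sets M. {i. \<exists>m. pair M i m \<in> A} \<in> sets M)"

lemma ACA0_jump_closed: assumes "ACA0 M" shows jump_closed
  unfolding jump_closed_def
proof
  fix A assume A: "A \<in> sets M"
  let ?s = "Plus (Var 0) (Var 1)"
  \<comment> \<open>\<open>pair\<close> written out as a term, with the candidate in variable
    \<open>0\<close> and the witness in variable \<open>1\<close>.\<close>
  let ?p = "ExN 1 (Mem (Plus (Times ?s ?s) (Var 0)) 0)"
  have "\<forall>p x e E. arithmetical p \<longrightarrow> set_assignment M E \<longrightarrow> {n. sat M (e(x := n)) E p} \<in> sets M"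
    using assms unfolding ACA0_def arithmetical_comprehension_def by blast
  from this[rule_format, of ?p "\<lambda>_. A" undefined 0]
  show "{i. \<exists>m. pair M i m \<in> A} \<in> sets M" using A by (simp add: set_assignment_const pair_def)
qed

subsection \<open>Leaving a tree\<close>

text \<open>Here \<open>n\<close> is the index of the move that leaves \<open>T\<close>, so its
  parity tells who left; the position outside \<open>T\<close> has length one more.\<close>

definition exits :: "'a set \<Rightarrow> 'a set \<Rightarrow> 'a \<Rightarrow> bool" where
  "exits T x n \<longleftrightarrow> pre x n \<in> T \<and> pre x (n \<oplus> \<one>) \<notin> T"

lemma mu_I_iff: "infinite_seq M x \<Longrightarrow> mu_I M T x \<longleftrightarrow> (\<exists>n. is_even M n \<and> exits T x n)"
  unfolding mu_I_def seg_in_iff is_even_def exits_def by auto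

lemma mu_II_iff: "infinite_seq M x \<Longrightarrow> mu_II M T x \<longleftrightarrow> (\<exists>n. \<not> is_even M n \<and> exits T x n)"
  unfolding mu_II_def seg_in_iff odd_iff[symmetric] is_odd_def exits_def by auto

context
  fixes T x assumes T: "binary_choice_tree M T" and x: "infinite_seq M x"
begin

lemma exits_unique: assumes "exits T x n" "exits T x m" shows "n = m"
proof -
  have "\<not> n \<prec> m" if "exits T x n" "exits T x m" for n m
    using that tree_pre[OF T x, of m "n \<oplus> \<one>"] unfolding exits_def lt_succ_le by blast
  then show ?thesis using assms lt_linear by blast
qed

lemma ex_first_outside:
  assumes "pre x n \<notin> T" shows "\<exists>m. exits T x m \<and> m \<oplus> \<one> \<preceq> n"
proof -
  have "D (\<lambda>e. pre x (e 0) \<notin> T)" by (intro D_intros F_pre x tree_sets[OF T])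
  from D_least[of "\<lambda>n. pre x n \<notin> T", OF this assms]
  obtain k where k: "k \<preceq> n" "pre x k \<notin> T" "\<forall>m. m \<prec> k \<longrightarrow> pre x m \<in> T" by blast
  then have "k \<noteq> \<zero>" using pre_zero[OF x] tree_eps[OF T] by metis
  then obtain m where m: "k = m \<oplus> \<one>" using zero_or_suc by blast
  then have "exits T x m" unfolding exits_def using k lt_suc by blast
  then show ?thesis using k m by blast
qed

lemma exits_iff: "exits T x n \<longleftrightarrow> pre x (n \<oplus> \<one>) \<notin> T \<and> (\<forall>j. j \<prec> n \<oplus> \<one> \<longrightarrow> pre x j \<in> T)"
  unfolding exits_def lt_suc using tree_pre[OF T x, of n] le_def by blast

text \<open>\<open>Q\<close> is the parity test that \<open>W_I\<close> or \<open>W_II\<close>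
  applies to the length of the first position outside \<open>T\<close>. That length exceeds the
  index of the offending move by one, hence the shift.\<close>

lemma winning_position:
  "(\<exists>n u. seg M x n u \<and> (\<exists>l n. seq_len M u l \<and> n \<prec> l \<and> \<not> seg_in M (members M u) n T \<and>
     (\<forall>j. j \<prec> n \<longrightarrow> seg_in M (members M u) j T) \<and> Q n)) \<longleftrightarrow> (\<exists>n. Q (n \<oplus> \<one>) \<and> exits T x n)"
  (is "?L \<longleftrightarrow> ?R")
proof
  assume ?L
  then obtain k l n where *: "seq_len M (pre x k) l" "n \<prec> l" "\<not> seg_in M (members M (pre x k)) n T"
    "\<forall>j. j \<prec> n \<longrightarrow> seg_in M (members M (pre x k)) j T" "Q n" unfolding seg_pre_iff[OF x] by blast
  have l: "l = k" using *(1) seq_len_pre[OF x] seq_len_unique by blast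
  have in_iff: "seg_in M (members M (pre x k)) j T \<longleftrightarrow> pre x j \<in> T" if "j \<preceq> n" for j
    using seg_in_of_pre[OF x, of j k T] that *(2) l le_def ar.order.trans by metis
  have n: "pre x n \<notin> T" "\<forall>j. j \<prec> n \<longrightarrow> pre x j \<in> T" using * in_iff le_def by blast+
  then have "n \<noteq> \<zero>" using pre_zero[OF x] tree_eps[OF T] by metis
  then obtain m where m: "n = m \<oplus> \<one>" using zero_or_suc by blast
  then have "exits T x m" using n exits_iff by blast
  then show ?R using *(5) m by blast
next
  assume ?R
  then obtain n where n: "Q (n \<oplus> \<one>)" "exits T x n" by blast
  \<comment> \<open>The position \<open>u\<close> has to be strictly longer than its initial segment
    outside \<open>T\<close>, which already has length \<open>n + 1\<close>.\<close>
  let ?k = "n \<oplus> \<one> \<oplus> \<one>"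
  have "seg_in M (members M (pre x ?k)) j T \<longleftrightarrow> pre x j \<in> T" if "j \<prec> ?k" for j
    using seg_in_of_pre[OF x, of j ?k T] that le_def by blast
  moreover have "n \<oplus> \<one> \<prec> ?k" using lt_suc by blast
  ultimately have "\<not> seg_in M (members M (pre x ?k)) (n \<oplus> \<one>) T \<and>
    (\<forall>j. j \<prec> n \<oplus> \<one> \<longrightarrow> seg_in M (members M (pre x ?k)) j T)"
    using n(2) lt_trans unfolding exits_iff by blast
  then show ?L
    using seg_pre[OF x] seq_len_pre[OF x] n(1) \<open>n \<oplus> \<one> \<prec> ?k\<close> by blast
qed

lemma W_I_iff: "(\<exists>n u. seg M x n u \<and> W_I M T u) \<longleftrightarrow> (\<exists>n. \<not> is_even M n \<and> exits T x n)"
  unfolding W_I_def winning_position even_suc odd_iff ..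

lemma W_II_iff: "(\<exists>n u. seg M x n u \<and> W_II M T u) \<longleftrightarrow> (\<exists>n. is_even M n \<and> exits T x n)"
  unfolding W_II_def winning_position odd_suc ..

end

lemma play_moves:
  assumes "is_play M \<sigma> \<tau> x" "(if pl then \<sigma> else \<tau>) = strat_of pl h" "is_even M n = pl"
  shows "nth x n = h (pre x n)"
proof -
  have x: "infinite_seq M x" "pair M (pre x n) (nth x n) \<in> (if is_even M n then \<sigma> else \<tau>)"
    using assms(1) is_play_iff by blast+
  then have "pair M (pre x n) (nth x n) \<in> strat_of pl h" using assms(2,3) by simp
  then show ?thesis using strat_of_mem[of "pre x n" pl "nth x n" h] Seq_pre[OF x(1)] lh_pre[OF x(1)] assms(3) by simp
qed

section \<open>Wellfounded games as instances of the other determinacy principles\<close>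

lemma determined_cong:
  assumes "\<And>x. infinite_seq M x \<Longrightarrow> A x \<longleftrightarrow> A' x" "\<And>x. infinite_seq M x \<Longrightarrow> C x \<longleftrightarrow> C' x"
  shows "determined M A C \<longleftrightarrow> determined M A' C'"
proof -
  have "is_play M \<sigma> \<tau> x \<and> A x \<longleftrightarrow> is_play M \<sigma> \<tau> x \<and> A' x" "is_play M \<sigma> \<tau> x \<and> C x \<longleftrightarrow> is_play M \<sigma> \<tau> x \<and> C' x"
    for \<sigma> \<tau> x using assms is_play_iff by blast+
  then show ?thesis unfolding determined_def by simp
qed

lemma determined_iff: "determined M A C \<longleftrightarrow>
  (\<exists>\<sigma>. strat True \<sigma> \<and> (\<forall>\<tau>. strat False \<tau> \<longrightarrow> (\<exists>x. is_play M \<sigma> \<tau> x \<and> A x))) \<or>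
  (\<exists>\<tau>. strat False \<tau> \<and> (\<forall>\<sigma>. strat True \<sigma> \<longrightarrow> (\<exists>x. is_play M \<sigma> \<tau> x \<and> C x)))"
  unfolding determined_def strat_def by simp

text \<open>On a wellfounded tree the payoff is decided by the player who leaves first.\<close>

lemma game_False_wellfounded:
  assumes T: "binary_choice_tree M T" "wellfounded_tree M T" and det: "game_determined M T (\<lambda>x. False)"
  shows "determined M (\<lambda>x. \<exists>n u. seg M x n u \<and> W_I M T u) (\<lambda>x. \<exists>n u. seg M x n u \<and> W_II M T u)"
proof -
  have ex: "\<exists>n. exits T x n" if x: "infinite_seq M x" for x
  proof -
    obtain n where "pre x n \<notin> T" using T(2) x seg_in_iff[OF x] unfolding wellfounded_tree_def by blast
    then show ?thesis using ex_first_outside[OF T(1) x] by blast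
  qed
  have "psi M T (\<lambda>x. False) x \<longleftrightarrow> (\<exists>n u. seg M x n u \<and> W_I M T u)"
    "\<not> psi M T (\<lambda>x. False) x \<longleftrightarrow> (\<exists>n u. seg M x n u \<and> W_II M T u)" if x: "infinite_seq M x" for x
    unfolding psi_def mu_I_iff[OF x] mu_II_iff[OF x] W_I_iff[OF T(1) x] W_II_iff[OF T(1) x]
    using ex[OF x] exits_unique[OF T(1) x] by metis+
  then show ?thesis using det unfolding game_determined_def
    using determined_cong[of "psi M T (\<lambda>x. False)" "\<lambda>x. \<exists>n u. seg M x n u \<and> W_I M T u"
      "\<lambda>x. \<not> psi M T (\<lambda>x. False) x" "\<lambda>x. \<exists>n u. seg M x n u \<and> W_II M T u"] by simp
qed

lemma ex_set_assignment: "\<exists>E. set_assignment M E"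
  using sets_nonempty set_assignment_const by blast

definition false_fml :: fml where "false_fml = Neg (Eq Zero Zero)"

lemma bounded_false: "bounded_fml false_fml"
  unfolding false_fml_def by (intro bounded_fml.intros)
lemma sat_false: "\<not> sat M e E false_fml" unfolding false_fml_def by simp

lemma delta01_wellfounded: assumes "delta01_det M" shows "wellfounded_det M"
  unfolding wellfounded_det_def
proof (intro allI impI)
  fix T assume T: "binary_choice_tree M T" "wellfounded_tree M T"
  obtain E where E: "set_assignment M E" using ex_set_assignment by blast
  have pq: "sigma01 (ExN 0 false_fml)" "pi01 (AllN 0 false_fml)"
    unfolding sigma01_def pi01_def using bounded_false by blast+
  have "game_determined M T (\<lambda>x. sat M undefined (E(0 := x)) (ExN 0 false_fml))"
    by (rule assms[unfolded delta01_det_def, rule_format, OF T(1) E pq]) (simp add: sat_false)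
  then show "determined M (\<lambda>x. \<exists>n u. seg M x n u \<and> W_I M T u) (\<lambda>x. \<exists>n u. seg M x n u \<and> W_II M T u)"
    by (intro game_False_wellfounded[OF T]) (simp add: sat_false)
qed

text \<open>Removing any class of level \<open>k\<close> from an empty Sigma01 class gives an
  unsatisfiable formula of the next level.\<close>

lemma ex_diff_sigma01: assumes "k \<ge> 1" shows "\<exists>p. diff_sigma01 k p \<and> (\<forall>e E. \<not> sat M e E p)"
proof -
  have p: "sigma01 (ExN 0 false_fml)" unfolding sigma01_def using bounded_false by blast
  from assms show ?thesis
  proof (induct k rule: dec_induct)
    case base then show ?case using diff_sigma01.intros(1)[OF p] sat_false by auto
  next
    case (step k)
    then obtain q where "diff_sigma01 k q" by blast
    from diff_sigma01.intros(2)[OF p this] show ?case using sat_false by auto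
  qed
qed

lemma diff_sigma01_wellfounded: assumes "k \<ge> 1" "diff_sigma01_det M k" shows "wellfounded_det M"
  unfolding wellfounded_det_def
proof (intro allI impI)
  fix T assume T: "binary_choice_tree M T" "wellfounded_tree M T"
  obtain E where E: "set_assignment M E" using ex_set_assignment by blast
  obtain p where p: "diff_sigma01 k p" "\<forall>e E. \<not> sat M e E p" using ex_diff_sigma01[OF assms(1)] by blast
  have "game_determined M T (\<lambda>x. sat M undefined (E(0 := x)) p)"
    by (rule assms(2)[unfolded diff_sigma01_det_def, rule_format, OF T(1) E p(1)])
  then show "determined M (\<lambda>x. \<exists>n u. seg M x n u \<and> W_I M T u) (\<lambda>x. \<exists>n u. seg M x n u \<and> W_II M T u)"
    by (intro game_False_wellfounded[OF T]) (simp add: p(2))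
qed

subsection \<open>The reversal\<close>

text \<open>Padding by zeros. Facts about finite positions can then be proved for
  \<open>pre x l\<close>, whose entries are values of \<open>nth x\<close>.\<close>

lemma ex_infinite_extension: assumes "Seq s" shows "\<exists>x. infinite_seq M x \<and> s = pre x (lh s)"
proof -
  have s: "seq_len M s (lh s)" using seq_len_lh assms by blast
  define x where "x = {p. p \<in> members M s \<or> (\<exists>i. i \<preceq> p \<and> lh s \<preceq> i \<and> p = pair M i \<zero>)}"
  have "D (\<lambda>e. e 0 \<in> x)" unfolding x_def mem_Collect_eq by (intro D_intros D_members F_pair)
  then have "x \<in> sets M" using D_set[of "\<lambda>p. p \<in> x"] by simp
  have px: "pair M i j \<in> x \<longleftrightarrow> (if i \<prec> lh s then pair M i j \<in> members M s else j = \<zero>)" for i j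
    unfolding x_def using seq_pos[OF s, of i j] le_lt[of "lh s" i] pair_inj le_pair1 by auto
  have "\<exists>!j. pair M i j \<in> x" for i unfolding px using seq_entry[OF s, of i] by (cases "i \<prec> lh s") simp_all
  moreover have "\<forall>p\<in>x. \<exists>i j. p = pair M i j" unfolding x_def using members_pair[OF assms] by blast
  ultimately have x: "infinite_seq M x" unfolding infinite_seq_def using \<open>x \<in> sets M\<close> by blast
  have "seg M x (lh s) s" unfolding seg_def using s px seq_pos[OF s] by auto
  then show ?thesis using x seg_pre_iff[OF x] by blast
qed

lemma double_less: "n \<oplus> n \<prec> m \<oplus> m \<longleftrightarrow> n \<prec> m"
proof -
  have mono: "n \<oplus> n \<prec> m \<oplus> m" if "n \<prec> m" for n m using ar.add_strict_mono that by blast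
  then show ?thesis using lt_linear[of n m] lt_irrefl lt_trans by metis
qed

lemma double_inj: "n \<oplus> n = m \<oplus> m \<longleftrightarrow> n = m"
  using double_less lt_linear lt_irrefl by metis

lemma double_neq: "n \<oplus> n \<noteq> m \<oplus> m \<oplus> \<one>"
  using odd_iff unfolding is_odd_def is_even_def by metis

lemma even_or_odd: obtains n where "l = n \<oplus> n" | n where "l = n \<oplus> n \<oplus> \<one>"
  using odd_iff[of l] unfolding is_odd_def is_even_def by blast

context
  fixes A :: "'a set"
  assumes A: "A \<in> sets M"
begin

text \<open>Insisting on the least witness leaves at most one positive answer for each number, as a
  binary tree demands.\<close>

definition first :: "'a \<Rightarrow> 'a \<Rightarrow> bool" where
  "first m i \<longleftrightarrow> pair M i m \<in> A \<and> (\<forall>k. k \<prec> m \<longrightarrow> pair M i k \<notin> A)"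

lemma D_first: "F s \<Longrightarrow> F t \<Longrightarrow> D (\<lambda>e. first (s e) (t e))"
  by (rule D_subst2[where P=first]) (unfold first_def, intro D_intros A F_pair)

lemma first_unique: "first m i \<Longrightarrow> first m' i \<Longrightarrow> m = m'"
  unfolding first_def using lt_linear by blast

lemma ex_first: assumes "pair M i k \<in> A" shows "\<exists>m. first m i"
proof -
  have "D (\<lambda>e. pair M i (e 0) \<in> A)" by (intro D_intros A F_pair)
  from D_least[of "\<lambda>k. pair M i k \<in> A", OF this assms] show ?thesis unfolding first_def by blast
qed

text \<open>Player I answers in round \<open>n\<close> whether \<open>n\<close> is in the projection of \<open>A\<close>: the answer \<open>0\<close>
  means no, and \<open>m + 1\<close> is a yes with the first witness \<open>m\<close>. Player II accepts by \<open>0\<close>, which is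
  legal only if no answer is refuted by a witness up to \<open>n\<close>, or challenges the answer \<open>0\<close> by a
  witness, after which I has no legal move.\<close>

definition answer :: "'a \<Rightarrow> 'a \<Rightarrow> bool" where
  "answer n j \<longleftrightarrow> j = \<zero> \<or> (\<exists>m. m \<prec> j \<and> j = m \<oplus> \<one> \<and> first m n)"

definition accept :: "'a \<Rightarrow> 'a \<Rightarrow> bool" where
  "accept s n \<longleftrightarrow> pair M (n \<oplus> n \<oplus> \<one>) \<zero> \<in> members M s \<and>
    (\<forall>m. m \<preceq> n \<longrightarrow> (\<forall>q. q \<preceq> n \<longrightarrow> first m q \<longrightarrow> pair M (q \<oplus> q) (m \<oplus> \<one>) \<in> members M s))"

definition challenge :: "'a \<Rightarrow> 'a \<Rightarrow> bool" where
  "challenge s n \<longleftrightarrow> lh s = n \<oplus> n \<oplus> \<one> \<oplus> \<one> \<and> pair M (n \<oplus> n) \<zero> \<in> members M s \<and>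
    (\<exists>m. m \<preceq> s \<and> pair M (n \<oplus> n \<oplus> \<one>) (m \<oplus> \<one>) \<in> members M s \<and> first m n)"

text \<open>Bounds by the code \<open>s\<close> keep the conditions Delta01 in \<open>A\<close>, so
  that the tree exists in the model; \<open>pre_Tr\<close> removes them again.\<close>

definition Tr :: "'a set" where
  "Tr = {s. Seq s \<and>
    (\<forall>n. n \<preceq> s \<longrightarrow> n \<oplus> n \<prec> lh s \<longrightarrow> (\<exists>j. j \<preceq> s \<and> pair M (n \<oplus> n) j \<in> members M s \<and> answer n j)) \<and>
    (\<forall>n. n \<preceq> s \<longrightarrow> n \<oplus> n \<oplus> \<one> \<prec> lh s \<longrightarrow> accept s n \<or> challenge s n)}"

lemma D_answer: "F s \<Longrightarrow> F t \<Longrightarrow> D (\<lambda>e. answer (s e) (t e))"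
  by (rule D_subst2[where P=answer]) (unfold answer_def, intro D_intros D_first)

lemma Tr_sets: "Tr \<in> sets M"
proof -
  have "D (\<lambda>e. e 0 \<in> Tr)"
    unfolding Tr_def mem_Collect_eq accept_def challenge_def
    by (intro D_intros D_Seq D_members D_answer D_first F_lh F_pair)
  from D_set[of "\<lambda>s. s \<in> Tr", OF this] show ?thesis by simp
qed

lemma answer_unique: assumes "answer n a" "answer n b" "answer n c" shows "a = b \<or> a = c \<or> b = c"
  using assms first_unique unfolding answer_def by metis

definition legal_II :: "'a set \<Rightarrow> 'a \<Rightarrow> bool" where
  "legal_II x n \<longleftrightarrow> nth x (n \<oplus> n \<oplus> \<one>) = \<zero> \<and>
    (\<forall>m. m \<preceq> n \<longrightarrow> (\<forall>q. q \<preceq> n \<longrightarrow> first m q \<longrightarrow> nth x (q \<oplus> q) = m \<oplus> \<one>))"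

definition challenge_II :: "'a set \<Rightarrow> 'a \<Rightarrow> bool" where
  "challenge_II x n \<longleftrightarrow> nth x (n \<oplus> n) = \<zero> \<and> (\<exists>m. nth x (n \<oplus> n \<oplus> \<one>) = m \<oplus> \<one> \<and> first m n)"

lemma pre_Tr:
  assumes x: "infinite_seq M x"
  shows "pre x l \<in> Tr \<longleftrightarrow> (\<forall>n. n \<oplus> n \<prec> l \<longrightarrow> answer n (nth x (n \<oplus> n))) \<and>
    (\<forall>n. n \<oplus> n \<oplus> \<one> \<prec> l \<longrightarrow> legal_II x n \<or> (l = n \<oplus> n \<oplus> \<one> \<oplus> \<one> \<and> challenge_II x n))"
proof -
  have bound: "n \<preceq> pre x l" "n \<oplus> n \<prec> l" if "n \<oplus> n \<prec> l \<or> n \<oplus> n \<oplus> \<one> \<prec> l" for n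
  proof -
    show l: "n \<oplus> n \<prec> l" using that lt_suc lt_trans by metis
    then show "n \<preceq> pre x l"
      using n_le_pre[OF x, of l] le_add1[of n n] le_def ar.order.trans by metis
  qed
  have entry: "(\<exists>j. j \<preceq> pre x l \<and> pair M i j \<in> members M (pre x l) \<and> R j) \<longleftrightarrow> R (nth x i)" if "i \<prec> l" for i R
  proof -
    have "pair M i (nth x i) \<in> members M (pre x l)" using that pre_entry[OF x] by blast
    then have "nth x i \<preceq> pre x l"
      using members_less le_pair2 le_def ar.order.trans by metis
    then show ?thesis unfolding pre_entry[OF x] using that by auto
  qed
  have accept: "accept (pre x l) n \<longleftrightarrow> legal_II x n" if n: "n \<oplus> n \<oplus> \<one> \<prec> l" for n
  proof -
    have "q \<oplus> q \<prec> l" if "q \<preceq> n" for q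
      using that n bound(2)[of n] double_less[of q n] lt_trans le_def by metis
    then show ?thesis unfolding accept_def legal_II_def pre_entry[OF x] using n by metis
  qed
  have challenge: "challenge (pre x l) n \<longleftrightarrow> l = n \<oplus> n \<oplus> \<one> \<oplus> \<one> \<and> challenge_II x n"
    if n: "n \<oplus> n \<oplus> \<one> \<prec> l" for n
  proof -
    have "m \<preceq> pre x l" if "nth x (n \<oplus> n \<oplus> \<one>) = m \<oplus> \<one>" for m
    proof -
      have "pair M (n \<oplus> n \<oplus> \<one>) (m \<oplus> \<one>) \<in> members M (pre x l)" using that n pre_entry[OF x] by simp
      then show ?thesis using members_less le_pair2[of "m \<oplus> \<one>"] le_add1[of m \<one>] le_def ar.order.trans by metis
    qed
    then show ?thesis
      unfolding challenge_def challenge_II_def pre_entry[OF x] lh_pre[OF x] using n bound(2)[of n] by metis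
  qed
  show ?thesis unfolding Tr_def mem_Collect_eq lh_pre[OF x] using Seq_pre[OF x] bound entry accept challenge by blast
qed

text \<open>A challenge is tolerated only as the last move, so in a proper initial segment all moves
  of II are acceptances.\<close>

lemma Tr_pre: assumes "infinite_seq M x" "pre x l \<in> Tr" "k \<prec> l" shows "pre x k \<in> Tr"
proof -
  have "l \<noteq> n \<oplus> n \<oplus> \<one> \<oplus> \<one>" if "n \<oplus> n \<oplus> \<one> \<prec> k" for n
    using that assms(3) lt_suc[of k] lt_trans[of _ k] lt_irrefl by metis
  then show ?thesis using assms(2,3) lt_trans unfolding pre_Tr[OF assms(1)] by blast
qed

text \<open>A challenge has the same shape as a positive answer: in round \<open>n\<close> either
  player moves \<open>0\<close> or \<open>m + 1\<close> with \<open>m\<close> the least witness for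
  \<open>n\<close>. Binary branching for both players follows from
  \<open>answer_unique\<close>.\<close>

lemma Tr_answer:
  assumes x: "infinite_seq M x" and "pre x (l \<oplus> \<one>) \<in> Tr" "l = n \<oplus> n \<or> l = n \<oplus> n \<oplus> \<one>"
  shows "answer n (nth x l)"
  using assms(3)
proof
  assume "l = n \<oplus> n" then show ?thesis using assms(2) lt_suc unfolding pre_Tr[OF x] by blast
next
  assume l: "l = n \<oplus> n \<oplus> \<one>"
  then have "legal_II x n \<or> challenge_II x n" using assms(2) lt_suc unfolding pre_Tr[OF x] by blast
  then show ?thesis unfolding legal_II_def challenge_II_def answer_def l using lt_suc by auto
qed

lemma Tr_tree: "binary_choice_tree M Tr"
  unfolding binary_choice_tree_def
proof (intro conjI Tr_sets ballI allI impI)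
  have "eps \<in> Tr" unfolding Tr_def using not_lt0 by simp
  then show "Tr \<noteq> {}" by blast
next
  fix s assume "s \<in> Tr" then show "\<exists>l. seq_len M s l" unfolding Tr_def Seq_def by blast
next
  fix s l n assume s: "s \<in> Tr" "seq_len M s l" "n \<prec> l"
  obtain x where x: "infinite_seq M x" "s = pre x l"
    using ex_infinite_extension[OF SeqI[OF s(2)]] lh_eq[OF s(2)] by blast
  show "seg_in M (members M s) n Tr"
    using Tr_pre[OF x(1) _ s(3)] s x seg_in_of_pre[OF x(1)] le_def by metis
next
  fix s a b c
  assume "s \<in> Tr" "\<exists>t\<in>Tr. snoc M s a t" "\<exists>t\<in>Tr. snoc M s b t" "\<exists>t\<in>Tr. snoc M s c t"
  then have s: "Seq s" "app s a \<in> Tr" "app s b \<in> Tr" "app s c \<in> Tr" by (auto simp: snoc_iff)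
  obtain n where n: "lh s = n \<oplus> n \<or> lh s = n \<oplus> n \<oplus> \<one>" using even_or_odd[of "lh s"] by blast
  have "answer n a" if a: "app s a \<in> Tr" for a
  proof -
    obtain x where x: "infinite_seq M x" "app s a = pre x (lh s \<oplus> \<one>)"
      using ex_infinite_extension[OF Seq_app[OF s(1)], of a] lh_app[OF s(1)] by metis
    then have "a = nth x (lh s)" using app_inj[OF s(1) Seq_pre[OF x(1)]] pre_Suc[OF x(1)] by metis
    then show ?thesis using Tr_answer[OF x(1) _ n] a x(2) by simp
  qed
  then show "a = b \<or> a = c \<or> b = c" using answer_unique s by blast
qed

text \<open>By \<open>z\<close> the preceding move was not a challenge, after which every
  continuation is illegal.\<close>

lemma Tr_I:
  assumes x: "infinite_seq M x" and n: "pre x (n \<oplus> n) \<in> Tr"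
    and a: "answer n (nth x (n \<oplus> n))"
    and z: "\<And>k. n \<oplus> n = k \<oplus> k \<oplus> \<one> \<oplus> \<one> \<Longrightarrow> \<not> challenge_II x k"
  shows "pre x (n \<oplus> n \<oplus> \<one>) \<in> Tr"
  unfolding pre_Tr[OF x]
proof (intro conjI allI impI)
  fix k assume "k \<oplus> k \<prec> n \<oplus> n \<oplus> \<one>"
  then show "answer k (nth x (k \<oplus> k))" using n a lt_suc double_inj unfolding pre_Tr[OF x] by metis
next
  fix k assume "k \<oplus> k \<oplus> \<one> \<prec> n \<oplus> n \<oplus> \<one>"
  then have "k \<oplus> k \<oplus> \<one> \<prec> n \<oplus> n" using lt_suc double_neq by metis
  then show "legal_II x k \<or> n \<oplus> n \<oplus> \<one> = k \<oplus> k \<oplus> \<one> \<oplus> \<one> \<and> challenge_II x k"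
    using n z unfolding pre_Tr[OF x] by blast
qed

lemma Tr_II:
  assumes x: "infinite_seq M x" and n: "pre x (n \<oplus> n \<oplus> \<one>) \<in> Tr" and b: "legal_II x n \<or> challenge_II x n"
  shows "pre x (n \<oplus> n \<oplus> \<one> \<oplus> \<one>) \<in> Tr"
  unfolding pre_Tr[OF x]
proof (intro conjI allI impI)
  fix k assume "k \<oplus> k \<prec> n \<oplus> n \<oplus> \<one> \<oplus> \<one>"
  then have "k \<oplus> k \<prec> n \<oplus> n \<oplus> \<one>" using lt_suc double_neq by metis
  then show "answer k (nth x (k \<oplus> k))" using n unfolding pre_Tr[OF x] by blast
next
  fix k assume k: "k \<oplus> k \<oplus> \<one> \<prec> n \<oplus> n \<oplus> \<one> \<oplus> \<one>"
  show "legal_II x k \<or> n \<oplus> n \<oplus> \<one> \<oplus> \<one> = k \<oplus> k \<oplus> \<one> \<oplus> \<one> \<and> challenge_II x k"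
  proof (cases "k = n")
    case True then show ?thesis using b by blast
  next
    case False
    then have "k \<oplus> k \<oplus> \<one> \<prec> n \<oplus> n \<oplus> \<one>" using k lt_suc double_inj suc_inj by metis
    moreover have "n \<oplus> n \<oplus> \<one> \<noteq> k \<oplus> k \<oplus> \<one> \<oplus> \<one>" using suc_inj double_neq by metis
    ultimately show ?thesis using n unfolding pre_Tr[OF x] by blast
  qed
qed

text \<open>Beyond the end of round \<open>n\<close> the exemption for a challenge no longer
  applies.\<close>

lemma Tr_legal: assumes x: "infinite_seq M x" and "pre x (n \<oplus> n \<oplus> \<one> \<oplus> \<one> \<oplus> \<one>) \<in> Tr" shows "legal_II x n"
proof -
  have "n \<oplus> n \<oplus> \<one> \<prec> n \<oplus> n \<oplus> \<one> \<oplus> \<one> \<oplus> \<one>" unfolding lt_suc by blast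
  moreover have "n \<oplus> n \<oplus> \<one> \<oplus> \<one> \<oplus> \<one> \<noteq> n \<oplus> n \<oplus> \<one> \<oplus> \<one>" using lt_suc lt_irrefl by metis
  ultimately show ?thesis using assms(2) unfolding pre_Tr[OF x] by blast
qed

lemma Tr_wellfounded:
  assumes "{i. \<exists>m. pair M i m \<in> A} \<notin> sets M" shows "wellfounded_tree M Tr"
  unfolding wellfounded_tree_def
proof
  assume "\<exists>x. infinite_seq M x \<and> (\<forall>n. seg_in M x n Tr)"
  then obtain x where x: "infinite_seq M x" and all: "\<And>n. pre x n \<in> Tr" using seg_in_iff by blast
  have "(\<exists>m. pair M i m \<in> A) \<longleftrightarrow> nth x (i \<oplus> i) \<noteq> \<zero>" for i
  proof
    assume "\<exists>m. pair M i m \<in> A"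
    then obtain m where m: "first m i" using ex_first by blast
    \<comment> \<open>Round \<open>m + i\<close> checks all numbers and witnesses up to
      \<open>m + i\<close>, in particular \<open>i\<close> and \<open>m\<close>.\<close>
    have "legal_II x (m \<oplus> i)" using Tr_legal[OF x] all by blast
    then have "nth x (i \<oplus> i) = m \<oplus> \<one>" unfolding legal_II_def using m le_add1 le_add2 by blast
    then show "nth x (i \<oplus> i) \<noteq> \<zero>" using suc_neq by simp
  next
    assume "nth x (i \<oplus> i) \<noteq> \<zero>"
    moreover have "answer i (nth x (i \<oplus> i))" using Tr_answer[OF x all] by blast
    ultimately show "\<exists>m. pair M i m \<in> A" unfolding answer_def first_def by blast
  qed
  moreover have "{i. nth x (i \<oplus> i) \<noteq> \<zero>} \<in> sets M" by (rule D_set) (intro D_intros F_nth x)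
  ultimately show False using assms by simp
qed

lemma play_I_unique:
  assumes "strat True \<sigma>" "is_play M \<sigma> \<tau> x" "is_play M \<sigma> \<tau>' x'" "is_even M n" "pre x n = pre x' n"
  shows "nth x n = nth x' n"
proof -
  have "pair M (pre x n) (nth x n) \<in> \<sigma>" "pair M (pre x' n) (nth x' n) \<in> \<sigma>"
    using assms(2-4) unfolding is_play_iff by metis+
  moreover have "Seq (pre x n)" "is_even M (lh (pre x n))"
    using assms(2,4) Seq_pre lh_pre unfolding is_play_iff by auto
  ultimately show ?thesis using assms(1,5) unfolding strat_iff by metis
qed

text \<open>A strategy of I that wins against a permanently accepting II gives a wrong answer at some point;
  challenging that answer defeats it.\<close>

lemma I_not_winning:
  assumes \<sigma>: "strat True \<sigma>" "\<And>\<tau>. strat False \<tau> \<Longrightarrow> \<exists>x. is_play M \<sigma> \<tau> x \<and> (\<exists>n. \<not> is_even M n \<and> exits Tr x n)"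
  shows False
proof -
  have "strat False (strat_of False (\<lambda>_. \<zero>))" by (intro strat_of F_intros)
  then obtain x l where x: "is_play M \<sigma> (strat_of False (\<lambda>_. \<zero>)) x" and l: "\<not> is_even M l" "exits Tr x l"
    using \<sigma>(2) by blast
  have inf: "infinite_seq M x" using x is_play_iff by blast
  have mv: "nth x n = \<zero>" if "\<not> is_even M n" for n
    using play_moves[OF x, of False "\<lambda>_. \<zero>" n] that by simp
  obtain n where n: "l = n \<oplus> n \<oplus> \<one>" using l(1) even_or_odd[of l] is_even_def by metis
  \<comment> \<open>II left the tree with the move \<open>0\<close>, so some number was not answered
    by its least witness.\<close>
  have "\<not> legal_II x n" using Tr_II[OF inf, of n] l(2) unfolding exits_def n by blast
  then obtain m q where mq: "m \<preceq> n" "q \<preceq> n" "first m q" "nth x (q \<oplus> q) \<noteq> m \<oplus> \<one>"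
    using mv[OF l(1)] unfolding legal_II_def n by blast
  have "q \<oplus> q \<oplus> \<one> \<preceq> l" unfolding n using mq(2) double_less[of q n] double_inj lt_suc_mono le_def by metis
  then have inT: "pre x (q \<oplus> q \<oplus> \<one>) \<in> Tr" using l(2) tree_pre[OF Tr_tree inf] unfolding exits_def by blast
  \<comment> \<open>Answers inside the tree are \<open>0\<close> or the least witness plus one, so
    the wrong answer is a negative one and can be challenged.\<close>
  have zero: "nth x (q \<oplus> q) = \<zero>"
    using Tr_answer[OF inf inT] mq(3,4) first_unique unfolding answer_def by metis
  \<comment> \<open>A single deviation from permanent acceptance: the challenge in round
    \<open>q\<close>.\<close>
  define g where "g s = (if lh s = q \<oplus> q \<oplus> \<one> then m \<oplus> \<one> else \<zero>)" for s
  have "strat False (strat_of False g)" unfolding g_def by (intro strat_of F_If D_intros F_lh)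
  then obtain x' l' where x': "is_play M \<sigma> (strat_of False g) x'" and l': "\<not> is_even M l'" "exits Tr x' l'"
    using \<sigma>(2) by blast
  have inf': "infinite_seq M x'" using x' is_play_iff by blast
  have mv': "nth x' n = (if n = q \<oplus> q \<oplus> \<one> then m \<oplus> \<one> else \<zero>)" if "\<not> is_even M n" for n
    using play_moves[OF x', of False g n] that lh_pre[OF inf'] unfolding g_def by simp
  \<comment> \<open>I follows the same strategy in both plays, and the replies of II differ only at
    index \<open>q + q + 1\<close>; up to there the plays coincide.\<close>
  have same: "k \<preceq> q \<oplus> q \<oplus> \<one> \<longrightarrow> pre x k = pre x' k" for k
  proof (rule S_induction[where P="\<lambda>k. k \<preceq> q \<oplus> q \<oplus> \<one> \<longrightarrow> pre x k = pre x' k"])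
    show "S (\<lambda>e. e 0 \<preceq> q \<oplus> q \<oplus> \<one> \<longrightarrow> pre x (e 0) = pre x' (e 0))"
      by (intro D_S D_intros F_pre inf inf')
    show "\<zero> \<preceq> q \<oplus> q \<oplus> \<one> \<longrightarrow> pre x \<zero> = pre x' \<zero>" using pre_zero inf inf' by simp
    fix k assume IH: "k \<preceq> q \<oplus> q \<oplus> \<one> \<longrightarrow> pre x k = pre x' k"
    show "k \<oplus> \<one> \<preceq> q \<oplus> q \<oplus> \<one> \<longrightarrow> pre x (k \<oplus> \<one>) = pre x' (k \<oplus> \<one>)"
    proof
      assume "k \<oplus> \<one> \<preceq> q \<oplus> q \<oplus> \<one>"
      then have k: "k \<prec> q \<oplus> q \<oplus> \<one>" unfolding lt_succ_le .
      then have pk: "pre x k = pre x' k" using IH le_def by blast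
      moreover have "nth x k = nth x' k"
      proof (cases "is_even M k")
        case True then show ?thesis using play_I_unique[OF \<sigma>(1) x x' True pk] by blast
      next
        case False then show ?thesis using mv mv' k lt_irrefl by metis
      qed
      ultimately show "pre x (k \<oplus> \<one>) = pre x' (k \<oplus> \<one>)" using pre_Suc inf inf' by metis
    qed
  qed
  have "q \<oplus> q \<preceq> q \<oplus> q \<oplus> \<one>" by (rule le_add1)
  then have "nth x' (q \<oplus> q) = \<zero>"
    using zero play_I_unique[OF \<sigma>(1) x x', of "q \<oplus> q"] same is_even_def by metis
  moreover have odd: "\<not> is_even M (q \<oplus> q \<oplus> \<one>)" using double_neq unfolding is_even_def by metis
  ultimately have "challenge_II x' q" unfolding challenge_II_def using mv'[OF odd] mq(3) by metis
  moreover have "pre x' (q \<oplus> q \<oplus> \<one>) \<in> Tr" using inT same le_def by metis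
  ultimately have "pre x' (q \<oplus> q \<oplus> \<one> \<oplus> \<one>) \<in> Tr" using Tr_II[OF inf'] by blast
  moreover have "pre x' (q \<oplus> q \<oplus> \<one> \<oplus> \<one> \<oplus> \<one>) \<notin> Tr"
    using Tr_legal[OF inf', of q] mv'[OF odd] suc_neq unfolding legal_II_def by metis
  \<comment> \<open>An exit at an even index: I left first, against the choice of
    \<open>\<sigma>\<close>.\<close>
  ultimately have "exits Tr x' (q \<oplus> q \<oplus> \<one> \<oplus> \<one>)" unfolding exits_def by blast
  then have "l' = q \<oplus> q \<oplus> \<one> \<oplus> \<one>" using exits_unique[OF Tr_tree inf'] l' by blast
  then show False using l'(1) odd even_suc odd_iff by metis
qed

text \<open>A strategy of II never challenges an I who gives a positive answer exactly where the strategy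
  would challenge the negative one.\<close>

lemma II_not_winning:
  assumes \<tau>: "strat False \<tau>" "\<And>\<sigma>. strat True \<sigma> \<Longrightarrow> \<exists>x. is_play M \<sigma> \<tau> x \<and> (\<exists>n. is_even M n \<and> exits Tr x n)"
  shows False
proof -
  \<comment> \<open>The reply function of \<open>\<tau>\<close>; the default makes it total, so that
    it belongs to \<open>F\<close>.\<close>
  define rv where "rv t = (if Seq t \<and> \<not> is_even M (lh t) then THE y. pair M t y \<in> \<tau> else \<zero>)" for t
  have rv_iff: "pair M t y \<in> \<tau> \<longleftrightarrow> y = rv t" if "Seq t" "\<not> is_even M (lh t)" for t y
  proof -
    have ex1: "\<exists>!y. pair M t y \<in> \<tau>" using \<tau>(1) that unfolding strat_iff by auto
    have "pair M t (rv t) \<in> \<tau>" using theI'[OF ex1] that unfolding rv_def by simp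
    then show ?thesis using ex1 by blast
  qed
  have "y = rv t \<longleftrightarrow> (if Seq t \<and> \<not> is_even M (lh t) then pair M t y \<in> \<tau> else y = \<zero>)" for y t
    using rv_iff[of t y] by (cases "Seq t \<and> \<not> is_even M (lh t)") (auto simp: rv_def)
  moreover have \<tau>_sets: "\<tau> \<in> sets M" using \<tau>(1) unfolding strat_iff by blast
  have "S (\<lambda>e. if Seq (e 1) \<and> \<not> is_even M (lh (e 1)) then pair M (e 1) (e 0) \<in> \<tau> else e 0 = \<zero>)"
    by (intro D_S D_intros D_Seq D_even F_lh F_pair \<tau>_sets)
  ultimately have "S (\<lambda>e. e 0 = rv (e 1))" by (simp only:)
  then have F_rv: "F (\<lambda>e. rv (e 0))" unfolding F_def by simp
  \<comment> \<open>The reply that would refute the answer \<open>0\<close> is itself the correct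
    positive answer. So I copies it instead of searching for a witness, which keeps \<open>h\<close>
    in \<open>F\<close> without any jump.\<close>
  define h where "h s = (if \<exists>m. m \<prec> rv (app s \<zero>) \<and> rv (app s \<zero>) = m \<oplus> \<one> \<and> (\<exists>n. n \<preceq> s \<and> lh s = n \<oplus> n \<and> first m n)
    then rv (app s \<zero>) else \<zero>)" for s
  have "F (\<lambda>e. h (e 0))" unfolding h_def
    by (intro F_If D_intros D_first F_lh F_move[OF F_rv] F_app)
  then have "strat True (strat_of True h)" by (rule strat_of)
  then obtain x l where x: "is_play M (strat_of True h) \<tau> x" and l: "is_even M l" "exits Tr x l"
    using \<tau>(2) by blast
  have inf: "infinite_seq M x" using x is_play_iff by blast
  have mv: "nth x n = h (pre x n)" if "is_even M n" for n
    using play_moves[OF x, of True h n] that by simp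
  have mv': "nth x n = rv (pre x n)" if "\<not> is_even M n" for n
  proof -
    have "pair M (pre x n) (nth x n) \<in> \<tau>" using x that unfolding is_play_iff by metis
    then show ?thesis using rv_iff[OF Seq_pre[OF inf]] lh_pre[OF inf] that by simp
  qed
  obtain n where n: "l = n \<oplus> n" using l(1) unfolding is_even_def by blast
  have "answer n (nth x (n \<oplus> n))"
    using mv[of "n \<oplus> n"] l(1) lh_pre[OF inf] double_inj unfolding n answer_def h_def by (auto split: if_splits)
  moreover have "\<not> challenge_II x k" for k
  proof
    assume ch: "challenge_II x k"
    have ev: "is_even M (k \<oplus> k)" "\<not> is_even M (k \<oplus> k \<oplus> \<one>)" using double_neq unfolding is_even_def by metis+
    obtain m where m: "nth x (k \<oplus> k) = \<zero>" "nth x (k \<oplus> k \<oplus> \<one>) = m \<oplus> \<one>" "first m k"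
      using ch unfolding challenge_II_def by blast
    have rv: "rv (app (pre x (k \<oplus> k)) \<zero>) = m \<oplus> \<one>"
      using m(1,2) mv'[OF ev(2)] pre_Suc[OF inf, of "k \<oplus> k"] by simp
    have "k \<preceq> pre x (k \<oplus> k)" using n_le_pre[OF inf] le_add1 ar.order.trans by metis
    moreover have "m \<prec> m \<oplus> \<one>" using lt_suc by blast
    ultimately have "h (pre x (k \<oplus> k)) = m \<oplus> \<one>"
      unfolding h_def rv lh_pre[OF inf] using m(3) by auto
    then show False using m(1) mv[OF ev(1)] suc_neq by simp
  qed
  ultimately have "pre x (l \<oplus> \<one>) \<in> Tr" using Tr_I[OF inf, of n] l(2) unfolding n exits_def by blast
  then show False using l(2) unfolding exits_def by blast
qed

end

lemma wellfounded_jump: assumes det: "wellfounded_det M" shows jump_closed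
  unfolding jump_closed_def
proof (rule ballI, rule ccontr)
  fix A assume A: "A \<in> sets M" and "{i. \<exists>m. pair M i m \<in> A} \<notin> sets M"
  then have wf: "wellfounded_tree M (Tr A)" by (rule Tr_wellfounded)
  have "determined M (\<lambda>x. \<exists>n. \<not> is_even M n \<and> exits (Tr A) x n) (\<lambda>x. \<exists>n. is_even M n \<and> exits (Tr A) x n)"
    using det[unfolded wellfounded_det_def, rule_format, OF Tr_tree[OF A] wf]
      determined_cong[OF W_I_iff[OF Tr_tree[OF A]] W_II_iff[OF Tr_tree[OF A]]] by simp
  then show False unfolding determined_iff using I_not_winning[OF A] II_not_winning[OF A] by blast
qed

end

section \<open>Arithmetical comprehension from closure under the jump\<close>

locale aca0 = rca0 +
  assumes jump: jump_closed
begin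

text \<open>\<open>jump_closed\<close> handles predicates of a single number, so the finitely many
  relevant variables are packed into one by repeated pairing.\<close>

lemma S_D_finite:
  assumes "S P" "\<And>e e'. (\<forall>i<Suc N. e i = e' i) \<Longrightarrow> P e = P e'"
  shows "D P"
  using assms
proof (induct N arbitrary: P)
  case 0
  obtain Q where Q: "B Q" "\<forall>e. P e \<longleftrightarrow> (\<exists>a. Q (case_nat a e))" using 0(1) unfolding S_def by auto
  \<comment> \<open>Only index \<open>0\<close> matters to \<open>P\<close>, so the remaining values
    may be frozen.\<close>
  define e0 :: "nat \<Rightarrow> 'a" where "e0 = (\<lambda>_. \<zero>)"
  define A where "A = {p. \<exists>i. i \<preceq> p \<and> (\<exists>m. m \<preceq> p \<and> p = pair M i m \<and> Q (case_nat m (case_nat i e0)))}"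
  let ?r = "\<lambda>i. case i of 0 \<Rightarrow> 0 | Suc 0 \<Rightarrow> Suc 0 | Suc (Suc j) \<Rightarrow> j + 3"
  have inj: "inj ?r" by (rule injI) (auto split: nat.split_asm)
  have "(\<lambda>i. e (?r i)) = case_nat (e 0) (case_nat (e 1) (\<lambda>i. e (i + 3)))" for e :: "nat \<Rightarrow> 'a"
    by (auto simp: fun_eq_iff split: nat.splits)
  then have "B (\<lambda>e. Q (case_nat (e 0) (case_nat (e 1) (\<lambda>i. e (i + 3)))))"
    using B_rename[OF Q(1) inj] by simp
  then have "D (\<lambda>e. \<exists>i. i \<preceq> e 0 \<and> (\<exists>m. m \<preceq> e 0 \<and> e 0 = pair M i m \<and>
      Q (case_nat m (case_nat i (\<lambda>i. e (Suc i))))))"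
    by (intro D_bex_le D_conj D_eq F_pair F_intros) (simp add: D_B eval_nat_numeral)
  from D_comprehension[OF this, of e0] have "A \<in> sets M" unfolding A_def by simp
  then have "{i. \<exists>m. pair M i m \<in> A} \<in> sets M" using jump unfolding jump_closed_def by blast
  moreover have "(\<exists>m. pair M i m \<in> A) \<longleftrightarrow> P (case_nat i e0)" for i
    unfolding A_def using Q(2) pair_inj le_pair1 le_pair2 by auto
  ultimately have "{i. P (case_nat i e0)} \<in> sets M" by simp
  then have "D (\<lambda>e. e 0 \<in> {i. P (case_nat i e0)})" by (intro D_intros)
  moreover have "P (case_nat (e 0) e0) = P e" for e using 0(2)[of "case_nat (e 0) e0" e] by simp
  ultimately show ?case by simp
next
  case (Suc N)
  define P' where "P' e \<longleftrightarrow> (\<exists>a b. e 0 = pair M a b \<and> P (case_nat a (case_nat b (\<lambda>i. e (Suc i)))))" for e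
  let ?r = "\<lambda>i. case i of 0 \<Rightarrow> 1 | Suc 0 \<Rightarrow> 0 | Suc (Suc j) \<Rightarrow> j + 3"
  have inj: "inj ?r" by (rule injI) (auto split: nat.split_asm)
  have "(\<lambda>i. e (?r i)) = case_nat (e 1) (case_nat (e 0) (\<lambda>i. e (i + 3)))" for e :: "nat \<Rightarrow> 'a"
    by (auto simp: fun_eq_iff split: nat.splits)
  then have "S (\<lambda>e. P (case_nat (e 1) (case_nat (e 0) (\<lambda>i. e (i + 3)))))"
    using S_rename[OF Suc(2) inj] by simp
  then have "S P'"
    unfolding P'_def by (intro S_ex S_conj F_S_eq F_pair F_intros) (simp add: eval_nat_numeral)
  moreover have "P' e = P' e'" if e: "\<forall>i<Suc N. e i = e' i" for e e'
  proof -
    have "P (case_nat a (case_nat b (\<lambda>i. e (Suc i)))) = P (case_nat a (case_nat b (\<lambda>i. e' (Suc i))))" for a b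
      by (rule Suc(3)) (use e in \<open>auto split: nat.splits\<close>)
    then show ?thesis using e unfolding P'_def by simp
  qed
  ultimately have P': "D P'" by (rule Suc(1))
  have inj': "inj (\<lambda>i. case i of 0 \<Rightarrow> 0 | Suc j \<Rightarrow> j + 3)"
    by (rule injI) (auto split: nat.split_asm)
  have "(\<lambda>i. e (case i of 0 \<Rightarrow> 0 | Suc j \<Rightarrow> j + 3)) = case_nat (e 0) (\<lambda>i. e (i + 3))" for e :: "nat \<Rightarrow> 'a"
    by (auto split: nat.splits)
  then have "D (\<lambda>e. P' (case_nat (e 0) (\<lambda>i. e (i + 3))))" using D_rename[OF P' inj'] by simp
  then have "D (\<lambda>e. P' (case_nat (e 0) (\<lambda>i. e (Suc (i + 2)))))" by (simp add: eval_nat_numeral)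
  then have "D (\<lambda>e. P' (case_nat (pair M (e 0) (e 1)) (\<lambda>i. e (i + 2))))"
    by (intro D_subst1[where P="\<lambda>a e. P' (case_nat a (\<lambda>i. e (i + 2)))"] F_pair F_intros)
  moreover have "P' (case_nat (pair M (e 0) (e 1)) (\<lambda>i. e (i + 2))) = P e" for e
  proof -
    have "case_nat (e 0) (case_nat (e 1) (\<lambda>i. e (i + 2))) = e" by (auto simp: fun_eq_iff split: nat.splits)
    then show ?thesis unfolding P'_def using pair_inj by auto
  qed
  ultimately show ?case by simp
qed

lemma S_D: assumes "S P" shows "D P"
proof -
  obtain p E where p: "\<forall>e. sat M e E p = P e" using S_formula[OF assms] by auto
  obtain N where N: "\<forall>e e' E. (\<forall>i<N. e i = e' i) \<longrightarrow> sat M e E p = sat M e' E p"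
    using sat_cong[of M p] by blast
  show ?thesis
  proof (rule S_D_finite[OF assms])
    fix e e' :: "nat \<Rightarrow> 'a" assume "\<forall>i<Suc N. e i = e' i"
    then have "\<forall>i<N. e i = e' i" by simp
    then show "P e = P e'" using N p by metis
  qed
qed

lemma D_ex: "D (\<lambda>e. P (e 0) (\<lambda>i. e (Suc i))) \<Longrightarrow> D (\<lambda>e. \<exists>a. P a e)"
  by (rule S_D, rule S_ex, rule D_S)
lemma D_all: assumes "D (\<lambda>e. P (e 0) (\<lambda>i. e (Suc i)))" shows "D (\<lambda>e. \<forall>a. P a e)"
  using D_not[OF D_ex[OF D_not[OF assms]]] by simp

lemma F_tval: "(\<And>i. F (\<lambda>e. f e i)) \<Longrightarrow> F (\<lambda>e. tval M (f e) t)"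
  by (induct t) (auto intro: F_intros)

text \<open>\<open>G\<close> allows set parameters that vary with the environment;
  \<open>normal_form\<close> puts the graph of a coded position in place of the set
  variable.\<close>

lemma D_sat:
  assumes "arithmetical p" "\<And>i. F (\<lambda>e. f e i)" "\<And>Y. D (\<lambda>e. e 0 \<in> G (\<lambda>i. e (Suc i)) Y)"
  shows "D (\<lambda>e. sat M (f e) (G e) p)"
  using assms
proof (induct p arbitrary: f G)
  case (Mem t Y)
  show ?case unfolding sat.simps
    by (rule D_subst1[where P="\<lambda>a e. a \<in> G e Y"]) (intro Mem F_tval)+
next
  case (ExN x p)
  show ?case unfolding sat.simps
  proof (rule D_ex, rule ExN(1)[of "\<lambda>e. (f (\<lambda>i. e (Suc i)))(x := e 0)" "\<lambda>e. G (\<lambda>i. e (Suc i))"])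
    fix i show "F (\<lambda>e. ((f (\<lambda>i. e (Suc i)))(x := e 0)) i)"
      using F_weak[OF ExN(3), of 1 i] F_var by (cases "i = x") simp_all
  next
    fix Y show "D (\<lambda>e. e 0 \<in> G (\<lambda>i. e (Suc (Suc i))) Y)"
      using D_rename[OF ExN(4), of "\<lambda>i. if i = 0 then 0 else Suc i" Y] by (simp add: inj_def)
  qed (use ExN in simp)
next
  case (AllN x p)
  show ?case unfolding sat.simps
  proof (rule D_all, rule AllN(1)[of "\<lambda>e. (f (\<lambda>i. e (Suc i)))(x := e 0)" "\<lambda>e. G (\<lambda>i. e (Suc i))"])
    fix i show "F (\<lambda>e. ((f (\<lambda>i. e (Suc i)))(x := e 0)) i)"
      using F_weak[OF AllN(3), of 1 i] F_var by (cases "i = x") simp_all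
  next
    fix Y show "D (\<lambda>e. e 0 \<in> G (\<lambda>i. e (Suc (Suc i))) Y)"
      using D_rename[OF AllN(4), of "\<lambda>i. if i = 0 then 0 else Suc i" Y] by (simp add: inj_def)
  qed (use AllN in simp)
next
  case (Eq s t) then show ?case unfolding sat.simps by (intro D_eq F_tval)
next
  case (Lt s t) then show ?case unfolding sat.simps by (intro D_lt F_tval)
next
  case (Neg p) then show ?case unfolding sat.simps by (intro D_not) simp
next
  case (Conj p q)
  then have "D (\<lambda>e. sat M (f e) (G e) p)" "D (\<lambda>e. sat M (f e) (G e) q)" by simp_all
  then show ?case unfolding sat.simps by (intro D_conj)
next
  case (Disj p q)
  then have "D (\<lambda>e. sat M (f e) (G e) p)" "D (\<lambda>e. sat M (f e) (G e) q)" by simp_all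
  then show ?case unfolding sat.simps by (intro D_disj)
next
  case (Imp p q)
  then have "D (\<lambda>e. sat M (f e) (G e) p)" "D (\<lambda>e. sat M (f e) (G e) q)" by simp_all
  then show ?case unfolding sat.simps by (intro D_imp)
qed simp_all

lemma jump_closed_ACA0: "ACA0 M"
  unfolding ACA0_def
proof (intro conjI sets_nonempty basic)
  show "set_induction M" unfolding set_induction_def
  proof (intro ballI impI allI)
    fix X n assume X: "X \<in> sets M" "\<zero> \<in> X" "\<forall>n. n \<in> X \<longrightarrow> n \<oplus> \<one> \<in> X"
    show "n \<in> X"
      by (rule S_induction[where P="\<lambda>n. n \<in> X"]) (use X D_S[OF D_mem[OF X(1) F_var]] in auto)
  qed
  show "arithmetical_comprehension M" unfolding arithmetical_comprehension_def
  proof (intro allI impI)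
    fix p x e E assume p: "arithmetical p" "set_assignment M E"
    have "D (\<lambda>e'. sat M (e(x := e' 0)) E p)"
    proof (rule D_sat[OF p(1)])
      fix i show "F (\<lambda>e'. (e(x := e' 0)) i)" by (cases "i = x") (simp_all add: F_intros)
    next
      fix Y show "D (\<lambda>e'. e' 0 \<in> E Y)" using p(2) by (intro D_intros) (auto simp: set_assignment_def)
    qed
    then show "{n. sat M (e(x := n)) E p} \<in> sets M" using D_set by simp
  qed
qed

definition least :: "('a \<Rightarrow> bool) \<Rightarrow> 'a" where
  "least Q = (if \<exists>m. Q m then THE m. Q m \<and> (\<forall>k. k \<prec> m \<longrightarrow> \<not> Q k) else \<zero>)"

lemma least_iff:
  assumes "D (\<lambda>e. Q (e 0))"
  shows "m = least Q \<longleftrightarrow> (if \<exists>m. Q m then Q m \<and> (\<forall>k. k \<prec> m \<longrightarrow> \<not> Q k) else m = \<zero>)"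
proof (cases "\<exists>m. Q m")
  case True
  then obtain m0 where m0: "Q m0 \<and> (\<forall>k. k \<prec> m0 \<longrightarrow> \<not> Q k)" using D_least[OF assms] by blast
  have uniq: "m = m0" if "Q m \<and> (\<forall>k. k \<prec> m \<longrightarrow> \<not> Q k)" for m
    using that m0 lt_linear by blast
  have "(THE m. Q m \<and> (\<forall>k. k \<prec> m \<longrightarrow> \<not> Q k)) = m0" by (rule the_equality) (use m0 uniq in blast)+
  then have "least Q = m0" using True unfolding least_def by simp
  then have eq: "m = least Q \<longleftrightarrow> m = m0" by simp
  show ?thesis unfolding eq if_P[OF True]
  proof
    assume "m = m0" then show "Q m \<and> (\<forall>k. k \<prec> m \<longrightarrow> \<not> Q k)" using m0 by blast
  qed (rule uniq)
qed (simp add: least_def)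

lemma least:
  assumes "D (\<lambda>e. Q (e 0))" "Q n"
  shows "Q (least Q)" "least Q \<preceq> n"
proof -
  have "\<exists>m. Q m" using assms(2) by blast
  then have "Q (least Q) \<and> (\<forall>k. k \<prec> least Q \<longrightarrow> \<not> Q k)"
    using iffD1[OF least_iff[OF assms(1), of "least Q"] refl] unfolding if_P[OF \<open>\<exists>m. Q m\<close>] by blast
  then show "Q (least Q)" "least Q \<preceq> n" using assms(2) le_lt by blast+
qed

text \<open>Whether any value exists is an unbounded question, settled by \<open>D_ex\<close>; with
  the default zero the graph is then Delta01.\<close>

lemma F_least:
  assumes "D (\<lambda>e. Q (e 0) (e 1))"
  shows "F (\<lambda>e. least (\<lambda>m. Q m (e 0)))"
proof -
  have Qc: "D (\<lambda>e. Q (e 0) c)" for c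
    by (rule D_subst2[where P=Q, OF assms]) (intro F_intros)+
  have *: "m = least (\<lambda>m. Q m c) \<longleftrightarrow> (if \<exists>m. Q m c then Q m c \<and> (\<forall>k. k \<prec> m \<longrightarrow> \<not> Q k c) else m = \<zero>)" for m c
    by (rule least_iff[OF Qc])
  have Q: "D (\<lambda>e. Q (e i) (e j))" for i j
    by (rule D_subst2[where P=Q, OF assms]) (intro F_intros)+
  show ?thesis unfolding F_def * by (intro D_S D_intros D_ex Q)
qed

subsection \<open>A normal form for \<open>\<Sigma>\<^sup>0\<^sub>1\<close> classes\<close>

text \<open>Terms are built from sums and products. Monotonicity is what lets the bound in
  \<open>bounded_use\<close> survive bounded quantifiers.\<close>

lemma tval_mono: "a \<preceq> c \<Longrightarrow> tval M (e(x := a)) b \<preceq> tval M (e(x := c)) b"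
proof (induct b)
  case (Plus s t) then show ?case by (simp add: ar.add_mono)
next
  case (Times s t) then show ?case by (simp add: ar.mult_mono zero_le)
qed (auto simp: ar.order.refl)

text \<open>The use principle: the value of the term \<open>b\<close> bounds the numbers that the
  formula can ask \<open>X\<close> about. Bounds are added for connectives, and a bounded quantifier
  is passed by replacing its variable with its bound.\<close>

lemma bounded_use:
  assumes "bounded_fml q"
  shows "\<exists>b. \<forall>e Y Y'. (\<forall>p. p \<prec> tval M e b \<longrightarrow> (p \<in> Y \<longleftrightarrow> p \<in> Y')) \<longrightarrow>
    sat M e (E(X := Y)) q = sat M e (E(X := Y')) q"
proof -
  have w: "\<forall>p. p \<prec> c \<longrightarrow> R p" if "\<forall>p. p \<prec> d \<longrightarrow> R p" "c \<preceq> d" for c d and R :: "'a \<Rightarrow> bool"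
    using that ar.less_le_trans by blast
  have two: "\<exists>b. \<forall>e Y Y'. (\<forall>p. p \<prec> tval M e b \<longrightarrow> (p \<in> Y \<longleftrightarrow> p \<in> Y')) \<longrightarrow> A e Y Y' \<and> C e Y Y'"
    if A: "\<exists>b. \<forall>e Y Y'. (\<forall>p. p \<prec> tval M e b \<longrightarrow> (p \<in> Y \<longleftrightarrow> p \<in> Y')) \<longrightarrow> A e Y Y'"
    and C: "\<exists>b. \<forall>e Y Y'. (\<forall>p. p \<prec> tval M e b \<longrightarrow> (p \<in> Y \<longleftrightarrow> p \<in> Y')) \<longrightarrow> C e Y Y'" for A C
  proof -
    from A obtain b where b: "\<forall>e Y Y'. (\<forall>p. p \<prec> tval M e b \<longrightarrow> (p \<in> Y \<longleftrightarrow> p \<in> Y')) \<longrightarrow> A e Y Y'" ..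
    from C obtain c where c: "\<forall>e Y Y'. (\<forall>p. p \<prec> tval M e c \<longrightarrow> (p \<in> Y \<longleftrightarrow> p \<in> Y')) \<longrightarrow> C e Y Y'" ..
    show ?thesis
    proof (intro exI[of _ "Plus b c"] allI impI)
      fix e Y Y' assume "\<forall>p. p \<prec> tval M e (Plus b c) \<longrightarrow> (p \<in> Y \<longleftrightarrow> p \<in> Y')"
      then have *: "\<forall>p. p \<prec> tval M e b \<oplus> tval M e c \<longrightarrow> (p \<in> Y \<longleftrightarrow> p \<in> Y')" by simp
      note 1 = w[OF * le_add1] and 2 = w[OF * le_add2]
      show "A e Y Y' \<and> C e Y Y'"
        by (intro conjI b[THEN spec, THEN spec, THEN spec, THEN mp, OF 1]
          c[THEN spec, THEN spec, THEN spec, THEN mp, OF 2])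
    qed
  qed
  have quant: "\<exists>b. \<forall>e Y Y'. (\<forall>p. p \<prec> tval M e b \<longrightarrow> (p \<in> Y \<longleftrightarrow> p \<in> Y')) \<longrightarrow>
      (\<forall>a. a \<prec> tval M e t \<longrightarrow> A (e(x := a)) Y Y')"
    if A: "\<exists>b. \<forall>e Y Y'. (\<forall>p. p \<prec> tval M e b \<longrightarrow> (p \<in> Y \<longleftrightarrow> p \<in> Y')) \<longrightarrow> A e Y Y'" for A t x
  proof -
    from A obtain b where b: "\<forall>e Y Y'. (\<forall>p. p \<prec> tval M e b \<longrightarrow> (p \<in> Y \<longleftrightarrow> p \<in> Y')) \<longrightarrow> A e Y Y'" ..
    show ?thesis
    proof (intro exI[of _ "tsubst x t b"] allI impI)
      fix e Y Y' a assume *: "\<forall>p. p \<prec> tval M e (tsubst x t b) \<longrightarrow> (p \<in> Y \<longleftrightarrow> p \<in> Y')" and "a \<prec> tval M e t"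
      then have le: "tval M (e(x := a)) b \<preceq> tval M e (tsubst x t b)"
        unfolding tval_tsubst by (intro tval_mono) (simp add: le_def)
      show "A (e(x := a)) Y Y'"
        by (rule b[THEN spec, THEN spec, THEN spec, THEN mp, OF w[OF * le]])
    qed
  qed
  show ?thesis using assms
  proof induct
    case (3 t Z)
    show ?case by (rule exI[of _ "Plus t One"]) (auto simp: lt_suc)
  next
    case (5 p q) from two[OF 5(2) 5(4)] show ?case by (elim exE) (rule exI, auto)
  next
    case (6 p q) from two[OF 6(2) 6(4)] show ?case by (elim exE) (rule exI, auto)
  next
    case (7 p q) from two[OF 7(2) 7(4)] show ?case by (elim exE) (rule exI, auto)
  next
    case (8 p x t)
    have t: "tval M (e(x := a)) t = tval M e t" for e a using 8(3) by (intro tval_cong) auto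
    from quant[OF 8(2), of t x] obtain b where b: "\<forall>e Y Y'. (\<forall>p. p \<prec> tval M e b \<longrightarrow> (p \<in> Y \<longleftrightarrow> p \<in> Y')) \<longrightarrow>
      (\<forall>a. a \<prec> tval M e t \<longrightarrow> sat M (e(x := a)) (E(X := Y)) p = sat M (e(x := a)) (E(X := Y')) p)" ..
    show ?case
    proof (intro exI[of _ b] allI impI)
      fix e Y Y' assume *: "\<forall>p. p \<prec> tval M e b \<longrightarrow> (p \<in> Y \<longleftrightarrow> p \<in> Y')"
      note b[THEN spec, THEN spec, THEN spec, THEN mp, OF *]
      then show "sat M e (E(X := Y)) (AllN x (Imp (Lt (Var x) t) p)) = sat M e (E(X := Y')) (AllN x (Imp (Lt (Var x) t) p))"
        unfolding sat.simps tval.simps t fun_upd_same by blast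
    qed
  next
    case (9 p x t)
    have t: "tval M (e(x := a)) t = tval M e t" for e a using 9(3) by (intro tval_cong) auto
    from quant[OF 9(2), of t x] obtain b where b: "\<forall>e Y Y'. (\<forall>p. p \<prec> tval M e b \<longrightarrow> (p \<in> Y \<longleftrightarrow> p \<in> Y')) \<longrightarrow>
      (\<forall>a. a \<prec> tval M e t \<longrightarrow> sat M (e(x := a)) (E(X := Y)) p = sat M (e(x := a)) (E(X := Y')) p)" ..
    show ?case
    proof (intro exI[of _ b] allI impI)
      fix e Y Y' assume *: "\<forall>p. p \<prec> tval M e b \<longrightarrow> (p \<in> Y \<longleftrightarrow> p \<in> Y')"
      note b[THEN spec, THEN spec, THEN spec, THEN mp, OF *]
      then show "sat M e (E(X := Y)) (ExN x (Conj (Lt (Var x) t) p)) = sat M e (E(X := Y')) (ExN x (Conj (Lt (Var x) t) p))"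
        unfolding sat.simps tval.simps t fun_upd_same by blast
    qed
  qed auto
qed

text \<open>A true instance of the matrix queries only a finite part of the play, so some position
  settles it; \<open>U\<close> collects these positions. A longer position answers the same queries
  alike, hence the closure under extension.\<close>

lemma normal_form:
  assumes "sigma01 p" "set_assignment M E"
  shows "\<exists>U\<in>sets M. (\<forall>s\<in>U. Seq s \<and> (\<forall>a. app s a \<in> U)) \<and>
    (\<forall>x. infinite_seq M x \<longrightarrow> (sat M e (E(X := x)) p \<longleftrightarrow> (\<exists>n. pre x n \<in> U)))"
proof -
  obtain y q where q: "bounded_fml q" "p = ExN y q" using assms unfolding sigma01_def by auto
  obtain b where b: "\<forall>e Y Y'. (\<forall>p. p \<prec> tval M e b \<longrightarrow> (p \<in> Y \<longleftrightarrow> p \<in> Y')) \<longrightarrow>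
    sat M e (E(X := Y)) q = sat M e (E(X := Y')) q" using bounded_use[OF q(1)] by blast
  \<comment> \<open>An entry \<open>pair i j\<close> below the bound has \<open>i\<close> below the
    length of \<open>s\<close>, so it is enough to compare the bound with the length.\<close>
  define U where "U = {s. Seq s \<and> (\<exists>a. tval M (e(y := a)) b \<preceq> lh s \<and> sat M (e(y := a)) (E(X := members M s)) q)}"
  have Fe: "F (\<lambda>e'. (e(y := e' 0)) i)" for i by (cases "i = y") (simp_all add: F_intros)
  have "D (\<lambda>e'. sat M (e(y := e' 0)) (E(X := members M (e' 1))) q)"
  proof (rule D_sat[OF bounded_arithmetical[OF q(1)] Fe])
    fix Y show "D (\<lambda>e'. e' 0 \<in> (E(X := members M (e' (Suc 1)))) Y)"
    proof (cases "Y = X")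
      case False
      have "E Y \<in> sets M" using assms(2) by (auto simp: set_assignment_def)
      then show ?thesis using False by (simp add: D_mem F_var)
    qed (simp add: D_members F_var)
  qed
  then have "D (\<lambda>e'. e' 0 \<in> U)" unfolding U_def mem_Collect_eq
    by (intro D_conj D_Seq D_ex D_le F_tval Fe F_lh F_intros) simp
  then have "U \<in> sets M" using D_set[of "\<lambda>s. s \<in> U"] by simp
  moreover have "Seq s \<and> app s a \<in> U" if s: "s \<in> U" for s a
  proof -
    obtain c where c: "Seq s" "tval M (e(y := c)) b \<preceq> lh s" "sat M (e(y := c)) (E(X := members M s)) q"
      using s unfolding U_def by blast
    have "p \<in> members M s \<longleftrightarrow> p \<in> members M (app s a)" if p: "p \<prec> tval M (e(y := c)) b" for p
    proof
      assume "p \<in> members M (app s a)"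
      then obtain i j where ij: "p = pair M i j" "pair M i j \<in> members M (app s a)"
        using members_pair[OF Seq_app[OF c(1)]] by blast
      have "i \<prec> lh s" using p c(2) ij(1) le_pair1 by (metis ar.le_less_trans ar.less_le_trans)
      then show "p \<in> members M s" using ij members_app[OF c(1)] lt_irrefl by metis
    qed (use members_sub_app[OF c(1)] in blast)
    then have "sat M (e(y := c)) (E(X := members M (app s a))) q" using b c(3) by blast
    moreover have "tval M (e(y := c)) b \<preceq> lh (app s a)"
      unfolding lh_app[OF c(1)] using c(2) le_add1 by (rule ar.order.trans)
    ultimately show ?thesis using c(1) unfolding U_def by auto
  qed
  moreover have "sat M e (E(X := x)) p \<longleftrightarrow> (\<exists>n. pre x n \<in> U)" if x: "infinite_seq M x" for x
  proof -
    have agree: "sat M (e(y := a)) (E(X := x)) q = sat M (e(y := a)) (E(X := members M (pre x n))) q"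
      if n: "tval M (e(y := a)) b \<preceq> n" for a n
    proof (intro b[rule_format])
      fix p assume p: "p \<prec> tval M (e(y := a)) b"
      show "p \<in> x \<longleftrightarrow> p \<in> members M (pre x n)"
      proof
        assume px: "p \<in> x"
        then obtain i j where ij: "p = pair M i j" using x unfolding infinite_seq_def by blast
        have "i \<prec> n" using p n ij le_pair1 by (metis ar.le_less_trans ar.less_le_trans)
        then show "p \<in> members M (pre x n)" using ij px pre_entry[OF x] nth_iff[OF x] by blast
      next
        assume pm: "p \<in> members M (pre x n)"
        then obtain i j where ij: "p = pair M i j" using members_pair[OF Seq_pre[OF x]] by blast
        then show "p \<in> x" using pm pre_entry[OF x] nth_iff[OF x] by blast
      qed
    qed
    show ?thesis unfolding q(2) U_def sat.simps mem_Collect_eq lh_pre[OF x]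
      using agree Seq_pre[OF x] ar.order.refl by metis
  qed
  ultimately show ?thesis by blast
qed

subsection \<open>Solving games on binary choice trees\<close>

definition my :: "bool \<Rightarrow> 'a \<Rightarrow> bool" where "my pl s \<longleftrightarrow> is_even M (lh s) = pl"

text \<open>In the region \<open>R\<close> the set \<open>V\<close> consists of the positions won by the player \<open>pl\<close>, by means of
  \<open>h\<close>; from the other positions the opponent wins by means of \<open>h'\<close>. Neither strategy is ever the
  first to leave \<open>T\<close>.\<close>

definition solution :: "'a set \<Rightarrow> 'a set \<Rightarrow> bool \<Rightarrow> ('a set \<Rightarrow> bool) \<Rightarrow> 'a set \<Rightarrow> ('a \<Rightarrow> 'a) \<Rightarrow> ('a \<Rightarrow> 'a) \<Rightarrow> bool" where
  "solution T R pl P V h h' \<longleftrightarrow> V \<in> sets M \<and> V \<subseteq> T \<and> F (\<lambda>e. h (e 0)) \<and> F (\<lambda>e. h' (e 0)) \<and>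
    (\<forall>s\<in>R. s \<in> V \<longrightarrow> my pl s \<longrightarrow> app s (h s) \<in> V) \<and>
    (\<forall>s\<in>R. \<forall>a. s \<in> V \<longrightarrow> \<not> my pl s \<longrightarrow> app s a \<in> T \<longrightarrow> app s a \<in> V) \<and>
    (\<forall>s\<in>R. s \<in> T - V \<longrightarrow> \<not> my pl s \<longrightarrow> app s (h' s) \<in> T - V) \<and>
    (\<forall>s\<in>R. \<forall>a. s \<in> T - V \<longrightarrow> my pl s \<longrightarrow> app s a \<in> T \<longrightarrow> app s a \<notin> V) \<and>
    (\<forall>x n0. infinite_seq M x \<longrightarrow> (\<forall>n. pre x n \<in> T) \<longrightarrow> (\<forall>n. n0 \<preceq> n \<longrightarrow> pre x n \<in> R \<inter> V) \<longrightarrow>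
       (\<forall>n. n0 \<preceq> n \<longrightarrow> is_even M n = pl \<longrightarrow> nth x n = h (pre x n)) \<longrightarrow> P x) \<and>
    (\<forall>x n0. infinite_seq M x \<longrightarrow> (\<forall>n. pre x n \<in> T) \<longrightarrow> (\<forall>n. n0 \<preceq> n \<longrightarrow> pre x n \<in> R - V) \<longrightarrow>
       (\<forall>n. n0 \<preceq> n \<longrightarrow> is_even M n \<noteq> pl \<longrightarrow> nth x n = h' (pre x n)) \<longrightarrow> \<not> P x)"

lemma solution_win:
  assumes "solution T R pl P V h h'" "infinite_seq M x" "\<forall>n. pre x n \<in> T"
    "\<forall>n. n0 \<preceq> n \<longrightarrow> pre x n \<in> R \<inter> V" "\<forall>n. n0 \<preceq> n \<longrightarrow> is_even M n = pl \<longrightarrow> nth x n = h (pre x n)"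
  shows "P x"
  by (rule assms(1)[unfolded solution_def, THEN conjunct2, THEN conjunct2, THEN conjunct2, THEN conjunct2, THEN conjunct2, THEN conjunct2, THEN conjunct2, THEN conjunct2, THEN conjunct1, rule_format, OF assms(2)])
    (use assms(3-5) in auto)

lemma solution_lose:
  assumes "solution T R pl P V h h'" "infinite_seq M x" "\<forall>n. pre x n \<in> T"
    "\<forall>n. n0 \<preceq> n \<longrightarrow> pre x n \<in> R - V" "\<forall>n. n0 \<preceq> n \<longrightarrow> is_even M n \<noteq> pl \<longrightarrow> nth x n = h' (pre x n)"
  shows "\<not> P x"
  by (rule assms(1)[unfolded solution_def, THEN conjunct2, THEN conjunct2, THEN conjunct2, THEN conjunct2, THEN conjunct2, THEN conjunct2, THEN conjunct2, THEN conjunct2, THEN conjunct2, rule_format, OF assms(2)])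
    (use assms(3-5) in auto)

lemma solution_moves:
  assumes "solution T R pl P V h h'"
  shows "V \<in> sets M" "V \<subseteq> T" "F (\<lambda>e. h (e 0))" "F (\<lambda>e. h' (e 0))"
    "\<forall>s\<in>R. s \<in> V \<longrightarrow> my pl s \<longrightarrow> app s (h s) \<in> V"
    "\<forall>s\<in>R. \<forall>a. s \<in> V \<longrightarrow> \<not> my pl s \<longrightarrow> app s a \<in> T \<longrightarrow> app s a \<in> V"
    "\<forall>s\<in>R. s \<in> T - V \<longrightarrow> \<not> my pl s \<longrightarrow> app s (h' s) \<in> T - V"
    "\<forall>s\<in>R. \<forall>a. s \<in> T - V \<longrightarrow> my pl s \<longrightarrow> app s a \<in> T \<longrightarrow> app s a \<notin> V"
  by (insert assms[unfolded solution_def]) (elim conjE, assumption)+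

text \<open>Used to pass from the whole tree to the region \<open>U\<close>, and from a normal form
  back to its formula.\<close>

lemma solution_weaken:
  assumes sol: "solution T R pl P V h h'" and R: "R' \<subseteq> R"
    and P: "\<And>x. infinite_seq M x \<Longrightarrow> P x \<longleftrightarrow> P' x"
  shows "solution T R' pl P' V h h'"
  unfolding solution_def
proof (intro conjI)
  show "\<forall>x n0. infinite_seq M x \<longrightarrow> (\<forall>n. pre x n \<in> T) \<longrightarrow> (\<forall>n. n0 \<preceq> n \<longrightarrow> pre x n \<in> R' \<inter> V) \<longrightarrow>
       (\<forall>n. n0 \<preceq> n \<longrightarrow> is_even M n = pl \<longrightarrow> nth x n = h (pre x n)) \<longrightarrow> P' x"
    by (intro allI impI, rule iffD1[OF P], assumption, rule solution_win[OF sol]) (use R in blast)+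
  show "\<forall>x n0. infinite_seq M x \<longrightarrow> (\<forall>n. pre x n \<in> T) \<longrightarrow> (\<forall>n. n0 \<preceq> n \<longrightarrow> pre x n \<in> R' - V) \<longrightarrow>
       (\<forall>n. n0 \<preceq> n \<longrightarrow> is_even M n \<noteq> pl \<longrightarrow> nth x n = h' (pre x n)) \<longrightarrow> \<not> P' x"
    by (intro allI impI, subst P[symmetric], assumption, rule solution_lose[OF sol]) (use R in blast)+
qed (use solution_moves[OF sol] R in blast)+

text \<open>Holds vacuously for every \<open>P\<close>. It feeds \<open>ex_solution_False\<close>,
  where \<open>U\<close> is empty too.\<close>

lemma solution_empty: "solution T {} pl P {} (\<lambda>_. \<zero>) (\<lambda>_. \<zero>)"
proof -
  have "{a. False} \<in> sets M" by (rule D_set) (rule D_const)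
  then show ?thesis unfolding solution_def using F_const ar.order.refl by auto
qed

context
  fixes T U V0 :: "'a set" and pl :: bool and g g' :: "'a \<Rightarrow> 'a" and P' :: "'a set \<Rightarrow> bool"
  assumes T: "binary_choice_tree M T" and U: "U \<in> sets M"
    and up: "\<And>s a. s \<in> U \<Longrightarrow> app s a \<in> U"
    and sol: "solution T U (\<not> pl) P' V0 g g'"
begin

text \<open>The player \<open>pl\<close> attracts the play to \<open>U - V0\<close>. Membership is witnessed by a finite set of
  positions, so that the attractor is arithmetical.\<close>

definition ok :: "'a set \<Rightarrow> 'a \<Rightarrow> bool" where
  "ok A s \<longleftrightarrow> s \<in> T \<and> (if s \<in> U then s \<notin> V0 else
     (my pl s \<and> (\<exists>a. app s a \<in> A)) \<or> (\<not> my pl s \<and> (\<forall>a. app s a \<in> T \<longrightarrow> app s a \<in> A)))"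

text \<open>Outside \<open>U\<close> the player can keep the play inside the set, on ever longer
  positions. A coded set is bounded, so the play has to reach \<open>U\<close> unless the opponent
  leaves \<open>T\<close>.\<close>

definition good :: "'a \<Rightarrow> bool" where "good c \<longleftrightarrow> (\<forall>s. s \<in> members M c \<longrightarrow> ok (members M c) s)"

definition Att :: "'a set" where "Att = {s. \<exists>c. good c \<and> s \<in> members M c}"

text \<open>A canonical witness. Minimality makes the chosen witnesses decrease weakly along a play,
  which is enough for \<open>att_win\<close>.\<close>

definition rk :: "'a \<Rightarrow> 'a" where "rk s = least (\<lambda>c. good c \<and> s \<in> members M c)"

text \<open>Inside \<open>U\<close> the inner game is solved for the other player, so there
  \<open>g'\<close> is the strategy that serves \<open>pl\<close>. Outside \<open>U\<close> the move
  stays in the current witness.\<close>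

definition att_move :: "'a \<Rightarrow> 'a" where
  "att_move s = (if s \<in> U then g' s else least (\<lambda>a. app s a \<in> members M (rk s)))"

definition avoid_move :: "'a \<Rightarrow> 'a" where
  "avoid_move s = (if s \<in> U then g s else least (\<lambda>a. app s a \<in> T \<and> app s a \<notin> Att))"

lemma V0: "V0 \<in> sets M" by (rule solution_moves[OF sol])

lemma D_my: "F t \<Longrightarrow> D (\<lambda>e. my pl (t e))" unfolding my_def by (intro D_intros D_even F_lh)

lemma D_good: "F t \<Longrightarrow> D (\<lambda>e. good (t e))"
  by (rule D_subst1[where P="\<lambda>c e. good c"])
    (unfold good_def ok_def, intro D_intros D_all D_ex D_members D_my F_app tree_sets[OF T] U V0)

lemma D_Att: "F t \<Longrightarrow> D (\<lambda>e. t e \<in> Att)"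
  by (rule D_subst1[where P="\<lambda>c e. c \<in> Att"])
    (unfold Att_def mem_Collect_eq, intro D_intros D_ex D_members D_good)

lemma Att_sets: "Att \<in> sets M" using D_set[OF D_Att[OF F_var]] by simp

lemma F_rk: "F (\<lambda>e. rk (e 0))"
  unfolding rk_def by (intro F_least D_intros D_good D_members)

lemma F_att_move: "F (\<lambda>e. att_move (e 0))"
proof -
  have "F (\<lambda>e. least (\<lambda>a. app (e 0) a \<in> members M (rk (e 0))))"
    by (rule F_least[where Q="\<lambda>a s. app s a \<in> members M (rk s)"]) (intro D_members F_app F_move[OF F_rk] F_intros)
  then show ?thesis
    unfolding att_move_def by (intro F_If D_intros U solution_moves[OF sol])
qed

lemma F_avoid_move: "F (\<lambda>e. avoid_move (e 0))"
proof -
  have "F (\<lambda>e. least (\<lambda>a. app (e 0) a \<in> T \<and> app (e 0) a \<notin> Att))"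
    by (rule F_least[where Q="\<lambda>a s. app s a \<in> T \<and> app s a \<notin> Att"])
      (intro D_intros D_Att F_app tree_sets[OF T])
  then show ?thesis
    unfolding avoid_move_def by (intro F_If D_intros U solution_moves[OF sol])
qed

lemma ok_mono: "ok A s \<Longrightarrow> A \<subseteq> A' \<Longrightarrow> ok A' s"
  unfolding ok_def by (auto split: if_splits)

lemma rk: assumes "s \<in> Att" shows "good (rk s)" "s \<in> members M (rk s)"
proof -
  have "D (\<lambda>e. good (e 0) \<and> s \<in> members M (e 0))" by (intro D_intros D_good D_members)
  moreover obtain c where "good c \<and> s \<in> members M c" using assms unfolding Att_def by blast
  ultimately have "good (rk s) \<and> s \<in> members M (rk s)"
    unfolding rk_def using least(1)[of "\<lambda>c. good c \<and> s \<in> members M c"] by blast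
  then show "good (rk s)" "s \<in> members M (rk s)" by blast+
qed

lemma rk_le: assumes "good c" "s \<in> members M c" shows "rk s \<preceq> c"
proof -
  have "D (\<lambda>e. good (e 0) \<and> s \<in> members M (e 0))" by (intro D_intros D_good D_members)
  then show ?thesis unfolding rk_def using least(2)[of "\<lambda>c. good c \<and> s \<in> members M c"] assms by blast
qed

lemma good_sub: "good c \<Longrightarrow> members M c \<subseteq> Att" unfolding Att_def by blast

lemma Att_ok: "s \<in> Att \<Longrightarrow> ok (members M (rk s)) s" using rk unfolding good_def by blast
lemma Att_T: "Att \<subseteq> T" using Att_ok unfolding ok_def by blast

lemma good_union:
  assumes "good c" "good d"
  shows "\<exists>k. good k \<and> members M k = members M c \<union> members M d"
proof -
  have "\<exists>k. set_code M k \<and> members M k = {i. i \<in> members M c \<or> i \<in> members M d}"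
  proof (rule ex_set_code)
    show "D (\<lambda>e. e 0 \<in> members M c \<or> e 0 \<in> members M d)" by (intro D_intros D_members)
    show "i \<prec> c \<oplus> d" if "i \<in> members M c \<or> i \<in> members M d" for i
      using that members_less le_add1 le_add2 ar.less_le_trans by metis
  qed
  then obtain k where k: "members M k = members M c \<union> members M d" by auto
  have "good k" unfolding good_def k
  proof (intro allI impI)
    fix s assume "s \<in> members M c \<union> members M d"
    then show "ok (members M c \<union> members M d) s"
      using assms ok_mono[of _ s "members M c \<union> members M d"] unfolding good_def by blast
  qed
  then show ?thesis using k by blast
qed

text \<open>Adding \<open>s\<close> to the set \<open>c\<close> gives a good set again, by
  \<open>ok_mono\<close>.\<close>

lemma AttI: assumes "good c" "ok (members M c) s" shows "s \<in> Att"
proof -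
  have "\<exists>k. set_code M k \<and> members M k = {i. i \<in> members M c \<or> i = s}"
  proof (rule ex_set_code)
    show "D (\<lambda>e. e 0 \<in> members M c \<or> e 0 = s)" by (intro D_intros D_members)
    show "i \<prec> c \<oplus> (s \<oplus> \<one>)" if "i \<in> members M c \<or> i = s" for i
      using that members_less le_add1 lt_add add_comm add_assoc' ar.less_le_trans by metis
  qed
  then obtain k where k: "members M k = insert s (members M c)" by auto
  have "good k" unfolding good_def k
  proof (intro allI impI)
    fix t assume "t \<in> insert s (members M c)"
    then show "ok (insert s (members M c)) t"
      using assms ok_mono[of "members M c" t "insert s (members M c)"] unfolding good_def by blast
  qed
  then show ?thesis using k unfolding Att_def by blast
qed

lemma good_eps: "good eps" "members M eps = {}"
proof -
  show "members M eps = {}" using members_pair[OF Seq_eps] not_lt0 by auto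
  then show "good eps" unfolding good_def by simp
qed

text \<open>Here the binary branching of the tree is used.\<close>

lemma ok_Att: assumes "ok Att s" shows "s \<in> Att"
proof (cases "s \<in> U \<or> my pl s")
  case True
  show ?thesis
  proof (cases "s \<in> U")
    case True
    then have "ok (members M eps) s" using assms unfolding ok_def by simp
    then show ?thesis using AttI good_eps by blast
  next
    case False
    then obtain a where a: "app s a \<in> Att" using assms \<open>s \<in> U \<or> my pl s\<close> unfolding ok_def by auto
    then have "ok (members M (rk (app s a))) s"
      using assms False \<open>s \<in> U \<or> my pl s\<close> rk(2)[OF a] unfolding ok_def by auto
    then show ?thesis using AttI rk(1)[OF a] by blast
  qed
next
  case False
  have s: "s \<in> T" and all: "\<And>a. app s a \<in> T \<Longrightarrow> app s a \<in> Att"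
    using assms False unfolding ok_def by auto
  \<comment> \<open>Two values that cover all legal moves, also if there are fewer than two of
    them.\<close>
  obtain b1 b2 where b: "\<And>a. app s a \<in> T \<Longrightarrow> a = b1 \<or> a = b2"
    using tree_binary[OF T s] by metis
  \<comment> \<open>For an illegal move the empty set serves as witness.\<close>
  have "\<exists>c. good c \<and> (app s a \<in> T \<longrightarrow> app s a \<in> members M c)" for a
    using all[of a] rk good_eps by blast
  then obtain c1 c2 where c: "good c1" "app s b1 \<in> T \<longrightarrow> app s b1 \<in> members M c1"
    "good c2" "app s b2 \<in> T \<longrightarrow> app s b2 \<in> members M c2" by metis
  obtain k where k: "good k" "members M k = members M c1 \<union> members M c2" using good_union c by blast
  have "app s a \<in> members M k" if "app s a \<in> T" for a using b[OF that] that c k(2) by blast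
  then have "ok (members M k) s" using s False unfolding ok_def by auto
  then show ?thesis using AttI k by blast
qed

lemma att_move: assumes "s \<in> Att" "s \<notin> U" "my pl s" shows "app s (att_move s) \<in> members M (rk s)"
proof -
  have D: "D (\<lambda>e. app s (e 0) \<in> members M (rk s))" by (intro D_members F_app F_intros)
  obtain a where "app s a \<in> members M (rk s)" using Att_ok[OF assms(1)] assms(2,3) unfolding ok_def by auto
  from least(1)[of "\<lambda>a. app s a \<in> members M (rk s)", OF D this] show ?thesis
    unfolding att_move_def using assms(2) by simp
qed

lemma sol_at: 
  "s \<in> U \<Longrightarrow> s \<in> V0 \<Longrightarrow> \<not> my pl s \<Longrightarrow> app s (g s) \<in> V0"
  "s \<in> U \<Longrightarrow> s \<in> V0 \<Longrightarrow> my pl s \<Longrightarrow> app s a \<in> T \<Longrightarrow> app s a \<in> V0"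
  "s \<in> U \<Longrightarrow> s \<in> T - V0 \<Longrightarrow> my pl s \<Longrightarrow> app s (g' s) \<in> T - V0"
  "s \<in> U \<Longrightarrow> s \<in> T - V0 \<Longrightarrow> \<not> my pl s \<Longrightarrow> app s a \<in> T \<Longrightarrow> app s a \<notin> V0"
  "V0 \<subseteq> T"
  using solution_moves[OF sol] unfolding my_def by auto

text \<open>In \<open>U\<close> the condition \<open>ok\<close> depends on \<open>V0\<close> alone,
  whatever the witness is.\<close>

lemma Att_U: assumes "s \<in> U" shows "s \<in> Att \<longleftrightarrow> s \<in> T - V0"
proof -
  have "ok A s \<longleftrightarrow> s \<in> T - V0" for A unfolding ok_def using assms by simp
  then show ?thesis using Att_ok[of s] ok_Att[of s] by blast
qed

lemma stays_in_U:
  assumes x: "infinite_seq M x" and n1: "pre x n1 \<in> U" and "n1 \<preceq> n"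
  shows "pre x n \<in> U"
proof -
  have "n1 \<preceq> n \<longrightarrow> pre x n \<in> U"
  proof (rule S_induction[where P="\<lambda>n. n1 \<preceq> n \<longrightarrow> pre x n \<in> U"])
    show "S (\<lambda>e. n1 \<preceq> e 0 \<longrightarrow> pre x (e 0) \<in> U)" by (intro D_S D_intros U F_pre x)
    show "n1 \<preceq> \<zero> \<longrightarrow> pre x \<zero> \<in> U" using n1 le_def not_lt0 by metis
    show "n1 \<preceq> n \<oplus> \<one> \<longrightarrow> pre x (n \<oplus> \<one>) \<in> U" if "n1 \<preceq> n \<longrightarrow> pre x n \<in> U" for n
      using that n1 up unfolding pre_Suc[OF x] le_def lt_suc by (metis pre_Suc[OF x])
  qed
  then show ?thesis using assms(3) by blast
qed

text \<open>Before \<open>U\<close> is reached, the witness of a position also serves its successor,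
  so \<open>rk\<close> never increases. All positions would then have codes below one number while
  their lengths grow. Once in \<open>U\<close>, the play avoids \<open>V0\<close> and
  \<open>g'\<close> refutes \<open>P'\<close>.\<close>

lemma att_win:
  assumes x: "infinite_seq M x" "\<forall>n. pre x n \<in> T" "\<forall>n. n0 \<preceq> n \<longrightarrow> pre x n \<in> Att"
    "\<forall>n. n0 \<preceq> n \<longrightarrow> is_even M n = pl \<longrightarrow> nth x n = att_move (pre x n)"
  shows "(\<exists>n. pre x n \<in> U) \<and> \<not> P' x"
proof -
  have "\<exists>n. n0 \<preceq> n \<and> pre x n \<in> U"
  proof (rule ccontr)
    assume "\<not> ?thesis"
    then have nU: "pre x n \<notin> U" if "n0 \<preceq> n" for n using that by blast
    let ?c = "rk (pre x n0)"
    have step: "rk (pre x (n \<oplus> \<one>)) \<preceq> rk (pre x n)" if n: "n0 \<preceq> n" for n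
    proof (rule rk_le)
      show "good (rk (pre x n))" using rk(1) x(3) n by blast
      have A: "pre x n \<in> Att" using x(3) n by blast
      show "pre x (n \<oplus> \<one>) \<in> members M (rk (pre x n))"
      proof (cases "my pl (pre x n)")
        case True
        then show ?thesis using att_move[OF A nU[OF n] True] x(4) n pre_Suc[OF x(1)] lh_pre[OF x(1)]
          unfolding my_def by metis
      next
        case False
        have "app (pre x n) (nth x n) \<in> T" using x(2) pre_Suc[OF x(1)] by metis
        then show ?thesis using Att_ok[OF A] nU[OF n] False unfolding ok_def pre_Suc[OF x(1)] by auto
      qed
    qed
    have le: "n0 \<preceq> n \<longrightarrow> rk (pre x n) \<preceq> ?c" for n
    proof (rule S_induction[where P="\<lambda>n. n0 \<preceq> n \<longrightarrow> rk (pre x n) \<preceq> ?c"])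
      show "S (\<lambda>e. n0 \<preceq> e 0 \<longrightarrow> rk (pre x (e 0)) \<preceq> ?c)"
        by (intro D_S D_intros F_move[OF F_rk] F_pre x(1))
      show "n0 \<preceq> \<zero> \<longrightarrow> rk (pre x \<zero>) \<preceq> ?c" using zero_le le_def not_lt0 by metis
      fix n assume IH: "n0 \<preceq> n \<longrightarrow> rk (pre x n) \<preceq> ?c"
      show "n0 \<preceq> n \<oplus> \<one> \<longrightarrow> rk (pre x (n \<oplus> \<one>)) \<preceq> ?c"
      proof
        assume "n0 \<preceq> n \<oplus> \<one>"
        then have "n0 \<preceq> n \<or> n0 = n \<oplus> \<one>" unfolding le_def lt_suc by blast
        then show "rk (pre x (n \<oplus> \<one>)) \<preceq> ?c"
          using IH step[of n] ar.order.trans[of "rk (pre x (n \<oplus> \<one>))" "rk (pre x n)" ?c] ar.order.refl by metis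
      qed
    qed
    \<comment> \<open>Codes dominate lengths, so at this length the code of the position cannot lie
      below \<open>?c\<close>.\<close>
    let ?n = "n0 \<oplus> ?c"
    have "pre x ?n \<prec> ?c"
      using members_less[OF rk(2)] x(3) le le_add1 ar.less_le_trans by metis
    then show False using n_le_pre[OF x(1), of ?n] le_add2[of ?c n0] le_lt ar.order.trans by metis
  qed
  then obtain n1 where n1: "n0 \<preceq> n1" "pre x n1 \<in> U" by blast
  have nU: "n1 \<preceq> n \<Longrightarrow> pre x n \<in> U" for n using stays_in_U x(1) n1 by blast
  have "\<not> P' x"
  proof -
    have ge: "n0 \<preceq> n" if "n1 \<preceq> n" for n using n1 that ar.order.trans by blast
    have "\<forall>n. n1 \<preceq> n \<longrightarrow> pre x n \<in> U - V0" using nU x(3) Att_U ge by blast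
    moreover have "\<forall>n. n1 \<preceq> n \<longrightarrow> is_even M n \<noteq> (\<not> pl) \<longrightarrow> nth x n = g' (pre x n)"
      using x(4) ge nU unfolding att_move_def by auto
    ultimately show ?thesis by (rule solution_lose[OF sol x(1,2)])
  qed
  then show ?thesis using n1 by blast
qed

text \<open>A play that enters \<open>U\<close> outside the attractor is in \<open>V0\<close>, where
  \<open>g\<close> secures \<open>P'\<close>; a play that never enters \<open>U\<close> fails the
  other condition.\<close>

lemma avoid_win:
  assumes x: "infinite_seq M x" "\<forall>n. pre x n \<in> T" "\<forall>n. n0 \<preceq> n \<longrightarrow> pre x n \<notin> Att"
    "\<forall>n. n0 \<preceq> n \<longrightarrow> is_even M n \<noteq> pl \<longrightarrow> nth x n = avoid_move (pre x n)"
  shows "\<not> ((\<exists>n. pre x n \<in> U) \<and> \<not> P' x)"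
proof
  assume *: "(\<exists>n. pre x n \<in> U) \<and> \<not> P' x"
  then obtain n1 where n1: "pre x n1 \<in> U" by blast
  have nU: "n1 \<preceq> n \<Longrightarrow> pre x n \<in> U" for n using stays_in_U x(1) n1 by blast
  \<comment> \<open>From this stage on the play is in \<open>U\<close> and also bound to
    \<open>avoid_move\<close>.\<close>
  let ?m = "n0 \<oplus> n1"
  have ge: "n0 \<preceq> n \<and> n1 \<preceq> n" if "?m \<preceq> n" for n using that le_add1 le_add2 ar.order.trans by metis
  have "\<forall>n. ?m \<preceq> n \<longrightarrow> pre x n \<in> U \<inter> V0" using nU x(2,3) Att_U ge by blast
  moreover have "\<forall>n. ?m \<preceq> n \<longrightarrow> is_even M n = (\<not> pl) \<longrightarrow> nth x n = g (pre x n)"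
    using x(4) ge nU unfolding avoid_move_def by auto
  ultimately have "P' x" by (rule solution_win[OF sol x(1,2)])
  then show False using * by blast
qed

lemma solution_attractor:
  "solution T UNIV pl (\<lambda>x. (\<exists>n. pre x n \<in> U) \<and> \<not> P' x) Att att_move avoid_move"
  unfolding solution_def
proof (intro conjI Att_sets Att_T F_att_move F_avoid_move ballI allI impI)
  fix s assume s: "s \<in> Att" "my pl s"
  show "app s (att_move s) \<in> Att"
  proof (cases "s \<in> U")
    case True
    then have "app s (g' s) \<in> T - V0" using s sol_at(3) Att_U by blast
    then show ?thesis using True up Att_U unfolding att_move_def by simp
  next
    case False then show ?thesis using att_move[OF s(1) False s(2)] good_sub[OF rk(1)[OF s(1)]] by blast
  qed
next
  fix s a assume s: "s \<in> Att" "\<not> my pl s" "app s a \<in> T"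
  show "app s a \<in> Att"
  proof (cases "s \<in> U")
    case True
    then have "app s a \<notin> V0" using s sol_at(4) Att_U by blast
    then show ?thesis using True up Att_U s(3) by blast
  next
    case False then show ?thesis using Att_ok[OF s(1)] s good_sub[OF rk(1)[OF s(1)]] unfolding ok_def by auto
  qed
next
  fix s assume s: "s \<in> T - Att" "\<not> my pl s"
  show "app s (avoid_move s) \<in> T - Att"
  proof (cases "s \<in> U")
    case True
    then have "app s (g s) \<in> V0" using s sol_at(1) Att_U by blast
    then show ?thesis using True up Att_U sol_at(5) unfolding avoid_move_def by auto
  next
    case False
    then obtain a where a: "app s a \<in> T \<and> app s a \<notin> Att" using s ok_Att[of s] unfolding ok_def by auto
    have "D (\<lambda>e. app s (e 0) \<in> T \<and> app s (e 0) \<notin> Att)"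
      by (intro D_intros D_Att F_app tree_sets[OF T])
    from least(1)[of "\<lambda>a. app s a \<in> T \<and> app s a \<notin> Att", OF this a] show ?thesis
      unfolding avoid_move_def using False by simp
  qed
next
  fix s a assume s: "s \<in> T - Att" "my pl s" "app s a \<in> T"
  show "app s a \<notin> Att"
  proof (cases "s \<in> U")
    case True
    then have "app s a \<in> V0" using s sol_at(2) Att_U by blast
    then show ?thesis using True up Att_U by blast
  next
    case False then show ?thesis using s ok_Att[of s] unfolding ok_def by auto
  qed
next
  fix x n0 assume "infinite_seq M x" "\<forall>n. pre x n \<in> T" "\<forall>n. n0 \<preceq> n \<longrightarrow> pre x n \<in> UNIV \<inter> Att"
    "\<forall>n. n0 \<preceq> n \<longrightarrow> is_even M n = pl \<longrightarrow> nth x n = att_move (pre x n)"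
  then show "\<exists>n. pre x n \<in> U" "\<not> P' x" using att_win[of x n0] by simp_all
next
  fix x n0 assume "infinite_seq M x" "\<forall>n. pre x n \<in> T" "\<forall>n. n0 \<preceq> n \<longrightarrow> pre x n \<in> UNIV - Att"
    "\<forall>n. n0 \<preceq> n \<longrightarrow> is_even M n \<noteq> pl \<longrightarrow> nth x n = avoid_move (pre x n)"
  then show "\<not> ((\<exists>n. pre x n \<in> U) \<and> \<not> P' x)" using avoid_win[of x n0] by simp
qed

end

section \<open>Iteration through the difference hierarchy, and determinacy\<close>

lemma ex_solution_diff:
  assumes T: "binary_choice_tree M T" and p: "sigma01 p" "set_assignment M E"
    and sol: "\<exists>V h h'. solution T UNIV (\<not> pl) P V h h'"
  shows "\<exists>V h h'. solution T UNIV pl (\<lambda>x. sat M e (E(X := x)) p \<and> \<not> P x) V h h'"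
proof -
  obtain U where U: "U \<in> sets M" "\<forall>s\<in>U. Seq s \<and> (\<forall>a. app s a \<in> U)"
    "\<forall>x. infinite_seq M x \<longrightarrow> (sat M e (E(X := x)) p \<longleftrightarrow> (\<exists>n. pre x n \<in> U))"
    using normal_form[OF p, of e X] by blast
  obtain V h h' where "solution T UNIV (\<not> pl) P V h h'" using sol by blast
  then have sol_U: "solution T U (\<not> pl) P V h h'" by (rule solution_weaken) simp_all
  have up: "app s a \<in> U" if "s \<in> U" for s a using U(2) that by blast
  have "\<exists>V h h'. solution T UNIV pl (\<lambda>x. (\<exists>n. pre x n \<in> U) \<and> \<not> P x) V h h'"
    by (intro exI, rule solution_attractor[OF T U(1) _ sol_U]) (rule up)
  then obtain V h h' where "solution T UNIV pl (\<lambda>x. (\<exists>n. pre x n \<in> U) \<and> \<not> P x) V h h'" by (elim exE)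
  then have "solution T UNIV pl (\<lambda>x. sat M e (E(X := x)) p \<and> \<not> P x) V h h'"
    by (rule solution_weaken) (use U(3) in simp_all)
  then show ?thesis by blast
qed

text \<open>With \<open>U\<close> empty the attractor consists of the positions from which
  \<open>pl\<close> can force the opponent out of \<open>T\<close>.\<close>

lemma ex_solution_False:
  assumes T: "binary_choice_tree M T"
  shows "\<exists>V h h'. solution T UNIV pl (\<lambda>x. False) V h h'"
proof -
  have "{a. False} \<in> sets M" by (rule D_set) (rule D_const)
  then have "{} \<in> sets M" by simp
  from solution_attractor[OF T this _ solution_empty, of pl undefined]
  have "solution T UNIV pl (\<lambda>x. (\<exists>n. pre x n \<in> {}) \<and> \<not> undefined x) (Att T {} {} pl)
    (att_move T {} {} pl (\<lambda>_. \<zero>)) (avoid_move T {} {} pl (\<lambda>_. \<zero>))" by blast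
  then have "solution T UNIV pl (\<lambda>x. False) (Att T {} {} pl)
    (att_move T {} {} pl (\<lambda>_. \<zero>)) (avoid_move T {} {} pl (\<lambda>_. \<zero>))" by simp
  then show ?thesis by blast
qed

lemma ex_solution:
  assumes "diff_sigma01 k p" "binary_choice_tree M T" "set_assignment M E"
  shows "\<exists>V h h'. solution T UNIV pl (\<lambda>x. sat M e (E(X := x)) p) V h h'"
  using assms(1)
\<comment> \<open>The player changes from level to level.\<close>
proof (induct arbitrary: pl)
  case (1 p)
  show ?case
    using ex_solution_diff[OF assms(2) 1 assms(3) ex_solution_False[OF assms(2)], of pl e X]
    unfolding not_False_eq_True simp_thms .
next
  case (2 p k q)
  show ?case unfolding sat.simps by (rule ex_solution_diff[OF assms(2) 2(1) assms(3) 2(3)])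
qed

text \<open>Stated for a general \<open>W\<close>, since it serves I with the set \<open>V\<close>
  and II with the set \<open>T - V\<close>. Following \<open>h\<close> keeps a play in
  \<open>W\<close> as long as it is in \<open>T\<close>, so an exit can only be the
  opponent's.\<close>

lemma follow:
  assumes T: "binary_choice_tree M T" and W: "W \<in> sets M" "W \<subseteq> T" "eps \<in> W"
    "\<And>s. s \<in> W \<Longrightarrow> my pl s \<Longrightarrow> app s (h s) \<in> W"
    "\<And>s a. s \<in> W \<Longrightarrow> \<not> my pl s \<Longrightarrow> app s a \<in> T \<Longrightarrow> app s a \<in> W"
    and x: "infinite_seq M x" "\<And>n. is_even M n = pl \<Longrightarrow> nth x n = h (pre x n)"
  shows "pre x n \<in> T \<Longrightarrow> pre x n \<in> W" and "exits T x n \<Longrightarrow> is_even M n \<noteq> pl"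
proof -
  have W': "pre x n \<in> T \<longrightarrow> pre x n \<in> W" for n
  proof (rule S_induction[where P="\<lambda>n. pre x n \<in> T \<longrightarrow> pre x n \<in> W"])
    show "S (\<lambda>e. pre x (e 0) \<in> T \<longrightarrow> pre x (e 0) \<in> W)"
      by (intro D_S D_intros F_pre x(1) W(1) tree_sets[OF T])
    show "pre x \<zero> \<in> T \<longrightarrow> pre x \<zero> \<in> W" using W(3) pre_zero[OF x(1)] by simp
    fix n assume IH: "pre x n \<in> T \<longrightarrow> pre x n \<in> W"
    show "pre x (n \<oplus> \<one>) \<in> T \<longrightarrow> pre x (n \<oplus> \<one>) \<in> W"
    proof
      assume n: "pre x (n \<oplus> \<one>) \<in> T"
      then have "pre x n \<in> W" using IH tree_pre[OF T x(1) n] le_add1 by blast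
      then show "pre x (n \<oplus> \<one>) \<in> W"
        using W(4)[of "pre x n"] W(5)[of "pre x n" "nth x n"] n x(2)[of n] lh_pre[OF x(1)]
        unfolding pre_Suc[OF x(1)] my_def by metis
    qed
  qed
  then show "pre x n \<in> T \<Longrightarrow> pre x n \<in> W" by blast
  show "is_even M n \<noteq> pl" if ex: "exits T x n"
  proof
    assume pl: "is_even M n = pl"
    have "pre x n \<in> W" using ex W' unfolding exits_def by blast
    then have "pre x (n \<oplus> \<one>) \<in> W"
      using W(4)[of "pre x n"] pl x(2)[OF pl] lh_pre[OF x(1)] unfolding pre_Suc[OF x(1)] my_def by metis
    then show False using ex W(2) unfolding exits_def by blast
  qed
qed

text \<open>A play inside \<open>T\<close> is decided by the winning clauses of
  \<open>solution\<close> with \<open>n0\<close> zero. In any other play the opponent left first by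
  \<open>follow\<close>, which \<open>psi\<close> scores for the same player.\<close>

lemma solution_determined:
  assumes T: "binary_choice_tree M T" and sol: "solution T UNIV True P V h h'"
  shows "game_determined M T P"
proof (cases "eps \<in> V")
  case True
  have \<sigma>: "strat True (strat_of True h)" by (rule strat_of[OF solution_moves(3)[OF sol]])
  have "\<exists>x. is_play M (strat_of True h) \<tau> x \<and> psi M T P x" if \<tau>: "strat False \<tau>" for \<tau>
  proof -
    obtain x where x: "is_play M (strat_of True h) \<tau> x" using ex_play[OF \<sigma> \<tau>] by blast
    then have inf: "infinite_seq M x" using is_play_iff by blast
    have mv: "nth x n = h (pre x n)" if "is_even M n = True" for n using play_moves[OF x, of True h n] that by simp
    have V: "pre x n \<in> T \<Longrightarrow> pre x n \<in> V" and ex: "exits T x n \<Longrightarrow> is_even M n \<noteq> True" for n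
      using follow[OF T solution_moves(1,2)[OF sol] True _ _ inf mv, of True n] solution_moves(5,6)[OF sol] by blast+
    have "P x" if all: "\<forall>n. pre x n \<in> T"
      by (rule solution_win[OF sol inf all, of \<zero>]) (use V all mv in auto)
    moreover have "\<exists>n. exits T x n" if "\<not> (\<forall>n. pre x n \<in> T)" using that ex_first_outside[OF T inf] by blast
    ultimately have "psi M T P x" unfolding psi_def mu_I_iff[OF inf] mu_II_iff[OF inf] using ex by blast
    then show ?thesis using x by blast
  qed
  then show ?thesis unfolding game_determined_def determined_iff using \<sigma> by blast
next
  case False
  have eps: "eps \<in> T - V" using False tree_eps[OF T] by blast
  have "D (\<lambda>e. e 0 \<in> T \<and> e 0 \<notin> V)" by (intro D_intros tree_sets[OF T] solution_moves[OF sol])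
  from D_set[of "\<lambda>s. s \<in> T \<and> s \<notin> V", OF this] have W: "T - V \<in> sets M" by (simp add: set_diff_eq)
  have \<tau>: "strat False (strat_of False h')" by (rule strat_of[OF solution_moves(4)[OF sol]])
  have "\<exists>x. is_play M \<sigma> (strat_of False h') x \<and> \<not> psi M T P x" if \<sigma>: "strat True \<sigma>" for \<sigma>
  proof -
    obtain x where x: "is_play M \<sigma> (strat_of False h') x" using ex_play[OF \<sigma> \<tau>] by blast
    then have inf: "infinite_seq M x" using is_play_iff by blast
    have mv: "nth x n = h' (pre x n)" if "is_even M n = False" for n using play_moves[OF x, of False h' n] that by simp
    have V: "pre x n \<in> T \<Longrightarrow> pre x n \<in> T - V" and ex: "exits T x n \<Longrightarrow> is_even M n \<noteq> False" for n
      using follow[OF T W _ eps _ _ inf mv, of False n] solution_moves(7,8)[OF sol] unfolding my_def by blast+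
    have "\<not> P x" if all: "\<forall>n. pre x n \<in> T"
      by (rule solution_lose[OF sol inf all, of \<zero>]) (use V all mv in auto)
    moreover have "\<exists>n. exits T x n" if "\<not> (\<forall>n. pre x n \<in> T)" using that ex_first_outside[OF T inf] by blast
    ultimately have "\<not> psi M T P x" unfolding psi_def mu_I_iff[OF inf] mu_II_iff[OF inf] using ex by blast
    then show ?thesis using x by blast
  qed
  then show ?thesis unfolding game_determined_def determined_iff using \<tau> by blast
qed

lemma diff_det: "diff_sigma01_det M k"
  unfolding diff_sigma01_det_def
proof (intro allI impI)
  fix T p X e E assume T: "binary_choice_tree M T" and E: "set_assignment M E" and p: "diff_sigma01 k p"
  show "game_determined M T (\<lambda>x. sat M e (E(X := x)) p)"
    using ex_solution[OF p T E, of True e X] solution_determined[OF T] by blast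
qed

lemma delta_det: "delta01_det M"
  unfolding delta01_det_def
proof (intro allI impI)
  fix T p q X e E assume T: "binary_choice_tree M T" and E: "set_assignment M E" and p: "sigma01 p"
  show "game_determined M T (\<lambda>x. sat M e (E(X := x)) p)"
    using diff_det[of 1] T E diff_sigma01.intros(1)[OF p] unfolding diff_sigma01_det_def by blast
qed

end

theorem theorem1:
  fixes M :: "'a l2_struct" and k :: nat
  assumes "k \<ge> 1" and "RCA0 M"
  shows "(wellfounded_det M \<longleftrightarrow> delta01_det M) \<and>
         (delta01_det M \<longleftrightarrow> diff_sigma01_det M k) \<and>
         (diff_sigma01_det M k \<longleftrightarrow> ACA0 M)"
proof -
  interpret rca0 M using assms(2) by (rule rca0.intro)
  \<comment> \<open>Either condition gives \<open>jump_closed\<close>, from which the rest follows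
    in \<open>aca0\<close>. The implications into \<open>wellfounded_det\<close> close the
    circle.\<close>
  have "delta01_det M \<and> diff_sigma01_det M k \<and> ACA0 M" if "wellfounded_det M \<or> ACA0 M"
  proof -
    have "jump_closed" using that wellfounded_jump ACA0_jump_closed by blast
    then interpret aca0 M by unfold_locales
    show ?thesis using delta_det diff_det jump_closed_ACA0 by blast
  qed
  then show ?thesis using delta01_wellfounded diff_sigma01_wellfounded[OF assms(1)] by blast
qed

end
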